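(* Let $X_0,X_1,X_2,\dots$ be a real-valued Markov chain whose Markov copula $C$ is idempotent, i.e. $C\ast C=C$. Then the sequence $X_0,X_1,\dots$ is spreadable, and hence exchangeable and conditionally i.i.d. with a random distribution $\eta$. Moreover, $X_1,X_2,\dots$ are conditionally i.i.d. given $X_0$, that is, $\sigma(\eta)\subseteq\sigma(X_0)$.
   Context: A (two-dimensional) copula is the joint distribution function of a random vector whose two marginals are uniform on $[0,1]$. By Sklar's theorem, the joint distribution function $F$ of a random vector $(X,Y)$ with marginal distribution functions $F_1,F_2$ can be written $F(x,y)=C(F_1(x),F_2(y))$ for some copula $C$, unique if $F$ is continuous; $C$ is then called the copula of $(X,Y)$. When $C$ is not unique, all possible copulas agree at points $(u,v)$ with $u$ in the range of $F_1$ and $v$ in the range of $F_2$, and by convention "the copula" of $(X,Y)$ is the one obtained from these values by interpolation that is linear in each coordinate. The Markov product $C\ast D$ of two copulas is defined as follows: if $Y_0,Y_1,Y_2$ is a Markov chain such that $(Y_0,Y_1)$ has copula $C$ and $(Y_1,Y_2)$ has copula $D$, then $C\ast D$ is the copula of $(Y_0,Y_2)$. That a Markov chain $X_0,X_1,\dots$ has Markov copula $C$ means that $C$ is the copula of each pair $(X_n,X_{n+1})$ of consecutive values, $n=0,1,\dots$. An infinite sequence $\xi_1,\xi_2,\dots$ is exchangeable if $(\xi_1,\xi_2,\dots)\stackrel{d}{=}(\xi_{k_1},\xi_{k_2},\dots)$ for all permutations $(1,2,\dots)\mapsto(k_1,k_2,\dots)$ which affect a finite set of numbers; it is spreadable if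 this equality in distribution is required only for strictly increasing sequences $k_1<k_2<\cdots$. For sequences in a Borel space both notions are equivalent to the values of the sequence being conditionally i.i.d. with a random distribution $\eta$, and then $\eta=\lim_{n\to\infty}\frac1n\sum_{k\le n}\delta_{\xi_k}$ almost surely, i.e. $\eta$ is the almost sure limit of the empirical distributions of the sequence (here the sequence is $X_0,X_1,\dots$). Here $\delta_x$ is the point mass at $x$, and $\sigma(\cdot)$ denotes the generated $\sigma$-algebra.
   Formalization: The formal theorem additionally assumes that all X_n have the same distribution; without this the claim fails (independent X_n with different laws have the idempotent independence copula but are not spreadable), and spreadability forces it. *)

theory Defs
  imports "HOL-Probability.Probability"
begin

section \<open>Copulas\<close>

text \<open>Being joint distribution functions, copulas are functions on the whole plane (not only on
  the unit square), so that equality of copulas is equality of functions.\<close>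

definition copula :: "(real \<Rightarrow> real \<Rightarrow> real) \<Rightarrow> bool" where
  "copula C \<longleftrightarrow> (\<exists>Q :: (real \<times> real) measure.
     prob_space Q \<and> sets Q = sets borel \<and>
     distr Q borel fst = uniform_measure lborel {0..1} \<and>
     distr Q borel snd = uniform_measure lborel {0..1} \<and>
     (\<forall>u v. C u v = measure Q ({..u} \<times> {..v})))"

text \<open>Sklar's identity determines a copula on the closure of the product of the ranges of the two
  marginal distribution functions \<open>F\<close>, \<open>G\<close>. What is missing are the gaps between
  \<open>F (x-) = P (X < x)\<close> and \<open>F x\<close> at the atoms \<open>x\<close> (likewise for \<open>G\<close>). There the
  interpolation is linear in each coordinate, which makes the copula of a pair unique.\<close>

definition copula_of ::
  "'a measure \<Rightarrow> ('a \<Rightarrow> real) \<Rightarrow> ('a \<Rightarrow> real) \<Rightarrow> (real \<Rightarrow> real \<Rightarrow> real) \<Rightarrow> bool" where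
  "copula_of M X Y C \<longleftrightarrow>
     (let F = cdf (distr M borel X); F_left = (\<lambda>x. measure (distr M borel X) {..<x});
          G = cdf (distr M borel Y); G_left = (\<lambda>y. measure (distr M borel Y) {..<y})
      in copula C \<and>
         (\<forall>x y. measure M {\<omega> \<in> space M. X \<omega> \<le> x \<and> Y \<omega> \<le> y} = C (F x) (G y)) \<and>
         (\<forall>x v. \<forall>t\<in>{0..1}. C ((1 - t) * F_left x + t * F x) v
                            = (1 - t) * C (F_left x) v + t * C (F x) v) \<and>
         (\<forall>u y. \<forall>t\<in>{0..1}. C u ((1 - t) * G_left y + t * G y)
                            = (1 - t) * C u (G_left y) + t * C u (G y)))"


section \<open>Markov chains and the Markov product\<close>

text \<open>The set \<open>I\<close> of times is meant to be an initial segment of the natural numbers. Neither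
  time-homogeneity nor stationarity is part of the definition.\<close>

definition markov_chain_on :: "nat set \<Rightarrow> 'a measure \<Rightarrow> (nat \<Rightarrow> 'a \<Rightarrow> real) \<Rightarrow> bool" where
  "markov_chain_on I M X \<longleftrightarrow>
     prob_space M \<and> (\<forall>i\<in>I. X i \<in> borel_measurable M) \<and>
     (\<forall>n B. Suc n \<in> I \<longrightarrow> B \<in> sets borel \<longrightarrow>
       (AE \<omega> in M.
          real_cond_exp M
            (vimage_algebra (space M) (\<lambda>\<omega>. \<lambda>i\<in>{..n}. X i \<omega>) (PiM {..n} (\<lambda>_. borel)))
            (indicator {\<omega> \<in> space M. X (Suc n) \<omega> \<in> B}) \<omega>
        = real_cond_exp M
            (vimage_algebra (space M) (X n) borel)
            (indicator {\<omega> \<in> space M. X (Suc n) \<omega> \<in> B}) \<omega>))"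

abbreviation markov_chain :: "'a measure \<Rightarrow> (nat \<Rightarrow> 'a \<Rightarrow> real) \<Rightarrow> bool" where
  "markov_chain \<equiv> markov_chain_on UNIV"

text \<open>The sample space \<open>nat \<Rightarrow> real\<close> is no restriction: only the joint law of
  \<open>(Y 0, Y 1, Y 2)\<close> matters, and it can be realised there.\<close>

definition markov_product ::
  "(real \<Rightarrow> real \<Rightarrow> real) \<Rightarrow> (real \<Rightarrow> real \<Rightarrow> real) \<Rightarrow> (real \<Rightarrow> real \<Rightarrow> real)"  (infixl "\<star>" 70) where
  "C \<star> D = (THE E. \<exists>(P :: (nat \<Rightarrow> real) measure) Y.
     markov_chain_on {0, 1, 2} P Y \<and>
     copula_of P (Y 0) (Y 1) C \<and> copula_of P (Y 1) (Y 2) D \<and> copula_of P (Y 0) (Y 2) E)"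


section \<open>Spreadable, exchangeable and conditionally i.i.d. sequences\<close>

definition same_law ::
  "'a measure \<Rightarrow> (nat \<Rightarrow> 'a \<Rightarrow> real) \<Rightarrow> (nat \<Rightarrow> 'a \<Rightarrow> real) \<Rightarrow> bool" where
  "same_law M X Y \<longleftrightarrow>
     distr M (PiM UNIV (\<lambda>_. borel)) (\<lambda>\<omega> n. X n \<omega>) =
     distr M (PiM UNIV (\<lambda>_. borel)) (\<lambda>\<omega> n. Y n \<omega>)"

definition spreadable :: "'a measure \<Rightarrow> (nat \<Rightarrow> 'a \<Rightarrow> real) \<Rightarrow> bool" where
  "spreadable M X \<longleftrightarrow> (\<forall>k :: nat \<Rightarrow> nat. strict_mono k \<longrightarrow> same_law M X (\<lambda>n. X (k n)))"

definition exchangeable :: "'a measure \<Rightarrow> (nat \<Rightarrow> 'a \<Rightarrow> real) \<Rightarrow> bool" where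
  "exchangeable M X \<longleftrightarrow>
     (\<forall>k :: nat \<Rightarrow> nat. bij k \<longrightarrow> finite {n. k n \<noteq> n} \<longrightarrow> same_law M X (\<lambda>n. X (k n)))"

abbreviation sigma_rv :: "'a measure \<Rightarrow> ('a \<Rightarrow> real) \<Rightarrow> 'a measure" where
  "sigma_rv M Z \<equiv> vimage_algebra (space M) Z borel"

abbreviation sigma_distribution :: "'a measure \<Rightarrow> ('a \<Rightarrow> real measure) \<Rightarrow> 'a measure" where
  "sigma_distribution M \<eta> \<equiv> vimage_algebra (space M) \<eta> (prob_algebra borel)"

text \<open>Given the \<open>\<sigma>\<close>-algebra \<open>G\<close>, the variables \<open>X 0, X 1, \<dots>\<close> are independent
  with common conditional distribution \<open>\<eta>\<close>, a \<open>G\<close>-measurable random distribution.\<close>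

definition cond_iid_given ::
  "'a measure \<Rightarrow> 'a measure \<Rightarrow> (nat \<Rightarrow> 'a \<Rightarrow> real) \<Rightarrow> ('a \<Rightarrow> real measure) \<Rightarrow> bool" where
  "cond_iid_given M G X \<eta> \<longleftrightarrow>
     subalgebra M G \<and> \<eta> \<in> measurable G (prob_algebra borel) \<and>
     (\<forall>n B. (\<forall>i<n. B i \<in> sets borel) \<longrightarrow>
       (AE \<omega> in M.
          real_cond_exp M G (indicator {\<omega> \<in> space M. \<forall>i<n. X i \<omega> \<in> B i}) \<omega>
        = (\<Prod>i<n. measure (\<eta> \<omega>) (B i))))"

abbreviation cond_iid ::
  "'a measure \<Rightarrow> (nat \<Rightarrow> 'a \<Rightarrow> real) \<Rightarrow> ('a \<Rightarrow> real measure) \<Rightarrow> bool" where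
  "cond_iid M X \<eta> \<equiv> cond_iid_given M (sigma_distribution M \<eta>) X \<eta>"

text \<open>Almost sure convergence of the empirical distributions, tested on every Borel set. It implies
  that almost surely the empirical distributions converge weakly.\<close>

definition empirical_limit ::
  "'a measure \<Rightarrow> (nat \<Rightarrow> 'a \<Rightarrow> real) \<Rightarrow> ('a \<Rightarrow> real measure) \<Rightarrow> bool" where
  "empirical_limit M X \<eta> \<longleftrightarrow>
     (\<forall>B\<in>sets borel. AE \<omega> in M.
        (\<lambda>n. (\<Sum>k<n. indicator B (X k \<omega>)) / real n) \<longlonglongrightarrow> measure (\<eta> \<omega>) B)"

end

(* Conditioning one variable of a pair on the other turns a copula C into a family of functions on
   the unit interval: for every u the map s |-> C u s has a density c, obtained by composing a
   conditional probability with a quantile function, and along a Markov chain the copula of the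
   outer pair is the integral of a product of two such densities.  These densities are determined
   by the copulas alone, so the Markov product is well defined and C * C = C says that (X0, X2) and
   (X0, X1) have the same law.  If kappa is the transition kernel of the chain and
   h x = kappa x B, then E[h X0 * h X1] = E[(h X0)^2] = E[(h X1)^2], so h X1 = h X0 almost surely.
   Hence kappa(Xn) is almost surely the same random distribution eta = kappa(X0) for all n, and the
   Markov property makes X1, X2, ... conditionally i.i.d. with distribution eta given X0. *)

theory Submission
  imports Defs
begin

text \<open>\<open>C \<star> C\<close> is a definite description over all triples with the given
  copulas; their marginals are arbitrary and may have atoms. It says something about (X0, X2) only
  once the outer copula is known not to depend on the triple and (X0, X2) is known to have a copula
  in the interpolated sense. Atoms are the obstacle in both: they are counted fractionally, through
  a weight in [0,1] for uniqueness and through an independent uniform variable for existence. The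
  unit interval is the common ground of triples with different marginals.

  The value E[h X0 * h X1] = E[(h X0)^2] comes from computing E[h X0 * 1_B(X2)] twice: by the Markov
  property at time 1, and by replacing (X0, X2) with the equally distributed (X0, X1). Equal
  marginals then give E[(h X1 - h X0)^2] = 0.

  Given X0 itself, X0 is degenerate, so it can join the conditionally i.i.d. sequence only given
  kappa(X0). Tests that are functions of kappa(X0) almost surely do not change when X0 is replaced
  by X1, and this moves the statement for X0 to time 1.\<close>

section \<open>Sub-sigma-algebras generated by a map, and bounded integrands\<close>

lemma (in prob_space) subalgebra_vimage:
  assumes "Y \<in> measurable M N"
  shows "subalgebra M (vimage_algebra (space M) Y N)"
  using measurable_sets[OF assms] measurable_space[OF assms]
  by (auto simp: subalgebra_def sets_vimage_algebra2 Pi_iff)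

lemma (in prob_space) sigma_finite_subalgebra_of:
  assumes "subalgebra M F"
  shows "sigma_finite_subalgebra M F"
proof -
  interpret finite_measure_subalgebra M F
    using assms by unfold_locales
  show ?thesis by unfold_locales
qed

lemma (in finite_measure) integrable_bounded:
  fixes f :: "'a \<Rightarrow> real"
  assumes "f \<in> borel_measurable M" "\<And>x. \<bar>f x\<bar> \<le> c"
  shows "integrable M f"
  using assms by (intro integrable_const_bound[where B=c]) auto

section \<open>Regular conditional distributions\<close>

text \<open>The disintegration identity is imposed on rectangles as an equality of integrals. So it
  carries no exceptional null set and depends on the joint law of \<open>(X, Z)\<close> only, and
  one \<open>\<kappa>\<close> can serve all pairs with the same law.\<close>

definition cond_kernel ::
  "'a measure \<Rightarrow> ('a \<Rightarrow> real) \<Rightarrow> ('a \<Rightarrow> real) \<Rightarrow> (real \<Rightarrow> real measure) \<Rightarrow> bool" where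
  "cond_kernel M X Z \<kappa> \<longleftrightarrow>
     \<kappa> \<in> measurable borel (prob_algebra borel) \<and>
     (\<forall>A\<in>sets borel. \<forall>B\<in>sets borel.
        (\<integral>\<omega>. indicator A (X \<omega>) * indicator B (Z \<omega>) \<partial>M :: real) =
        (\<integral>\<omega>. indicator A (X \<omega>) * measure (\<kappa> (X \<omega>)) B \<partial>M))"

lemma
  fixes \<kappa> :: "real \<Rightarrow> real measure"
  assumes "\<kappa> \<in> measurable borel (prob_algebra borel)"
  shows prob_space_kernel: "prob_space (\<kappa> x)" and sets_kernel: "sets (\<kappa> x) = sets borel"
    and real_distribution_kernel: "real_distribution (\<kappa> x)"
proof -
  have "\<kappa> x \<in> space (prob_algebra borel)"
    using measurable_space[OF assms] by simp
  then show "prob_space (\<kappa> x)" "sets (\<kappa> x) = sets borel"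
    by (auto simp: space_prob_algebra)
  then show "real_distribution (\<kappa> x)"
    by (simp add: real_distribution_def real_distribution_axioms_def)
qed

lemma measurable_kernel_measure [measurable (raw)]:
  assumes "\<kappa> \<in> measurable M (prob_algebra borel)" "B \<in> sets borel"
  shows "(\<lambda>x. measure (\<kappa> x) B) \<in> borel_measurable M"
  using measurable_compose[OF measurable_prob_algebraD[OF assms(1)] measurable_measure_subprob_algebra[OF assms(2)]] .

lemma kernel_measure_le_1:
  fixes \<kappa> :: "real \<Rightarrow> real measure"
  assumes "\<kappa> \<in> measurable borel (prob_algebra borel)"
  shows "measure (\<kappa> x) B \<le> 1"
  using prob_space.prob_le_1[OF prob_space_kernel[OF assms]] .

lemma (in prob_space) vimage_algebra_setE:
  assumes "A \<in> sets (vimage_algebra (space M) Y N)" "Y \<in> measurable M N"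
  obtains A' where "A' \<in> sets N" "A = Y -` A' \<inter> space M"
  using assms measurable_space[OF assms(2)] by (auto simp: sets_vimage_algebra2)

text \<open>The sets of the sigma-algebra generated by \<open>X\<close> are the preimages of Borel
  sets, and on these the defining identity of \<open>cond_kernel\<close> is the characterization of
  a conditional expectation.\<close>

lemma (in prob_space) cond_kernel_real_cond_exp:
  assumes X: "X \<in> borel_measurable M" and Z: "Z \<in> borel_measurable M"
    and k: "cond_kernel M X Z \<kappa>" and B: "B \<in> sets borel"
  shows "AE \<omega> in M. real_cond_exp M (vimage_algebra (space M) X borel)
     (indicator {\<omega>\<in>space M. Z \<omega> \<in> B}) \<omega> = measure (\<kappa> (X \<omega>)) B"
proof -
  let ?F = "vimage_algebra (space M) X borel"
  interpret sigma_finite_subalgebra M ?F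
    by (intro sigma_finite_subalgebra_of subalgebra_vimage X)
  have \<kappa>[measurable]: "\<kappa> \<in> measurable borel (prob_algebra borel)"
    using k by (simp add: cond_kernel_def)
  note [measurable] = X Z B
  show ?thesis
  proof (rule real_cond_exp_charact)
    fix A assume "A \<in> sets ?F"
    then obtain A' where A': "A' \<in> sets borel" "A = X -` A' \<inter> space M"
      using X by (rule vimage_algebra_setE)
    have "(\<integral>\<omega>\<in>A. indicator {\<omega>\<in>space M. Z \<omega> \<in> B} \<omega> \<partial>M)
        = (\<integral>\<omega>. indicator A' (X \<omega>) * indicator B (Z \<omega>) \<partial>M :: real)"
      unfolding set_lebesgue_integral_def A'(2)
      by (intro Bochner_Integration.integral_cong) (auto split: split_indicator)
    also have "\<dots> = (\<integral>\<omega>. indicator A' (X \<omega>) * measure (\<kappa> (X \<omega>)) B \<partial>M)"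
      using k A'(1) B by (simp add: cond_kernel_def)
    also have "\<dots> = (\<integral>\<omega>\<in>A. measure (\<kappa> (X \<omega>)) B \<partial>M)"
      unfolding set_lebesgue_integral_def A'(2)
      by (intro Bochner_Integration.integral_cong) (auto split: split_indicator)
    finally show "(\<integral>\<omega>\<in>A. indicator {\<omega>\<in>space M. Z \<omega> \<in> B} \<omega> \<partial>M) = (\<integral>\<omega>\<in>A. measure (\<kappa> (X \<omega>)) B \<partial>M)" .
  next
    show "integrable M (indicator {\<omega>\<in>space M. Z \<omega> \<in> B} :: 'a \<Rightarrow> real)"
      by (rule integrable_bounded[where c=1]) (auto split: split_indicator)
    show "integrable M (\<lambda>\<omega>. measure (\<kappa> (X \<omega>)) B)"
      by (rule integrable_bounded[where c=1]) (auto simp: kernel_measure_le_1[OF \<kappa>])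
    show "(\<lambda>\<omega>. measure (\<kappa> (X \<omega>)) B) \<in> borel_measurable ?F"
      by (rule measurable_compose[OF measurable_vimage_algebra1]) (use B in measurable)
  qed
qed

text \<open>The passage from indicators to a bounded \<open>g\<close> needs no approximation by
  simple functions: \<open>g (X \<omega>)\<close> is pulled out of the conditional
  expectation.\<close>

lemma (in prob_space) cond_kernel_integral:
  assumes X: "X \<in> borel_measurable M" and Z: "Z \<in> borel_measurable M"
    and k: "cond_kernel M X Z \<kappa>" and B: "B \<in> sets borel"
    and g: "g \<in> borel_measurable borel" and bd: "\<And>x. \<bar>g x\<bar> \<le> (c::real)"
  shows "(\<integral>\<omega>. g (X \<omega>) * indicator B (Z \<omega>) \<partial>M) = (\<integral>\<omega>. g (X \<omega>) * measure (\<kappa> (X \<omega>)) B \<partial>M)"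
proof -
  let ?F = "vimage_algebra (space M) X borel"
  interpret sigma_finite_subalgebra M ?F
    by (intro sigma_finite_subalgebra_of subalgebra_vimage X)
  have \<kappa>[measurable]: "\<kappa> \<in> measurable borel (prob_algebra borel)"
    using k by (simp add: cond_kernel_def)
  note [measurable] = X Z B g
  let ?i = "indicator {\<omega>\<in>space M. Z \<omega> \<in> B} :: 'a \<Rightarrow> real"
  have gF: "(\<lambda>\<omega>. g (X \<omega>)) \<in> borel_measurable ?F"
    by (rule measurable_compose[OF measurable_vimage_algebra1]) (use g in auto)
  have "(\<integral>\<omega>. g (X \<omega>) * indicator B (Z \<omega>) \<partial>M) = (\<integral>\<omega>. g (X \<omega>) * ?i \<omega> \<partial>M)"
    by (intro Bochner_Integration.integral_cong) (auto split: split_indicator)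
  also have "\<dots> = (\<integral>\<omega>. g (X \<omega>) * real_cond_exp M ?F ?i \<omega> \<partial>M)"
  proof (rule real_cond_exp_intg(2)[symmetric, OF _ gF])
    show "integrable M (\<lambda>\<omega>. g (X \<omega>) * ?i \<omega>)"
      using bd order_trans[OF abs_ge_zero bd]
      by (intro integrable_bounded[where c=c]) (auto split: split_indicator)
  qed measurable
  also have "\<dots> = (\<integral>\<omega>. g (X \<omega>) * measure (\<kappa> (X \<omega>)) B \<partial>M)"
    using cond_kernel_real_cond_exp[OF X Z k B]
    by (intro integral_cong_AE) auto
  finally show ?thesis .
qed

text \<open>For fixed \<open>A\<close> both sides are finite Borel measures in \<open>B\<close>: the
  law of \<open>Z\<close> on the event that \<open>X\<close> lies in \<open>A\<close>, and the
  mixture of the \<open>\<kappa> (X \<omega>)\<close> over that event. Equal distribution functions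
  make them equal.\<close>

lemma (in prob_space) cond_kernelI:
  assumes X: "X \<in> borel_measurable M" and Z: "Z \<in> borel_measurable M"
    and \<kappa>: "\<kappa> \<in> measurable borel (prob_algebra borel)"
    and eq: "\<And>A y. A \<in> sets borel \<Longrightarrow>
        (\<integral>\<omega>. indicator A (X \<omega>) * indicator {..y} (Z \<omega>) \<partial>M) =
        (\<integral>\<omega>. indicator A (X \<omega>) * measure (\<kappa> (X \<omega>)) {..y} \<partial>M)"
  shows "cond_kernel M X Z \<kappa>"
  unfolding cond_kernel_def
proof (intro conjI ballI \<kappa>)
  fix A B :: "real set" assume A: "A \<in> sets borel" and B: "B \<in> sets borel"
  note [measurable] = X Z A \<kappa>
  let ?D = "density M (\<lambda>\<omega>. indicator A (X \<omega>))"
  let ?N1 = "distr ?D borel Z"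
  let ?N2 = "bind ?D (\<lambda>\<omega>. \<kappa> (X \<omega>))"
  have \<kappa>X: "(\<lambda>\<omega>. \<kappa> (X \<omega>)) \<in> measurable ?D (subprob_algebra borel)"
    by (rule measurable_prob_algebraD) measurable
  have s2: "sets ?N2 = sets borel"
    by (rule sets_bind[OF sets_kernel[OF \<kappa>]]) (simp add: not_empty)
  have e1: "emeasure ?N1 B = ennreal (\<integral>\<omega>. indicator A (X \<omega>) * indicator B (Z \<omega>) \<partial>M)"
    if [measurable]: "B \<in> sets borel" for B
  proof -
    have "emeasure ?N1 B = (\<integral>\<^sup>+\<omega>. indicator A (X \<omega>) * indicator (Z -` B \<inter> space M) \<omega> \<partial>M)"
      by (subst emeasure_distr) (auto simp: emeasure_density intro!: measurable_sets_borel)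
    also have "\<dots> = (\<integral>\<^sup>+\<omega>. ennreal (indicator A (X \<omega>) * indicator B (Z \<omega>)) \<partial>M)"
      by (intro nn_integral_cong) (auto split: split_indicator)
    also have "\<dots> = ennreal (\<integral>\<omega>. indicator A (X \<omega>) * indicator B (Z \<omega>) \<partial>M)"
      by (intro nn_integral_eq_integral integrable_bounded[where c=1])
        (auto split: split_indicator)
    finally show ?thesis .
  qed
  have e2: "emeasure ?N2 B = ennreal (\<integral>\<omega>. indicator A (X \<omega>) * measure (\<kappa> (X \<omega>)) B \<partial>M)"
    if [measurable]: "B \<in> sets borel" for B
  proof -
    have "emeasure ?N2 B = (\<integral>\<^sup>+\<omega>. emeasure (\<kappa> (X \<omega>)) B \<partial>?D)"
      by (rule emeasure_bind[OF _ \<kappa>X]) (auto simp: not_empty)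
    also have "\<dots> = (\<integral>\<^sup>+\<omega>. indicator A (X \<omega>) * emeasure (\<kappa> (X \<omega>)) B \<partial>M)"
      using measurable_emeasure_kernel[OF \<kappa>X that] by (subst nn_integral_density) auto
    also have "\<dots> = (\<integral>\<^sup>+\<omega>. ennreal (indicator A (X \<omega>) * measure (\<kappa> (X \<omega>)) B) \<partial>M)"
      using prob_space.finite_measure[OF prob_space_kernel[OF \<kappa>], THEN finite_measure.emeasure_eq_measure]
      by (intro nn_integral_cong) (auto split: split_indicator)
    also have "\<dots> = ennreal (\<integral>\<omega>. indicator A (X \<omega>) * measure (\<kappa> (X \<omega>)) B \<partial>M)"
      using kernel_measure_le_1[OF \<kappa>]
      by (intro nn_integral_eq_integral integrable_bounded[where c=1])
        (auto split: split_indicator)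
    finally show ?thesis .
  qed
  have "?N1 = ?N2"
  proof (rule cdf_unique')
    show "finite_borel_measure ?N1"
      using e1[of UNIV] by (intro finite_borel_measure.intro finite_measureI finite_borel_measure_axioms.intro)
         (auto simp: space_distr)
    show "finite_borel_measure ?N2"
      using e2[of UNIV] sets_eq_imp_space_eq[OF s2]
      by (intro finite_borel_measure.intro finite_measureI finite_borel_measure_axioms.intro)
         (auto simp: s2)
    show "cdf ?N1 = cdf ?N2"
      unfolding cdf_def measure_def by (simp add: e1 e2 eq[OF A])
  qed
  then have "ennreal (\<integral>\<omega>. indicator A (X \<omega>) * indicator B (Z \<omega>) \<partial>M)
      = ennreal (\<integral>\<omega>. indicator A (X \<omega>) * measure (\<kappa> (X \<omega>)) B \<partial>M)"
    using e1[OF B] e2[OF B] by simp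
  then show "(\<integral>\<omega>. indicator A (X \<omega>) * indicator B (Z \<omega>) \<partial>M) =
        (\<integral>\<omega>. indicator A (X \<omega>) * measure (\<kappa> (X \<omega>)) B \<partial>M)"
    by (subst (asm) ennreal_inj) auto
qed

section \<open>Existence of regular conditional distributions\<close>

text \<open>Conditional expectations of the half-line indicators at rational levels are regularized
  into genuine distribution functions. Since the second coordinate lies almost surely in the open
  unit interval, the values 0 to the left of 0 and 1 from 1 onwards can simply be
  prescribed.\<close>

lemma cond_kernel_exists_unit_interval:
  fixes Q :: "(real \<times> real) measure"
  assumes "prob_space Q" and sQ: "sets Q = sets (borel \<Otimes>\<^sub>M borel)"
    and unit: "AE p in Q. 0 < snd p \<and> snd p < 1"
  shows "\<exists>\<kappa>. cond_kernel Q fst snd \<kappa>"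
proof -
  interpret prob_space Q by fact
  have spQ: "space Q = UNIV"
    using sets_eq_imp_space_eq[OF sQ] by (simp add: space_pair_measure)
  have [measurable]: "fst \<in> borel_measurable Q" "snd \<in> borel_measurable Q"
    by (auto cong: measurable_cong_sets[OF sQ refl])
  let ?F = "vimage_algebra (space Q) fst (borel :: real measure)"
  have F: "subalgebra Q ?F"
    by (rule subalgebra_vimage) measurable
  interpret sigma_finite_subalgebra Q ?F
    by (intro sigma_finite_subalgebra_of F)
  let ?i = "\<lambda>y p. indicator {..y} (snd p) :: real"
  have int_i: "integrable Q (?i y)" for y
    by (rule integrable_bounded[where c=1]) (auto split: split_indicator)
  define c where "c y = real_cond_exp Q ?F (?i y)" for y
  have cF[measurable]: "c y \<in> borel_measurable ?F" for y
    unfolding c_def by measurable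
  have cQ[measurable]: "c y \<in> borel_measurable Q" for y
    by (rule measurable_from_subalg[OF F cF])
  have int_c: "integrable Q (c y)" for y
    unfolding c_def by (rule real_cond_exp_int(1)[OF int_i])
  \<comment> \<open>Measurability with respect to the first coordinate makes \<open>c y\<close>
    constant on vertical lines, so evaluation at the arbitrary height 0 factors it through that
    coordinate.\<close>
  have c_fst: "c y (x, z) = c y (x, 0)" for x y z
  proof -
    have "c y -` {c y (x, 0)} \<inter> space ?F \<in> sets ?F"
      by (rule measurable_sets[OF cF]) simp
    then obtain A where "c y -` {c y (x, 0)} \<inter> space ?F = fst -` A \<inter> space Q"
      by (rule vimage_algebra_setE) measurable
    then have A: "c y (a, b) = c y (x, 0) \<longleftrightarrow> a \<in> A" for a b
      by (auto simp: spQ set_eq_iff)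
    from A[of x 0] A[of x z] show ?thesis by simp
  qed
  have c_01: "AE p in Q. 0 \<le> c y p \<and> c y p \<le> 1" for y
  proof -
    have "AE p in Q. 0 \<le> c y p"
      unfolding c_def by (rule real_cond_exp_pos) auto
    moreover have "AE p in Q. c y p \<le> 1"
      unfolding c_def by (rule real_cond_exp_le_c[OF int_i]) (auto split: split_indicator)
    ultimately show ?thesis by auto
  qed
  have c_mono: "AE p in Q. c y p \<le> c y' p" if "y \<le> y'" for y y'
    unfolding c_def using that
    by (intro real_cond_exp_mono int_i) (auto split: split_indicator)
  \<comment> \<open>Clamping turns the almost sure bounds on \<open>c\<close> into bounds for every
    \<open>x\<close>; the prescribed value 1 for \<open>1 \<le> q\<close> forces the distribution
    functions to reach 1.\<close>
  define G where "G q x = (if 1 \<le> q then 1 else max 0 (min 1 (c q (x, 0))))" for q x :: real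
  have G01: "0 \<le> G q x" "G q x \<le> 1" for q x
    by (auto simp: G_def)
  have G_AE: "AE p in Q. G q (fst p) = c q p" if "q < 1" for q
    using c_01[of q]
  proof eventually_elim
    fix p assume "0 \<le> c q p \<and> c q p \<le> 1"
    with that show "G q (fst p) = c q p"
      using c_fst[of q "fst p" "snd p"] by (simp add: G_def)
  qed
  have [measurable]: "G q \<in> borel_measurable borel" for q
  proof -
    have "(\<lambda>x. (x, 0)) \<in> measurable borel Q"
      by (subst measurable_cong_sets[OF refl sQ]) measurable
    from measurable_compose[OF this cQ[of q]]
    show ?thesis unfolding G_def by measurable
  qed
  \<comment> \<open>As an infimum over rationals above \<open>y\<close>, \<open>H x\<close> is monotone and right-continuous for every \<open>x\<close>,
    so that no exceptional null set has to be removed.\<close>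
  define R where "R y = {q \<in> \<rat>. y < q}" for y :: real
  have R_ne: "R y \<noteq> {}" for y
    using Rats_dense_in_real[of y "y + 1"] by (auto simp: R_def)
  have bdd: "bdd_below ((\<lambda>q. G q x) ` S)" for x S
    using G01(1) by (auto intro!: bdd_belowI[where m=0])
  define H where "H x y = (if y < 0 then 0 else INF q\<in>R y. G q x)" for x y
  have H_le: "H x y \<le> G q x" if "q \<in> R y" for x y q
    using that cINF_lower[OF bdd that] G01 by (auto simp: H_def)
  have H_ge: "z \<le> H x y" if "0 \<le> y" "\<And>q. q \<in> R y \<Longrightarrow> z \<le> G q x" for x y z
    using that by (auto simp: H_def intro!: cINF_greatest R_ne)
  have H0: "0 \<le> H x y" for x y
    using H_ge[of y 0 x] G01 by (cases "y < 0") (auto simp: H_def)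
  have H1: "H x y \<le> 1" for x y
    using R_ne[of y] H_le[of _ y x] G01 by (meson all_not_in_conv order_trans)
  have H_1: "H x y = 1" if "1 \<le> y" for x y
    using that H_ge[of y 1 x] H1[of x y] by (force simp: R_def G_def)
  have H_mono: "H x y \<le> H x y'" if "y \<le> y'" for x y y'
  proof (cases "y < 0")
    case True then show ?thesis using H0 by (simp add: H_def)
  next
    case False then show ?thesis
      using that by (intro H_ge H_le) (auto simp: R_def)
  qed
  have H_rc: "continuous (at_right a) (H x)" for a x
  proof (cases "a < 0")
    case True
    then have "eventually (\<lambda>y. H x a = H x y) (at_right a)"
      by (auto simp: eventually_at_right H_def intro!: exI[of _ 0])
    then show ?thesis
      unfolding continuous_within by (rule Lim_transform_eventually[OF tendsto_const])
  next
    case False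
    show ?thesis unfolding continuous_within
    proof (rule order_tendstoI)
      fix l assume "l < H x a"
      then have "\<And>y. a < y \<Longrightarrow> l < H x y"
        using H_mono[of a] less_le_trans by (meson less_imp_le)
      then show "eventually (\<lambda>y. l < H x y) (at_right a)"
        by (auto simp: eventually_at_right_less eventually_at_topological intro!: exI[of _ UNIV])
    next
      fix l assume "H x a < l"
      then obtain q where q: "q \<in> R a" "G q x < l"
        using False by (auto simp: H_def cINF_less_iff[OF R_ne bdd])
      then have "H x y < l" if "a < y" "y < q" for y
        using H_le[of q y x] that by (auto simp: R_def)
      moreover have "a < q" using q by (simp add: R_def)
      ultimately show "eventually (\<lambda>y. H x y < l) (at_right a)"
        by (auto simp: eventually_at_right)
    qed
  qed
  have H_bot: "(H x \<longlongrightarrow> 0) at_bot" for x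
    by (rule tendsto_eventually) (auto simp: eventually_at_bot_dense H_def intro!: exI[of _ 0])
  have H_top: "(H x \<longlongrightarrow> 1) at_top" for x
    using H_1 by (intro tendsto_eventually) (auto simp: eventually_at_top_linorder)
  define \<kappa> where "\<kappa> x = interval_measure (H x)" for x
  have rd: "real_distribution (\<kappa> x)" for x
    unfolding \<kappa>_def by (rule real_distribution_interval_measure[OF H_mono H_rc H_bot H_top])
  have \<kappa>_m: "measure (\<kappa> x) {..y} = H x y" for x y
    unfolding \<kappa>_def by (rule measure_interval_measure_Iic[OF H_mono H_rc H_bot])
  have \<kappa>_e: "emeasure (\<kappa> x) {..y} = ennreal (H x y)" for x y
  proof -
    interpret k: real_distribution "\<kappa> x" by (rule rd)
    show ?thesis by (simp add: k.emeasure_eq_measure \<kappa>_m)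
  qed
  have H_meas[measurable]: "(\<lambda>x. H x y) \<in> borel_measurable borel" for y
  proof -
    have "countable (R y)" unfolding R_def
      by (rule countable_subset[OF _ countable_rat]) auto
    then show ?thesis
      unfolding H_def by (cases "y < 0") (auto intro!: borel_measurable_cINF bdd)
  qed
  have \<kappa>_meas: "\<kappa> \<in> measurable borel (prob_algebra borel)"
  proof (rule measurable_prob_algebra_generated[where \<Omega>=UNIV and G="range atMost"])
    show "sets borel = sigma_sets UNIV (range (atMost :: real \<Rightarrow> _))"
      by (subst borel_eq_atMost) simp
    show "Int_stable (range (atMost :: real \<Rightarrow> _))"
      by (auto simp: Int_stable_def min_def)
  qed (use rd in \<open>auto simp: \<kappa>_e real_distribution_def real_distribution_axioms_def\<close>)
  \<comment> \<open>Monotonicity gives \<open>c y \<le> H\<close> almost surely. Conversely the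
    integral of \<open>H\<close> is at most the distribution function of the second coordinate at
    every rational \<open>q > y\<close>, hence by right-continuity at \<open>y\<close>, where it
    equals the integral of \<open>c y\<close>. A nonnegative difference with integral at most 0
    vanishes almost surely.\<close>
  have H_AE: "AE p in Q. H (fst p) y = c y p" if "0 \<le> y" for y
  proof -
    have "AE p in Q. c y p \<le> G q (fst p)" if "q \<in> R y" for q
    proof (cases "1 \<le> q")
      case True with c_01[of y] show ?thesis by (auto simp: G_def)
    next
      case False
      then have "AE p in Q. G q (fst p) = c q p" by (intro G_AE) simp
      with c_mono[of y q] that show ?thesis by (auto simp: R_def)
    qed
    moreover have "countable (R y)" unfolding R_def
      by (rule countable_subset[OF _ countable_rat]) auto
    ultimately have "AE p in Q. \<forall>q\<in>R y. c y p \<le> G q (fst p)"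
      by (subst AE_ball_countable) auto
    then have le: "AE p in Q. c y p \<le> H (fst p) y"
      by eventually_elim (use \<open>0 \<le> y\<close> in \<open>auto intro!: H_ge\<close>)
    have iH: "integrable Q (\<lambda>p. H (fst p) y)"
      by (rule integrable_bounded[where c=1]) (auto simp: H0 H1)
    interpret S: real_distribution "distr Q borel snd" by simp
    have iq: "(\<integral>p. ?i q p \<partial>Q) = cdf (distr Q borel snd) q" for q
      by (subst integral_distr[symmetric, of snd Q borel "indicator {..q}"]) (auto simp: cdf_def)
    have ub: "(\<integral>p. H (fst p) y \<partial>Q) \<le> cdf (distr Q borel snd) q" if "q \<in> R y" for q
    proof -
      have "(\<integral>p. H (fst p) y \<partial>Q) \<le> (\<integral>p. G q (fst p) \<partial>Q)"
        using that by (intro integral_mono iH integrable_bounded[where c=1] H_le) (auto simp: G01)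
      also have "\<dots> = cdf (distr Q borel snd) q"
      proof (cases "1 \<le> q")
        case True
        have "(\<integral>p. ?i q p \<partial>Q) = (\<integral>p. 1 \<partial>Q)"
          using unit True by (intro integral_cong_AE) auto
        then show ?thesis using True by (simp add: G_def iq prob_space)
      next
        case False
        then have "(\<integral>p. G q (fst p) \<partial>Q) = (\<integral>p. c q p \<partial>Q)"
          by (intro integral_cong_AE G_AE) auto
        also have "\<dots> = (\<integral>p. ?i q p \<partial>Q)"
          unfolding c_def by (rule real_cond_exp_int(2)[OF int_i])
        finally show ?thesis by (simp add: iq)
      qed
      finally show ?thesis .
    qed
    have "(\<integral>p. H (fst p) y \<partial>Q) \<le> cdf (distr Q borel snd) y"
    proof (rule ccontr)
      assume "\<not> ?thesis"
      then have "eventually (\<lambda>z. cdf (distr Q borel snd) z < (\<integral>p. H (fst p) y \<partial>Q)) (at_right y)"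
        using S.cdf_is_right_cont[of y] by (auto simp: continuous_within order_tendsto_iff)
      then obtain b where b: "y < b" "\<And>z. y < z \<Longrightarrow> z < b \<Longrightarrow> cdf (distr Q borel snd) z < (\<integral>p. H (fst p) y \<partial>Q)"
        by (auto simp: eventually_at_right_field)
      then obtain q where "q \<in> \<rat>" "y < q" "q < b" using Rats_dense_in_real by blast
      with b(2)[of q] ub[of q] show False by (auto simp: R_def)
    qed
    also have "\<dots> = (\<integral>p. c y p \<partial>Q)"
      unfolding iq[symmetric] c_def by (rule real_cond_exp_int(2)[OF int_i, symmetric])
    finally have "(\<integral>p. H (fst p) y - c y p \<partial>Q) \<le> 0"
      using iH int_c by simp
    moreover have "AE p in Q. 0 \<le> H (fst p) y - c y p" using le by auto
    ultimately have "AE p in Q. H (fst p) y - c y p = 0"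
      using iH int_c integral_nonneg_AE[of "\<lambda>p. H (fst p) y - c y p" Q]
      by (subst integral_nonneg_eq_0_iff_AE[symmetric]) auto
    then show ?thesis by auto
  qed
  have "cond_kernel Q fst snd \<kappa>"
  proof (rule cond_kernelI[OF _ _ \<kappa>_meas])
    fix A :: "real set" and y assume A[measurable]: "A \<in> sets borel"
    show "(\<integral>p. indicator A (fst p) * indicator {..y} (snd p) \<partial>Q) =
        (\<integral>p. indicator A (fst p) * measure (\<kappa> (fst p)) {..y} \<partial>Q)"
    proof (cases "y < 0")
      case True
      then have "(\<integral>p. indicator A (fst p) * indicator {..y} (snd p) \<partial>Q) = (\<integral>p. 0 \<partial>Q :: real)"
        using unit by (intro integral_cong_AE) auto
      with True show ?thesis by (simp add: \<kappa>_m H_def)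
    next
      case False
      have "(\<integral>p. indicator A (fst p) * ?i y p \<partial>Q) = (\<integral>p. indicator A (fst p) * c y p \<partial>Q)"
        unfolding c_def
        by (rule real_cond_exp_intg(2)[symmetric])
           (auto intro!: integrable_bounded[where c=1] measurable_compose[OF measurable_vimage_algebra1]
             split: split_indicator)
      also have "\<dots> = (\<integral>p. indicator A (fst p) * H (fst p) y \<partial>Q)"
        using H_AE[of y] False by (intro integral_cong_AE) auto
      finally show ?thesis by (simp add: \<kappa>_m)
    qed
  qed measurable
  then show ?thesis by blast
qed

theorem (in prob_space) cond_kernel_exists:
  assumes X: "X \<in> borel_measurable M" and Z: "Z \<in> borel_measurable M"
  shows "\<exists>\<kappa>. cond_kernel M X Z \<kappa>"
proof -
  note [measurable] = X Z
  \<comment> \<open>Squeezing \<open>Z\<close> into the unit interval makes the limits of the conditional distribution functions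
    at infinity trivial.\<close>
  define \<phi> where "\<phi> z = 1 / (1 + exp (- z))" for z :: real
  define \<psi> where "\<psi> t = ln (t / (1 - t))" for t :: real
  have [measurable]: "\<phi> \<in> borel_measurable borel" "\<psi> \<in> borel_measurable borel"
    unfolding \<phi>_def \<psi>_def by measurable
  have \<phi>01: "0 < \<phi> z \<and> \<phi> z < 1" for z
    by (auto simp: \<phi>_def divide_simps add_pos_pos)
  \<comment> \<open>A left inverse is enough: the kernels may charge points outside the open unit
    interval, and the values of \<open>\<psi>\<close> there do no harm.\<close>
  have \<psi>\<phi>: "\<psi> (\<phi> z) = z" for z
  proof -
    have p: "0 < 1 + exp (-z)" using exp_gt_zero[of "-z"] by linarith
    have "1 - 1 / (1 + exp (- z)) = exp (-z) / (1 + exp (-z))" using p by (simp add: field_simps)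
    then have "\<phi> z / (1 - \<phi> z) = 1 / exp (-z)" using p by (simp add: \<phi>_def)
    moreover have "1 / exp (-z) = exp z" by (simp add: exp_minus field_simps)
    ultimately show ?thesis by (simp add: \<psi>_def)
  qed
  let ?Q = "distr M (borel \<Otimes>\<^sub>M borel) (\<lambda>\<omega>. (X \<omega>, \<phi> (Z \<omega>)))"
  have m: "(\<lambda>\<omega>. (X \<omega>, \<phi> (Z \<omega>))) \<in> measurable M (borel \<Otimes>\<^sub>M borel)" by measurable
  have "AE p in ?Q. 0 < snd p \<and> snd p < 1"
    by (subst AE_distr_iff[OF m]) (auto simp: \<phi>01)
  then obtain \<kappa> where \<kappa>: "cond_kernel ?Q fst snd \<kappa>"
    using cond_kernel_exists_unit_interval[of ?Q] prob_space_distr[OF m] by auto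
  then have [measurable]: "\<kappa> \<in> measurable borel (prob_algebra borel)"
    by (simp add: cond_kernel_def)
  have "cond_kernel M X Z (\<lambda>x. distr (\<kappa> x) borel \<psi>)"
    unfolding cond_kernel_def
  proof (intro conjI ballI)
    show "(\<lambda>x. distr (\<kappa> x) borel \<psi>) \<in> measurable borel (prob_algebra borel)"
      by measurable
    fix A B :: "real set" assume [measurable]: "A \<in> sets borel" "B \<in> sets borel"
    have [measurable]: "\<psi> -` B \<in> sets borel"
      using measurable_sets[of \<psi> borel borel B] by simp
    have "(\<integral>\<omega>. indicator A (X \<omega>) * indicator B (Z \<omega>) \<partial>M)
       = (\<integral>p. indicator A (fst p) * indicator (\<psi> -` B) (snd p) \<partial>?Q :: real)"
      by (subst integral_distr[OF m]) (auto simp: indicator_def \<psi>\<phi>)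
    also have "\<dots> = (\<integral>p. indicator A (fst p) * measure (\<kappa> (fst p)) (\<psi> -` B) \<partial>?Q)"
      using \<kappa> by (simp add: cond_kernel_def)
    also have "\<dots> = (\<integral>\<omega>. indicator A (X \<omega>) * measure (\<kappa> (X \<omega>)) (\<psi> -` B) \<partial>M)"
      by (subst integral_distr[OF m]) auto
    also have "\<dots> = (\<integral>\<omega>. indicator A (X \<omega>) * measure (distr (\<kappa> (X \<omega>)) borel \<psi>) B \<partial>M)"
      using sets_kernel[OF \<open>\<kappa> \<in> _\<close>]
      by (subst measure_distr) (auto cong: measurable_cong_sets simp: sets_eq_imp_space_eq[OF sets_kernel[OF \<open>\<kappa> \<in> _\<close>]])
    finally show "(\<integral>\<omega>. indicator A (X \<omega>) * indicator B (Z \<omega>) \<partial>M) =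
        (\<integral>\<omega>. indicator A (X \<omega>) * measure (distr (\<kappa> (X \<omega>)) borel \<psi>) B \<partial>M)" .
  qed
  then show ?thesis by blast
qed

section \<open>Markov chains\<close>

lemma markov_chain_onD:
  assumes "markov_chain_on I M X"
  shows "prob_space M" "i \<in> I \<Longrightarrow> X i \<in> borel_measurable M"
  using assms by (auto simp: markov_chain_on_def)

lemma measurable_history:
  assumes "\<And>i. i \<le> n \<Longrightarrow> X i \<in> borel_measurable M"
  shows "(\<lambda>\<omega>. \<lambda>i\<in>{..n}. X i \<omega>) \<in> measurable M (PiM {..n} (\<lambda>_. borel))"
  using assms by (intro measurable_restrict) auto

text \<open>A bounded function of the history is pulled out of the conditional expectation given the
  history, which the Markov property then replaces by the one given \<open>X n\<close>, that is, by
  the kernel. All later uses of the Markov property go through this integral form.\<close>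

lemma markov_chain_on_integral:
  assumes mc: "markov_chain_on I M X" and I: "{..Suc n} \<subseteq> I"
    and k: "cond_kernel M (X n) (X (Suc n)) \<kappa>" and B: "B \<in> sets borel"
    and H: "H \<in> borel_measurable (PiM {..n} (\<lambda>_. borel))" and bd: "\<And>h. \<bar>H h\<bar> \<le> (c::real)"
  shows "(\<integral>\<omega>. H (\<lambda>i\<in>{..n}. X i \<omega>) * indicator B (X (Suc n) \<omega>) \<partial>M) =
         (\<integral>\<omega>. H (\<lambda>i\<in>{..n}. X i \<omega>) * measure (\<kappa> (X n \<omega>)) B \<partial>M)"
proof -
  interpret prob_space M using mc by (rule markov_chain_onD)
  have X: "X i \<in> borel_measurable M" if "i \<le> Suc n" for i
    using mc I that by (intro markov_chain_onD(2)[of I]) auto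
  let ?h = "\<lambda>\<omega>. \<lambda>i\<in>{..n}. X i \<omega>"
  have h: "?h \<in> measurable M (PiM {..n} (\<lambda>_. borel))"
    by (rule measurable_history) (use X in auto)
  let ?F = "vimage_algebra (space M) ?h (PiM {..n} (\<lambda>_. borel))"
  interpret sigma_finite_subalgebra M ?F
    by (intro sigma_finite_subalgebra_of subalgebra_vimage h)
  have \<kappa>[measurable]: "\<kappa> \<in> measurable borel (prob_algebra borel)"
    using k by (simp add: cond_kernel_def)
  note [measurable] = X[OF order_refl] X[of n, simplified] B
  have HF: "(\<lambda>\<omega>. H (?h \<omega>)) \<in> borel_measurable ?F"
    by (rule measurable_compose[OF measurable_vimage_algebra1 H])
       (use measurable_space[OF h] in auto)
  have [measurable]: "(\<lambda>\<omega>. H (?h \<omega>)) \<in> borel_measurable M"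
    by (rule measurable_compose[OF h H])
  let ?i = "indicator {\<omega>\<in>space M. X (Suc n) \<omega> \<in> B} :: 'a \<Rightarrow> real"
  have "(\<integral>\<omega>. H (?h \<omega>) * indicator B (X (Suc n) \<omega>) \<partial>M) = (\<integral>\<omega>. H (?h \<omega>) * ?i \<omega> \<partial>M)"
    by (intro Bochner_Integration.integral_cong) (auto split: split_indicator)
  also have "\<dots> = (\<integral>\<omega>. H (?h \<omega>) * real_cond_exp M ?F ?i \<omega> \<partial>M)"
  proof (rule real_cond_exp_intg(2)[symmetric, OF _ HF])
    show "integrable M (\<lambda>\<omega>. H (?h \<omega>) * ?i \<omega>)"
      using bd order_trans[OF abs_ge_zero bd]
      by (intro integrable_bounded[where c=c]) (auto split: split_indicator)
  qed measurable
  also have "\<dots> = (\<integral>\<omega>. H (?h \<omega>) * measure (\<kappa> (X n \<omega>)) B \<partial>M)"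
  proof (rule integral_cong_AE)
    have "AE \<omega> in M. real_cond_exp M ?F ?i \<omega>
        = real_cond_exp M (vimage_algebra (space M) (X n) borel) ?i \<omega>"
      using mc I B by (auto simp: markov_chain_on_def)
    moreover have "AE \<omega> in M. real_cond_exp M (vimage_algebra (space M) (X n) borel) ?i \<omega>
       = measure (\<kappa> (X n \<omega>)) B"
      by (rule cond_kernel_real_cond_exp[OF _ _ k B]) measurable
    ultimately show "AE \<omega> in M. H (?h \<omega>) * real_cond_exp M ?F ?i \<omega> = H (?h \<omega>) * measure (\<kappa> (X n \<omega>)) B"
      by eventually_elim simp
  qed measurable
  finally show ?thesis .
qed

text \<open>The converse of the integral form: both conditional expectations are identified with
  \<open>measure (\<kappa> n (X n \<omega>)) B\<close>. Integral identities survive a change of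
  sample space, so this is the criterion by which a chain is transported.\<close>

lemma markov_chain_onI:
  assumes P: "prob_space M" and X: "\<And>i. i \<in> I \<Longrightarrow> X i \<in> borel_measurable M"
    and I: "\<And>n. Suc n \<in> I \<Longrightarrow> {..n} \<subseteq> I"
    and \<kappa>: "\<And>n. \<kappa> n \<in> measurable borel (prob_algebra borel)"
    and eq: "\<And>n A B. Suc n \<in> I \<Longrightarrow> A \<in> sets (PiM {..n} (\<lambda>_. borel)) \<Longrightarrow> B \<in> sets borel \<Longrightarrow>
      (\<integral>\<omega>. indicator A (\<lambda>i\<in>{..n}. X i \<omega>) * indicator B (X (Suc n) \<omega>) \<partial>M) =
      (\<integral>\<omega>. indicator A (\<lambda>i\<in>{..n}. X i \<omega>) * measure (\<kappa> n (X n \<omega>)) B \<partial>M)"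
  shows "markov_chain_on I M X"
  unfolding markov_chain_on_def
proof (intro conjI allI ballI impI P X)
  fix n B assume n: "Suc n \<in> I" and B: "B \<in> sets (borel :: real measure)"
  interpret prob_space M by fact
  let ?h = "\<lambda>\<omega>. \<lambda>i\<in>{..n}. X i \<omega>"
  let ?P = "PiM {..n} (\<lambda>_. borel) :: (nat \<Rightarrow> real) measure"
  have h: "?h \<in> measurable M ?P"
    by (rule measurable_history) (use X I[OF n] in auto)
  have Xn: "X n \<in> borel_measurable M" "X (Suc n) \<in> borel_measurable M"
    using X I[OF n] n by auto
  note [measurable] = Xn B \<kappa>
  let ?F = "vimage_algebra (space M) ?h ?P"
  let ?i = "indicator {\<omega>\<in>space M. X (Suc n) \<omega> \<in> B} :: 'a \<Rightarrow> real"
  \<comment> \<open>The hypothesis on histories is applied to cylinders that constrain the last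
    coordinate alone.\<close>
  have "cond_kernel M (X n) (X (Suc n)) (\<kappa> n)"
    unfolding cond_kernel_def
  proof (intro conjI ballI \<kappa>)
    fix A B :: "real set" assume AB: "A \<in> sets borel" "B \<in> sets borel"
    let ?A = "(\<lambda>h. h n) -` A \<inter> space ?P"
    have "(\<lambda>h. h n) \<in> borel_measurable ?P"
      by (rule measurable_component_singleton) simp
    then have "?A \<in> sets ?P"
      using AB(1) by (rule measurable_sets)
    from eq[OF n this AB(2)]
    show "(\<integral>\<omega>. indicator A (X n \<omega>) * indicator B (X (Suc n) \<omega>) \<partial>M) =
        (\<integral>\<omega>. indicator A (X n \<omega>) * measure (\<kappa> n (X n \<omega>)) B \<partial>M)"
      by (simp add: indicator_def space_PiM)
  qed
  then have "AE \<omega> in M. real_cond_exp M (vimage_algebra (space M) (X n) borel) ?i \<omega>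
      = measure (\<kappa> n (X n \<omega>)) B"
    using Xn B by (intro cond_kernel_real_cond_exp)
  moreover have "AE \<omega> in M. real_cond_exp M ?F ?i \<omega> = measure (\<kappa> n (X n \<omega>)) B"
  proof -
    interpret sigma_finite_subalgebra M ?F
      by (intro sigma_finite_subalgebra_of subalgebra_vimage h)
    show ?thesis
    proof (rule real_cond_exp_charact)
      fix A assume "A \<in> sets ?F"
      then obtain A' where A': "A' \<in> sets ?P" "A = ?h -` A' \<inter> space M"
        using h by (rule vimage_algebra_setE)
      have "(\<integral>\<omega>\<in>A. ?i \<omega> \<partial>M) = (\<integral>\<omega>. indicator A' (?h \<omega>) * indicator B (X (Suc n) \<omega>) \<partial>M :: real)"
        unfolding set_lebesgue_integral_def A'(2)
        by (intro Bochner_Integration.integral_cong) (auto split: split_indicator)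
      also have "\<dots> = (\<integral>\<omega>. indicator A' (?h \<omega>) * measure (\<kappa> n (X n \<omega>)) B \<partial>M)"
        by (rule eq[OF n A'(1) B])
      also have "\<dots> = (\<integral>\<omega>\<in>A. measure (\<kappa> n (X n \<omega>)) B \<partial>M)"
        unfolding set_lebesgue_integral_def A'(2)
        by (intro Bochner_Integration.integral_cong) (auto split: split_indicator)
      finally show "(\<integral>\<omega>\<in>A. ?i \<omega> \<partial>M) = (\<integral>\<omega>\<in>A. measure (\<kappa> n (X n \<omega>)) B \<partial>M)" .
    next
      show "integrable M ?i"
        by (rule integrable_bounded[where c=1]) (auto split: split_indicator)
      show "integrable M (\<lambda>\<omega>. measure (\<kappa> n (X n \<omega>)) B)"
        by (rule integrable_bounded[where c=1]) (auto simp: kernel_measure_le_1[OF \<kappa>])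
      have "X n \<in> borel_measurable ?F"
      proof -
        have "(\<lambda>h. h n) \<in> borel_measurable ?P"
          by (rule measurable_component_singleton) simp
        from measurable_compose[OF measurable_vimage_algebra1 this, of ?h "space M"]
        show ?thesis using measurable_space[OF h] by simp
      qed
      then show "(\<lambda>\<omega>. measure (\<kappa> n (X n \<omega>)) B) \<in> borel_measurable ?F"
        by (rule measurable_compose) measurable
    qed
  qed
  ultimately show "AE \<omega> in M. real_cond_exp M ?F ?i \<omega>
      = real_cond_exp M (vimage_algebra (space M) (X n) borel) ?i \<omega>"
    by eventually_elim simp
qed

section \<open>Copulas\<close>

lemma uniform_01_atMost: "measure (uniform_measure lborel {0..1::real}) {..v} = max 0 (min 1 v)"
proof -
  have "{0..1} \<inter> {..v} = {0..min 1 v}" by auto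
  then show ?thesis by (auto simp: measure_uniform_measure max_def)
qed

text \<open>\<open>C u v\<close> is the mass of a quadrant under a law with uniform marginals.
  Everything follows from the masses of vertical strips; in particular an increment in
  \<open>u\<close> is at most the mass of a strip of width \<open>\<bar>u - u'\<bar>\<close>. The
  first two facts also cover arguments outside the unit square.\<close>

lemma copula_le_0: "copula C \<Longrightarrow> u \<le> 0 \<Longrightarrow> C u v = 0"
  and copula_ge_1: "copula C \<Longrightarrow> 1 \<le> u \<Longrightarrow> C u v = max 0 (min 1 v)"
  and copula_lipschitz: "copula C \<Longrightarrow> \<bar>C u v - C u' v\<bar> \<le> \<bar>u - u'\<bar>"
proof -
  assume "copula C"
  then obtain Q :: "(real \<times> real) measure" where
    "prob_space Q" and sQ: "sets Q = sets borel" and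
     1: "distr Q borel fst = uniform_measure lborel {0..1}" and
     2: "distr Q borel snd = uniform_measure lborel {0..1}" and
     C: "\<And>u v. C u v = measure Q ({..u} \<times> {..v})"
    unfolding copula_def by blast
  interpret prob_space Q by fact
  have spQ: "space Q = UNIV" using sets_eq_imp_space_eq[OF sQ] by simp
  have sQ2: "sets Q = sets (borel \<Otimes>\<^sub>M borel)" unfolding borel_prod by (rule sQ)
  have meas: "fst \<in> borel_measurable Q" "snd \<in> borel_measurable Q"
    by (auto cong: measurable_cong_sets[OF sQ2 refl])
  have rect: "A \<times> B \<in> sets Q" if "A \<in> sets borel" "B \<in> sets borel" for A B :: "real set"
    using that by (auto simp: sQ2)
  have m1: "measure Q ({..u} \<times> UNIV) = max 0 (min 1 u)" for u
    using uniform_01_atMost[of u] meas unfolding 1[symmetric]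
    by (subst (asm) measure_distr) (auto simp: spQ vimage_fst)
  have m2: "measure Q (UNIV \<times> {..u}) = max 0 (min 1 u)" for u
    using uniform_01_atMost[of u] meas unfolding 2[symmetric]
    by (subst (asm) measure_distr) (auto simp: spQ vimage_snd)
  show "C u v = 0" if "u \<le> 0" for u v
  proof -
    have "C u v \<le> measure Q ({..u} \<times> UNIV)"
      unfolding C by (rule finite_measure_mono) (auto intro: rect)
    then show ?thesis using that measure_nonneg[of Q] by (simp add: m1 C antisym)
  qed
  show "C u v = max 0 (min 1 v)" if "1 \<le> u" for u v
  proof -
    have "measure Q (UNIV \<times> {..v}) \<le> measure Q ({..u} \<times> {..v}) + measure Q ({u<..} \<times> UNIV)"
      by (rule order_trans[OF finite_measure_mono measure_Un_le]) (auto intro!: rect sets.Un)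
    moreover have "measure Q ({u<..} \<times> UNIV) = 0"
    proof -
      have "{u<..} \<times> UNIV = space Q - {..u} \<times> (UNIV :: real set)" by (auto simp: spQ)
      then show ?thesis using that prob_compl[OF rect[of "{..u}" UNIV]] by (simp add: m1)
    qed
    moreover have "measure Q ({..u} \<times> {..v}) \<le> measure Q (UNIV \<times> {..v})"
      by (rule finite_measure_mono) (auto intro: rect)
    ultimately show ?thesis
      by (auto simp: C m2 intro!: antisym)
  qed
  have *: "\<bar>C u v - C u' v\<bar> \<le> u' - u" if "u \<le> u'" for u u' v
  proof -
    have "measure Q ({..u'} \<times> {..v}) = measure Q ({..u} \<times> {..v}) + measure Q ({u<..u'} \<times> {..v})"
      using that by (subst finite_measure_Union[symmetric])
        (auto intro: rect intro!: arg_cong[where f="measure Q"])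
    moreover have "measure Q ({..u'} \<times> UNIV) = measure Q ({..u} \<times> UNIV) + measure Q ({u<..u'} \<times> UNIV)"
      using that by (subst finite_measure_Union[symmetric])
        (auto intro: rect intro!: arg_cong[where f="measure Q"])
    moreover have "measure Q ({u<..u'} \<times> {..v}) \<le> measure Q ({u<..u'} \<times> UNIV)"
      by (rule finite_measure_mono) (auto intro: rect)
    ultimately show ?thesis
      using that measure_nonneg[of Q "{u<..u'} \<times> {..v}"] by (auto simp: C m1)
  qed
  show "\<bar>C u v - C u' v\<bar> \<le> \<bar>u - u'\<bar>" for u u' v
    using *[of u u' v] *[of u' u v] by linarith
qed

lemma copula_swap:
  assumes "copula C" shows "copula (\<lambda>u v. C v u)"
proof -
  obtain Q :: "(real \<times> real) measure" where
    "prob_space Q" and sQ: "sets Q = sets borel" and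
     1: "distr Q borel fst = uniform_measure lborel {0..1}" and
     2: "distr Q borel snd = uniform_measure lborel {0..1}" and
     C: "\<And>u v. C u v = measure Q ({..u} \<times> {..v})"
    using assms unfolding copula_def by blast
  interpret prob_space Q by fact
  have spQ: "space Q = UNIV" using sets_eq_imp_space_eq[OF sQ] by simp
  have sQ2: "sets Q = sets (borel \<Otimes>\<^sub>M borel)" unfolding borel_prod by (rule sQ)
  have [measurable]: "fst \<in> borel_measurable Q" "snd \<in> borel_measurable Q"
    by (auto cong: measurable_cong_sets[OF sQ2 refl])
  have [measurable]: "prod.swap \<in> measurable Q (borel :: (real \<times> real) measure)"
    unfolding borel_prod[symmetric] prod.swap_def by measurable
  show ?thesis unfolding copula_def
  proof (intro exI[of _ "distr Q borel prod.swap"] conjI allI)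
    show "prob_space (distr Q borel prod.swap)" by (rule prob_space_distr) measurable
    show "distr (distr Q borel prod.swap) borel fst = uniform_measure lborel {0..1}"
      unfolding 2[symmetric] by (subst distr_distr) (auto simp: comp_def borel_measurable_continuous_onI continuous_intros)
    show "distr (distr Q borel prod.swap) borel snd = uniform_measure lborel {0..1}"
      unfolding 1[symmetric] by (subst distr_distr) (auto simp: comp_def borel_measurable_continuous_onI continuous_intros)
    show "C v u = measure (distr Q borel prod.swap) ({..u} \<times> {..v})" for u v
    proof -
      have "{..u} \<times> {..v} \<in> sets (borel :: (real \<times> real) measure)"
        unfolding borel_prod[symmetric] by (rule pair_measureI) auto
      then show ?thesis
        unfolding C by (subst measure_distr) (auto simp: spQ intro!: arg_cong[where f="measure Q"])
    qed
  qed simp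
qed

text \<open>Uniform marginals force the values on and outside the boundary of the unit square. The
  open square remains, and its coordinates are the levels at which quantiles exist.\<close>

lemma copula_eqI:
  assumes C: "copula C" and D: "copula D"
    and eq: "\<And>u v. 0 < u \<Longrightarrow> u < 1 \<Longrightarrow> 0 < v \<Longrightarrow> v < 1 \<Longrightarrow> C u v = D u v"
  shows "C = D"
proof (intro ext)
  fix u v :: real
  note C' = copula_swap[OF C] and D' = copula_swap[OF D]
  consider "u \<le> 0" | "1 \<le> u" | "v \<le> 0" | "1 \<le> v" | "0 < u" "u < 1" "0 < v" "v < 1" by linarith
  then show "C u v = D u v"
  proof cases
    case 1 then show ?thesis using copula_le_0[OF C] copula_le_0[OF D] by simp
  next
    case 2 then show ?thesis using copula_ge_1[OF C] copula_ge_1[OF D] by simp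
  next
    case 3 then show ?thesis using copula_le_0[OF C' 3] copula_le_0[OF D' 3] by simp
  next
    case 4 then show ?thesis using copula_ge_1[OF C' 4] copula_ge_1[OF D' 4] by simp
  next
    case 5 then show ?thesis by (rule eq)
  qed
qed

lemma copula_of_swap:
  assumes "copula_of M X Y C"
  shows "copula_of M Y X (\<lambda>u v. C v u)"
  using assms copula_swap[of C] unfolding copula_of_def Let_def
  by (simp add: conj_commute)

section \<open>Copula values at left limits and inside the gaps\<close>

text \<open>Both sides of the hypothesis are followed as the level increases to \<open>y\<close>.
  The left side converges because \<open>C\<close> is Lipschitz, the right side because it is the
  distribution function of the law of \<open>Y\<close> on the event \<open>E\<close>. Leaving
  \<open>E\<close> free allows the passage to the limit to be made in one coordinate after the
  other.\<close>

lemma copula_of_left_limit: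
  assumes "prob_space M" and Y: "Y \<in> borel_measurable M" and C: "copula C" and E: "E \<in> sets M"
    and eq: "\<And>y. C u (cdf (distr M borel Y) y) = measure M {\<omega>\<in>E. Y \<omega> \<le> y}"
  shows "C u (measure (distr M borel Y) {..<y}) = measure M {\<omega>\<in>E. Y \<omega> < y}"
proof -
  interpret prob_space M by fact
  note [measurable] = Y E
  interpret R: real_distribution "distr M borel Y" by simp
  let ?N = "distr (restrict_space M E) borel Y"
  have E': "E \<inter> space M = E" using sets.sets_into_space[OF E] by auto
  have YE[measurable]: "Y \<in> borel_measurable (restrict_space M E)"
    by (rule measurable_restrict_space1[OF Y])
  have N: "measure ?N B = measure M {\<omega>\<in>E. Y \<omega> \<in> B}" if [measurable]: "B \<in> sets borel" for B
    using E E' by (subst measure_distr)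
      (auto simp: space_restrict_space measure_restrict_space intro!: arg_cong[where f="measure M"])
  interpret N: finite_borel_measure ?N
    using E E' by (intro finite_borel_measure.intro finite_measureI finite_borel_measure_axioms.intro)
      (auto simp: emeasure_distr space_restrict_space emeasure_restrict_space)
  have "((\<lambda>z. C u (cdf (distr M borel Y) z)) \<longlongrightarrow> measure ?N {..<y}) (at_left y)"
    using N.cdf_at_left[of y] unfolding eq by (simp add: cdf_def N)
  moreover have "((\<lambda>z. C u (cdf (distr M borel Y) z)) \<longlongrightarrow> C u (measure (distr M borel Y) {..<y})) (at_left y)"
  proof -
    have "((\<lambda>z. \<bar>cdf (distr M borel Y) z - measure (distr M borel Y) {..<y}\<bar>) \<longlongrightarrow> 0) (at_left y)"
      using R.cdf_at_left[of y] by (intro tendsto_rabs_zero) (simp add: LIM_zero_iff)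
    then have "((\<lambda>z. C u (cdf (distr M borel Y) z) - C u (measure (distr M borel Y) {..<y})) \<longlongrightarrow> 0) (at_left y)"
      by (rule Lim_null_comparison[rotated]) (simp add: copula_lipschitz[OF copula_swap[OF C]])
    then show ?thesis by (simp add: LIM_zero_iff)
  qed
  ultimately have "C u (measure (distr M borel Y) {..<y}) = measure ?N {..<y}"
    by (intro tendsto_unique[of "at_left y"]) auto
  then show ?thesis by (simp add: N)
qed

text \<open>The interpolated value of a copula at \<open>(1 - \<theta>) * F (x-) + \<theta> * F x\<close> counts the atom at \<open>x\<close>
  with weight \<open>\<theta>\<close>.\<close>

definition weight :: "real \<Rightarrow> real \<Rightarrow> real \<Rightarrow> real" where
  "weight \<theta> x \<xi> = (1 - \<theta>) * indicator {..<x} \<xi> + \<theta> * indicator {..x} \<xi>"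

lemma measurable_weight [measurable]: "weight \<theta> x \<in> borel_measurable borel"
  unfolding weight_def by measurable

lemma weight_bounds: "\<theta> \<in> {0..1} \<Longrightarrow> 0 \<le> weight \<theta> x \<xi>" "\<theta> \<in> {0..1} \<Longrightarrow> weight \<theta> x \<xi> \<le> 1"
  by (auto simp: weight_def split: split_indicator)

text \<open>Linearity in each coordinate expands the copula value into four corner values, and the
  product of the weights expands in the same way. Each corner value is a joint probability.\<close>

lemma copula_of_eq_integral_weight:
  assumes M: "prob_space M" and X: "X \<in> borel_measurable M" and Y: "Y \<in> borel_measurable M"
    and C: "copula_of M X Y C" and \<theta>: "\<theta> \<in> {0..1}" and \<eta>: "\<eta> \<in> {0..1}"
  shows "C ((1 - \<theta>) * measure (distr M borel X) {..<x} + \<theta> * measure (distr M borel X) {..x})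
           ((1 - \<eta>) * measure (distr M borel Y) {..<y} + \<eta> * measure (distr M borel Y) {..y})
       = (\<integral>\<omega>. weight \<theta> x (X \<omega>) * weight \<eta> y (Y \<omega>) \<partial>M)"
proof -
  interpret prob_space M by fact
  note [measurable] = X Y
  have Xm: "{\<omega>\<in>space M. X \<omega> \<le> x} \<in> sets M" "{\<omega>\<in>space M. X \<omega> < x} \<in> sets M"
    "{\<omega>\<in>space M. Y \<omega> \<le> x} \<in> sets M" for x
    by measurable
  let ?F = "\<lambda>A. measure (distr M borel X) A" and ?G = "\<lambda>A. measure (distr M borel Y) A"
  let ?P = "\<lambda>A B. measure M {\<omega>\<in>space M. X \<omega> \<in> A \<and> Y \<omega> \<in> B}"
  have cop: "copula C" using C by (simp add: copula_of_def Let_def)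
  have lin1: "C ((1 - t) * ?F {..<x} + t * ?F {..x}) v = (1 - t) * C (?F {..<x}) v + t * C (?F {..x}) v"
    if "t \<in> {0..1}" for t v
    using C that by (simp add: copula_of_def Let_def cdf_def)
  have lin2: "C u ((1 - t) * ?G {..<y} + t * ?G {..y}) = (1 - t) * C u (?G {..<y}) + t * C u (?G {..y})"
    if "t \<in> {0..1}" for t u
    using C that by (simp add: copula_of_def Let_def cdf_def)
  \<comment> \<open>In the names of the four corners L marks a non-strict and S a strict inequality.
    The corner \<open>LL\<close> is Sklar's identity, \<open>LS\<close> and \<open>SL\<close> are
    its limits in one coordinate, and \<open>SS\<close> is the limit of \<open>SL\<close> in the
    other.\<close>
  have LL: "C (?F {..x}) (?G {..y}) = ?P {..x} {..y}" for x y
    using C by (simp add: copula_of_def Let_def cdf_def)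
  have LS: "C (?F {..x}) (?G {..<y}) = ?P {..x} {..<y}" for x y
    using copula_of_left_limit[OF M Y cop Xm(1), of "?F {..x}" x y]
    by (simp add: cdf_def LL Collect_conj_eq Int_ac)
  have SL: "C (?F {..<x}) (?G {..y}) = ?P {..<x} {..y}" for x y
    using copula_of_left_limit[OF M X copula_swap[OF cop] Xm(3), of "?G {..y}" y x]
    by (simp add: cdf_def LL Collect_conj_eq Int_ac)
  have SS: "C (?F {..<x}) (?G {..<y}) = ?P {..<x} {..<y}" for x y
    using copula_of_left_limit[OF M Y cop Xm(2), of "?F {..<x}" x y]
    by (simp add: cdf_def SL Collect_conj_eq Int_ac)
  have P: "?P A B = (\<integral>\<omega>. indicator A (X \<omega>) * indicator B (Y \<omega>) \<partial>M)"
    and int: "integrable M (\<lambda>\<omega>. indicator A (X \<omega>) * indicator B (Y \<omega>) :: real)"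
    if [measurable]: "A \<in> sets borel" "B \<in> sets borel" for A B
  proof -
    have "?P A B = (\<integral>\<omega>. indicator {\<omega>\<in>space M. X \<omega> \<in> A \<and> Y \<omega> \<in> B} \<omega> \<partial>M)"
      by simp
    also have "\<dots> = (\<integral>\<omega>. indicator A (X \<omega>) * indicator B (Y \<omega>) \<partial>M)"
      by (intro Bochner_Integration.integral_cong) (auto split: split_indicator)
    finally show "?P A B = (\<integral>\<omega>. indicator A (X \<omega>) * indicator B (Y \<omega>) \<partial>M)" .
    show "integrable M (\<lambda>\<omega>. indicator A (X \<omega>) * indicator B (Y \<omega>) :: real)"
      by (rule integrable_bounded[where c=1]) (auto split: split_indicator)
  qed
  have "(\<integral>\<omega>. weight \<theta> x (X \<omega>) * weight \<eta> y (Y \<omega>) \<partial>M)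
    = (\<integral>\<omega>. (1-\<theta>) * (1-\<eta>) * (indicator {..<x} (X \<omega>) * indicator {..<y} (Y \<omega>))
       + (1-\<theta>) * \<eta> * (indicator {..<x} (X \<omega>) * indicator {..y} (Y \<omega>))
       + \<theta> * (1-\<eta>) * (indicator {..x} (X \<omega>) * indicator {..<y} (Y \<omega>))
       + \<theta> * \<eta> * (indicator {..x} (X \<omega>) * indicator {..y} (Y \<omega>)) \<partial>M)"
    by (intro Bochner_Integration.integral_cong) (auto simp: weight_def algebra_simps)
  also have "\<dots> = (1-\<theta>) * (1-\<eta>) * ?P {..<x} {..<y} + (1-\<theta>) * \<eta> * ?P {..<x} {..y}
      + \<theta> * (1-\<eta>) * ?P {..x} {..<y} + \<theta> * \<eta> * ?P {..x} {..y}"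
    by (simp add: int P[symmetric])
  finally have eq: "(\<integral>\<omega>. weight \<theta> x (X \<omega>) * weight \<eta> y (Y \<omega>) \<partial>M) = \<dots>" .
  show ?thesis
    unfolding eq lin1[OF \<theta>] lin2[OF \<eta>] LL LS SL SS by (simp add: algebra_simps)
qed

section \<open>Quantile functions on the unit interval\<close>

abbreviation unit_interval :: "real measure" where
  "unit_interval \<equiv> restrict_space lborel {0<..<1}"

lemma prob_space_unit_interval: "prob_space unit_interval"
  by (auto simp: emeasure_restrict_space space_restrict_space intro!: prob_spaceI)

text \<open>\<open>I\<close> is the quantile function, which carries Lebesgue measure on the open
  unit interval to \<open>M\<close>. A level \<open>s\<close> lies in the gap of the distribution
  function at \<open>I s\<close>, at relative position \<open>\<theta>\<close>; cutting the unit
  interval at \<open>s\<close> therefore keeps everything strictly below \<open>I s\<close> and the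
  fraction \<open>\<theta>\<close> of the atom there. This translates copula coordinates into values
  of the variable.\<close>

lemma (in cdf_distribution) quantile_gap:
  assumes s: "0 < s" "s < 1"
  obtains \<theta> where "\<theta> \<in> {0..1}" "s = (1 - \<theta>) * measure M {..<I s} + \<theta> * measure M {..I s}"
    "\<And>f c. f \<in> borel_measurable borel \<Longrightarrow> (\<And>x. \<bar>f x\<bar> \<le> c) \<Longrightarrow>
       (\<integral>t. indicator {..s} t * f (I t) \<partial>unit_interval) = (\<integral>x. weight \<theta> (I s) x * f x \<partial>M)"
proof -
  let ?y = "I s"
  interpret \<Omega>: prob_space unit_interval by (rule prob_space_unit_interval)
  have [measurable]: "I \<in> borel_measurable unit_interval"
    using measurable_CI by (simp cong: measurable_cong_sets)
  have [measurable]: "(indicator {..s} :: real \<Rightarrow> real) \<in> borel_measurable unit_interval"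
    by (rule measurable_restrict_space1) measurable
  have up: "s \<le> measure M {..?y}"
    using pseudoinverse[OF s, of ?y] by (simp add: cdf_def)
  have lo: "measure M {..<?y} \<le> s"
  proof (rule tendsto_upperbound[OF cdf_at_left])
    have "cdf M z \<le> s" if "z < ?y" for z
      using pseudoinverse[OF s, of z] that by auto
    then show "eventually (\<lambda>z. cdf M z \<le> s) (at_left ?y)"
      by (auto simp: eventually_at_left_field intro!: exI[of _ "?y - 1"])
  qed simp
  have at: "measure M {..?y} = measure M {..<?y} + measure M {?y}"
    by (subst finite_measure_Union[symmetric]) (auto intro!: arg_cong[where f="measure M"])
  \<comment> \<open>Without an atom the gap is a single point and any position would do; 0 is
    chosen.\<close>
  define \<theta> where "\<theta> = (if measure M {?y} = 0 then 0 else (s - measure M {..<?y}) / measure M {?y})"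
  have \<theta>: "\<theta> * measure M {?y} = s - measure M {..<?y}" using up lo at by (auto simp: \<theta>_def)
  have \<theta>01: "\<theta> \<in> {0..1}"
    using up lo at measure_nonneg[of M "{?y}"] by (auto simp: \<theta>_def divide_simps)
  \<comment> \<open>Since \<open>I\<close> is monotone, only levels with the same quantile as
    \<open>s\<close> have to be compared with \<open>s\<close> itself.\<close>
  have split: "indicator {..s} t = indicator {..<?y} (I t) + (indicator {?y} (I t) * indicator {..s} t :: real)"
    if "t \<in> space unit_interval" for t
  proof -
    have t: "0 < t" "t < 1" using that by (auto simp: space_restrict_space)
    have "I t \<le> ?y" if "t \<le> s"
      using pseudoinverse[OF t, of ?y] pseudoinverse[OF s, of ?y] that by simp
    moreover have "t \<le> s" if "I t < ?y"
      using pseudoinverse[OF t, of "I t"] pseudoinverse[OF s, of "I t"] that by simp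
    ultimately show ?thesis by (auto split: split_indicator)
  qed
  have tr: "(\<integral>t. g (I t) \<partial>unit_interval) = (\<integral>x. g x \<partial>M)"
    if "g \<in> borel_measurable borel" for g :: "real \<Rightarrow> real"
    using integral_distr[of I unit_interval borel g] that by (simp add: distr_I_eq_M)
  have lt: "(\<integral>t. indicator {..s} t \<partial>unit_interval) = s"
  proof -
    have "(\<integral>t. indicator {..s} t \<partial>unit_interval) = measure unit_interval ({..s} \<inter> {0<..<1})"
      by (simp add: space_restrict_space)
    also have "\<dots> = measure lborel ({..s} \<inter> {0<..<1})"
      by (subst measure_restrict_space) auto
    also have "{..s} \<inter> {0<..<1} = {0<..s}" using s by auto
    finally show ?thesis using s by simp
  qed
  \<comment> \<open>The part of the level set of \<open>I\<close> that lies below \<open>s\<close>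
    is measured by subtraction: all of \<open>{..s}\<close> has mass \<open>s\<close>, and the
    levels with quantile below \<open>?y\<close> have the mass of \<open>{..<?y}\<close> under
    \<open>M\<close>.\<close>
  have atom: "(\<integral>t. indicator {?y} (I t) * indicator {..s} t \<partial>unit_interval) = s - measure M {..<?y}"
  proof -
    have "(\<integral>t. indicator {..s} t \<partial>unit_interval)
        = (\<integral>t. indicator {..<?y} (I t) + (indicator {?y} (I t) * indicator {..s} t :: real) \<partial>unit_interval)"
      by (intro Bochner_Integration.integral_cong split refl)
    also have "\<dots> = (\<integral>t. indicator {..<?y} (I t) \<partial>unit_interval)
       + (\<integral>t. indicator {?y} (I t) * indicator {..s} t \<partial>unit_interval)"
      by (intro Bochner_Integration.integral_add \<Omega>.integrable_bounded[where c=1])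
         (auto split: split_indicator)
    finally show ?thesis unfolding lt by (simp add: tr)
  qed
  have "(\<integral>t. indicator {..s} t * f (I t) \<partial>unit_interval) = (\<integral>x. weight \<theta> ?y x * f x \<partial>M)"
    if [measurable]: "f \<in> borel_measurable borel" and bd: "\<And>x. \<bar>f x\<bar> \<le> c" for f c
  proof -
    have c: "0 \<le> c" using order_trans[OF abs_ge_zero bd] .
    have "\<bar>\<theta> * f ?y\<bar> \<le> 1 * c"
      unfolding abs_mult using \<theta>01 bd c by (intro mult_mono) auto
    note c = c this[unfolded mult_1]
    have "(\<integral>t. indicator {..s} t * f (I t) \<partial>unit_interval)
       = (\<integral>t. indicator {..<?y} (I t) * f (I t) + (indicator {?y} (I t) * indicator {..s} t) * f ?y \<partial>unit_interval)"
      by (intro Bochner_Integration.integral_cong refl, subst split) (auto simp: algebra_simps split: split_indicator)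
    also have "\<dots> = (\<integral>t. indicator {..<?y} (I t) * f (I t) \<partial>unit_interval)
       + (\<integral>t. (indicator {?y} (I t) * indicator {..s} t) * f ?y \<partial>unit_interval)"
      using bd c by (intro Bochner_Integration.integral_add \<Omega>.integrable_bounded[where c=c])
         (auto split: split_indicator)
    also have "\<dots> = (\<integral>x. indicator {..<?y} x * f x \<partial>M) + (s - measure M {..<?y}) * f ?y"
      by (simp add: atom tr[of "\<lambda>x. indicator {..<?y} x * f x"])
    also have "\<dots> = (\<integral>x. indicator {..<?y} x * f x \<partial>M) + (\<integral>x. \<theta> * f ?y * indicator {?y} x \<partial>M)"
      by (simp add: \<theta>[symmetric])
    also have "\<dots> = (\<integral>x. indicator {..<?y} x * f x + \<theta> * f ?y * indicator {?y} x \<partial>M)"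
      using bd c by (intro Bochner_Integration.integral_add[symmetric] integrable_bounded[where c="c"])
         (auto split: split_indicator)
    also have "\<dots> = (\<integral>x. weight \<theta> ?y x * f x \<partial>M)"
      by (intro Bochner_Integration.integral_cong) (auto simp: weight_def split: split_indicator)
    finally show ?thesis .
  qed
  then show ?thesis
    using \<theta> \<theta>01 at by (intro that[of \<theta>]) (auto simp: algebra_simps)
qed

section \<open>Uniqueness of the Markov product\<close>

lemma (in real_distribution) integral_weight:
  "(\<integral>\<xi>. weight \<theta> x \<xi> \<partial>M) = (1 - \<theta>) * measure M {..<x} + \<theta> * measure M {..x}"
proof -
  have "integrable M (indicator A :: real \<Rightarrow> real)" if "A \<in> sets borel" for A
    using that by (intro integrable_bounded[where c=1]) (auto split: split_indicator)
  then show ?thesis by (simp add: weight_def)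
qed

lemma integral_weight_kernel:
  fixes \<kappa> :: "real \<Rightarrow> real measure"
  assumes "\<kappa> \<in> measurable borel (prob_algebra borel)"
  shows "(\<integral>\<xi>. weight \<theta> x \<xi> \<partial>\<kappa> y) = (1 - \<theta>) * measure (\<kappa> y) {..<x} + \<theta> * measure (\<kappa> y) {..x}"
  by (rule real_distribution.integral_weight[OF real_distribution_kernel[OF assms]])

lemma integral_weight_kernel_bounds:
  fixes \<kappa> :: "real \<Rightarrow> real measure"
  assumes \<kappa>: "\<kappa> \<in> measurable borel (prob_algebra borel)" and \<theta>: "\<theta> \<in> {0..1}"
  shows "0 \<le> (\<integral>\<xi>. weight \<theta> x \<xi> \<partial>\<kappa> y)" "(\<integral>\<xi>. weight \<theta> x \<xi> \<partial>\<kappa> y) \<le> 1"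
  unfolding integral_weight_kernel[OF \<kappa>] using \<theta>
  by (auto intro!: convex_bound_le kernel_measure_le_1[OF \<kappa>])

lemma (in prob_space) cond_kernel_weight:
  assumes X: "X \<in> borel_measurable M" and Y: "Y \<in> borel_measurable M"
    and k: "cond_kernel M Y X \<kappa>"
    and g: "g \<in> borel_measurable borel" and bd: "\<And>x. \<bar>g x\<bar> \<le> (c::real)"
  shows "(\<integral>\<omega>. g (Y \<omega>) * weight \<theta> x (X \<omega>) \<partial>M) = (\<integral>\<omega>. g (Y \<omega>) * (\<integral>\<xi>. weight \<theta> x \<xi> \<partial>\<kappa> (Y \<omega>)) \<partial>M)"
proof -
  have \<kappa>: "\<kappa> \<in> measurable borel (prob_algebra borel)"
    using k by (simp add: cond_kernel_def)
  note [measurable] = X Y g \<kappa>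
  have i1: "integrable M (\<lambda>\<omega>. g (Y \<omega>) * indicator A (X \<omega>))"
    and i2: "integrable M (\<lambda>\<omega>. g (Y \<omega>) * measure (\<kappa> (Y \<omega>)) A)" if [measurable]: "A \<in> sets borel" for A
  proof -
    have *: "\<bar>g y * z\<bar> \<le> c" if "\<bar>z\<bar> \<le> 1" for y z
      using mult_mono[OF bd[of y] that] order_trans[OF abs_ge_zero bd[of y]] by (simp add: abs_mult)
    show "integrable M (\<lambda>\<omega>. g (Y \<omega>) * indicator A (X \<omega>))"
      using bd order_trans[OF abs_ge_zero bd]
      by (intro integrable_bounded[where c=c]) (auto split: split_indicator)
    show "integrable M (\<lambda>\<omega>. g (Y \<omega>) * measure (\<kappa> (Y \<omega>)) A)"
      by (rule integrable_bounded[where c=c]) (auto intro!: * kernel_measure_le_1[OF \<kappa>])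
  qed
  have "(\<integral>\<omega>. g (Y \<omega>) * weight \<theta> x (X \<omega>) \<partial>M)
     = (\<integral>\<omega>. (1-\<theta>) * (g (Y \<omega>) * indicator {..<x} (X \<omega>)) + \<theta> * (g (Y \<omega>) * indicator {..x} (X \<omega>)) \<partial>M)"
    by (intro Bochner_Integration.integral_cong) (auto simp: weight_def algebra_simps)
  also have "\<dots> = (1-\<theta>) * (\<integral>\<omega>. g (Y \<omega>) * measure (\<kappa> (Y \<omega>)) {..<x} \<partial>M)
      + \<theta> * (\<integral>\<omega>. g (Y \<omega>) * measure (\<kappa> (Y \<omega>)) {..x} \<partial>M)"
    by (simp add: i1 cond_kernel_integral[OF Y X k _ g bd])
  also have "\<dots> = (\<integral>\<omega>. (1-\<theta>) * (g (Y \<omega>) * measure (\<kappa> (Y \<omega>)) {..<x})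
      + \<theta> * (g (Y \<omega>) * measure (\<kappa> (Y \<omega>)) {..x}) \<partial>M)"
    by (simp add: i2[unfolded One_nat_def])
  also have "\<dots> = (\<integral>\<omega>. g (Y \<omega>) * (\<integral>\<xi>. weight \<theta> x \<xi> \<partial>\<kappa> (Y \<omega>)) \<partial>M)"
    by (intro Bochner_Integration.integral_cong) (auto simp: integral_weight_kernel[OF \<kappa>] algebra_simps)
  finally show ?thesis .
qed

text \<open>\<open>c\<close> is the partial derivative of \<open>s \<mapsto> C u s\<close>; the condition on its total integral is the
  case \<open>s = 1\<close>.\<close>

definition copula_density :: "(real \<Rightarrow> real \<Rightarrow> real) \<Rightarrow> real \<Rightarrow> (real \<Rightarrow> real) \<Rightarrow> bool" where
  "copula_density C u c \<longleftrightarrow> c \<in> borel_measurable unit_interval \<and> (\<forall>t. 0 \<le> c t \<and> c t \<le> 1) \<and>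
     (\<integral>t. c t \<partial>unit_interval) = u \<and>
     (\<forall>s. 0 < s \<longrightarrow> s < 1 \<longrightarrow> (\<integral>t. indicator {..s} t * c t \<partial>unit_interval) = C u s)"

text \<open>The integrals over \<open>{..s}\<close> form the distribution function of the finite
  measure with density \<open>c\<close>: it is 0 up to 0, prescribed by \<open>C u\<close> inside,
  and equal to the total mass from 1 onwards. The density is thereby tied to \<open>C\<close> and
  \<open>u\<close> alone, whatever pair it was computed from.\<close>

lemma copula_density_unique:
  assumes c: "copula_density C u c" and d: "copula_density C u d"
  shows "AE t in unit_interval. c t = d t"
proof -
  interpret \<Omega>: prob_space unit_interval by (rule prob_space_unit_interval)
  have [measurable]: "c \<in> borel_measurable unit_interval" "d \<in> borel_measurable unit_interval"
    using c d by (auto simp: copula_density_def)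
  have bd: "0 \<le> c t" "c t \<le> 1" "0 \<le> d t" "d t \<le> 1" for t
    using c d by (auto simp: copula_density_def)
  \<comment> \<open>The identity map pushes measures on the unit interval to Borel measures on the
    line, where distribution functions are available.\<close>
  have id[measurable]: "(\<lambda>t. t) \<in> borel_measurable unit_interval"
    by (rule measurable_restrict_space1) simp
  have e: "emeasure (distr (density unit_interval (\<lambda>t. ennreal (f t))) borel (\<lambda>t. t)) A
        = ennreal (\<integral>t. indicator A t * f t \<partial>unit_interval)"
    if [measurable]: "f \<in> borel_measurable unit_interval" and f: "\<And>t. 0 \<le> f t" "\<And>t. f t \<le> 1"
      and A[measurable]: "A \<in> sets borel" for f :: "real \<Rightarrow> real" and A
  proof -
    have A': "A \<inter> space unit_interval \<in> sets unit_interval"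
      using measurable_sets[OF id A] by simp
    have Am[measurable]: "(indicator A :: real \<Rightarrow> real) \<in> borel_measurable unit_interval"
      by (rule measurable_restrict_space1) measurable
    have "emeasure (distr (density unit_interval (\<lambda>t. ennreal (f t))) borel (\<lambda>t. t)) A
      = emeasure (density unit_interval (\<lambda>t. ennreal (f t))) (A \<inter> space unit_interval)"
      by (subst emeasure_distr) auto
    also have "\<dots> = (\<integral>\<^sup>+t. ennreal (f t) * indicator (A \<inter> space unit_interval) t \<partial>unit_interval)"
      using A' by (intro emeasure_density) auto
    also have "\<dots> = (\<integral>\<^sup>+t. ennreal (indicator A t * f t) \<partial>unit_interval)"
      by (intro nn_integral_cong) (auto split: split_indicator)
    also have "\<dots> = ennreal (\<integral>t. indicator A t * f t \<partial>unit_interval)"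
      using f by (intro nn_integral_eq_integral \<Omega>.integrable_bounded[where c=1]) (auto split: split_indicator)
    finally show ?thesis .
  qed
  let ?N = "\<lambda>f. distr (density unit_interval (\<lambda>t. ennreal (f t))) borel (\<lambda>t. t)"
  have fin: "finite_borel_measure (?N c)" "finite_borel_measure (?N d)"
    by (intro finite_borel_measure.intro finite_measureI finite_borel_measure_axioms.intro;
        use e[of c UNIV] e[of d UNIV] bd in simp)+
  have "?N c = ?N d"
  proof (rule cdf_unique'[OF fin], rule ext)
    fix s :: real
    have "(\<integral>t. indicator {..s} t * c t \<partial>unit_interval) = (\<integral>t. indicator {..s} t * d t \<partial>unit_interval)"
    proof -
      consider "s \<le> 0" | "1 \<le> s" | "0 < s" "s < 1" by linarith
      then show ?thesis
      proof cases
        case 1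
        have "(\<integral>t. indicator {..s} t * f t \<partial>unit_interval) = (\<integral>t. 0 \<partial>unit_interval)" for f :: "real \<Rightarrow> real"
          using 1 by (intro Bochner_Integration.integral_cong) (auto simp: space_restrict_space split: split_indicator)
        then show ?thesis by metis
      next
        case 2
        have "(\<integral>t. indicator {..s} t * f t \<partial>unit_interval) = (\<integral>t. f t \<partial>unit_interval)" for f :: "real \<Rightarrow> real"
          using 2 by (intro Bochner_Integration.integral_cong) (auto simp: space_restrict_space split: split_indicator)
        then show ?thesis using c d by (simp add: copula_density_def)
      next
        case 3 then show ?thesis using c d by (simp add: copula_density_def)
      qed
    qed
    then show "cdf (?N c) s = cdf (?N d) s"
      using e[of c "{..s}"] e[of d "{..s}"] bd by (simp add: cdf_def measure_def)
  qed
  have "AE t in unit_interval. ennreal (c t) = ennreal (d t)"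
  proof (rule \<Omega>.density_unique)
    show "density unit_interval (\<lambda>t. ennreal (c t)) = density unit_interval (\<lambda>t. ennreal (d t))"
    proof (rule measure_eqI)
      fix A assume "A \<in> sets (density unit_interval (\<lambda>t. ennreal (c t)))"
      then have A: "A \<in> sets unit_interval" by simp
      then have AI: "A \<inter> {0<..<1} = A" "A \<in> sets borel"
        by (auto simp: sets_restrict_space)
      then have "emeasure (?N f) A = emeasure (density unit_interval (\<lambda>t. ennreal (f t))) A" for f
        by (subst emeasure_distr) (auto simp: space_restrict_space)
      then show "emeasure (density unit_interval (\<lambda>t. ennreal (c t))) A = emeasure (density unit_interval (\<lambda>t. ennreal (d t))) A"
        using \<open>?N c = ?N d\<close> by metis
    qed simp
  qed measurable
  then show ?thesis using bd by (auto elim!: eventually_mono)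
qed

text \<open>The density is the conditional expectation, given \<open>Y\<close>, of the weight that
  represents the level \<open>u\<close> of \<open>X\<close>, read off at the quantile of
  \<open>Y\<close>. By \<open>quantile_gap\<close> its integral up to \<open>s\<close> is an
  expectation with the weight of \<open>Y\<close> at level \<open>s\<close>; removing the
  conditioning leaves the expectation of a product of two weights, which is
  \<open>C u s\<close>.\<close>

lemma copula_density_quantile:
  assumes M: "prob_space M" and X: "X \<in> borel_measurable M" and Y: "Y \<in> borel_measurable M"
    and C: "copula_of M X Y C" and k: "cond_kernel M Y X \<kappa>" and \<theta>: "\<theta> \<in> {0..1}"
    and u: "u = (1 - \<theta>) * measure (distr M borel X) {..<x} + \<theta> * measure (distr M borel X) {..x}"
  shows "copula_density C u
    (\<lambda>t. \<integral>\<xi>. weight \<theta> x \<xi> \<partial>\<kappa> (right_continuous_mono.I (cdf (distr M borel Y)) t))"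
proof -
  interpret prob_space M by fact
  note [measurable] = X Y
  interpret R: cdf_distribution "distr M borel Y"
    unfolding cdf_distribution_def by simp
  let ?q = "R.I"
  have [measurable]: "?q \<in> borel_measurable unit_interval"
    using R.measurable_CI by (simp cong: measurable_cong_sets)
  have \<kappa>[measurable]: "\<kappa> \<in> measurable borel (prob_algebra borel)"
    using k by (simp add: cond_kernel_def)
  let ?a = "\<lambda>y. \<integral>\<xi>. weight \<theta> x \<xi> \<partial>\<kappa> y"
  have [measurable]: "?a \<in> borel_measurable borel"
    unfolding integral_weight_kernel[OF \<kappa>] by measurable
  have a: "0 \<le> ?a y" "?a y \<le> 1" for y
    by (rule integral_weight_kernel_bounds[OF \<kappa> \<theta>])+
  have "(\<integral>t. ?a (?q t) \<partial>unit_interval) = (\<integral>y. ?a y \<partial>distr M borel Y)"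
    using integral_distr[of ?q unit_interval borel ?a] by (simp add: R.distr_I_eq_M)
  also have "\<dots> = (\<integral>\<omega>. 1 * ?a (Y \<omega>) \<partial>M)" by (subst integral_distr) auto
  also have "\<dots> = (\<integral>\<omega>. 1 * weight \<theta> x (X \<omega>) \<partial>M)"
    by (rule cond_kernel_weight[OF X Y k, symmetric, of "\<lambda>_. 1" 1]) auto
  also have "\<dots> = u"
    unfolding u real_distribution.integral_weight[OF real_distribution_distr[OF X], symmetric]
    by (subst integral_distr) auto
  finally have tot: "(\<integral>t. ?a (?q t) \<partial>unit_interval) = u" .
  have "(\<integral>t. indicator {..s} t * ?a (?q t) \<partial>unit_interval) = C u s" if s: "0 < s" "s < 1" for s
  proof -
    from s obtain \<eta> where \<eta>: "\<eta> \<in> {0..1}"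
      and sG: "s = (1 - \<eta>) * measure (distr M borel Y) {..<?q s} + \<eta> * measure (distr M borel Y) {..?q s}"
      and int: "\<And>f c. f \<in> borel_measurable borel \<Longrightarrow> (\<And>x. \<bar>f x\<bar> \<le> c) \<Longrightarrow>
       (\<integral>t. indicator {..s} t * f (?q t) \<partial>unit_interval) = (\<integral>y. weight \<eta> (?q s) y * f y \<partial>distr M borel Y)"
      by (rule R.quantile_gap) blast
    have "(\<integral>t. indicator {..s} t * ?a (?q t) \<partial>unit_interval)
       = (\<integral>y. weight \<eta> (?q s) y * ?a y \<partial>distr M borel Y)"
      using a by (intro int[of _ 1]) auto
    also have "\<dots> = (\<integral>\<omega>. weight \<eta> (?q s) (Y \<omega>) * ?a (Y \<omega>) \<partial>M)"
      by (subst integral_distr) auto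
    also have "\<dots> = (\<integral>\<omega>. weight \<eta> (?q s) (Y \<omega>) * weight \<theta> x (X \<omega>) \<partial>M)"
      using weight_bounds[OF \<eta>] by (intro cond_kernel_weight[OF X Y k, where c=1, symmetric]) auto
    also have "\<dots> = C u s"
      unfolding u by (subst sG, subst copula_of_eq_integral_weight[OF M X Y C \<theta> \<eta>]) (simp add: mult.commute)
    finally show ?thesis .
  qed
  with tot a show ?thesis by (auto simp: copula_density_def)
qed

text \<open>\<open>E u v\<close> is the expectation of a weight of \<open>Y 0\<close> times a weight
  of \<open>Y 2\<close>. Given \<open>Y 1\<close> these two are independent, so it is the
  expectation of the product of their conditional expectations, and the quantile function of
  \<open>Y 1\<close> moves this to the unit interval.\<close>

lemma copula_of_markov_triple:
  assumes mc: "markov_chain_on {0, 1, 2} P Y"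
    and C: "copula_of P (Y 0) (Y 1) C" and D: "copula_of P (Y 1) (Y 2) D" and E: "copula_of P (Y 0) (Y 2) E"
    and u: "0 < u" "u < 1" and v: "0 < v" "v < 1"
  shows "\<exists>c d. copula_density C u c \<and> copula_density (\<lambda>v s. D s v) v d \<and>
     E u v = (\<integral>t. c t * d t \<partial>unit_interval)"
proof -
  interpret prob_space P by (rule markov_chain_onD[OF mc])
  have Y[measurable]: "Y 0 \<in> borel_measurable P" "Y 1 \<in> borel_measurable P" "Y 2 \<in> borel_measurable P"
    using mc by (auto simp: markov_chain_on_def)
  have [measurable]: "Y (Suc 0) \<in> borel_measurable P" using Y(2) by simp
  \<comment> \<open>Both kernels start from the middle variable: \<open>\<kappa>\<close> runs
    backward in time, \<open>\<mu>\<close> forward.\<close>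
  obtain \<kappa> where k: "cond_kernel P (Y 1) (Y 0) \<kappa>" using cond_kernel_exists[OF Y(2,1)] by blast
  obtain \<mu> where m: "cond_kernel P (Y 1) (Y 2) \<mu>" using cond_kernel_exists[OF Y(2,3)] by blast
  have \<kappa>[measurable]: "\<kappa> \<in> measurable borel (prob_algebra borel)" "\<mu> \<in> measurable borel (prob_algebra borel)"
    using k m by (auto simp: cond_kernel_def)
  interpret R0: cdf_distribution "distr P borel (Y 0)"
    unfolding cdf_distribution_def by (rule real_distribution_distr[OF Y(1)])
  interpret R1: cdf_distribution "distr P borel (Y 1)"
    unfolding cdf_distribution_def by (rule real_distribution_distr[OF Y(2)])
  interpret R2: cdf_distribution "distr P borel (Y 2)"
    unfolding cdf_distribution_def by (rule real_distribution_distr[OF Y(3)])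
  obtain \<theta> x where \<theta>: "\<theta> \<in> {0..1}"
    and ux: "u = (1 - \<theta>) * measure (distr P borel (Y 0)) {..<x} + \<theta> * measure (distr P borel (Y 0)) {..x}"
    by (rule R0.quantile_gap[OF u]) blast
  obtain \<eta> z where \<eta>: "\<eta> \<in> {0..1}"
    and vz: "v = (1 - \<eta>) * measure (distr P borel (Y 2)) {..<z} + \<eta> * measure (distr P borel (Y 2)) {..z}"
    by (rule R2.quantile_gap[OF v]) blast
  let ?a = "\<lambda>y. \<integral>\<xi>. weight \<theta> x \<xi> \<partial>\<kappa> y" and ?b = "\<lambda>y. \<integral>\<xi>. weight \<eta> z \<xi> \<partial>\<mu> y"
  have [measurable]: "?a \<in> borel_measurable borel" "?b \<in> borel_measurable borel"
    unfolding integral_weight_kernel[OF \<kappa>(1)] integral_weight_kernel[OF \<kappa>(2)] by measurable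
  have c: "copula_density C u (\<lambda>t. ?a (R1.I t))"
    by (rule copula_density_quantile[OF prob_space_axioms Y(1,2) C k \<theta> ux])
  have d: "copula_density (\<lambda>v s. D s v) v (\<lambda>t. ?b (R1.I t))"
    by (rule copula_density_quantile[OF prob_space_axioms Y(3,2) copula_of_swap[OF D] m \<eta> vz])
  have [measurable]: "R1.I \<in> borel_measurable unit_interval"
    using R1.measurable_CI by (simp cong: measurable_cong_sets)
  have b1: "\<bar>?b y\<bar> \<le> 1" for y
    using integral_weight_kernel_bounds[OF \<kappa>(2) \<eta>] by simp
  let ?h = "\<lambda>\<omega>. \<lambda>i\<in>{..1}. Y i \<omega>"
  have m1: "(\<integral>\<omega>. weight \<theta> x (Y 0 \<omega>) * indicator B (Y 2 \<omega>) \<partial>P)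
      = (\<integral>\<omega>. weight \<theta> x (Y 0 \<omega>) * measure (\<mu> (Y 1 \<omega>)) B \<partial>P)" if "B \<in> sets borel" for B
  proof -
    have "(\<integral>\<omega>. weight \<theta> x (?h \<omega> 0) * indicator B (Y (Suc 1) \<omega>) \<partial>P)
      = (\<integral>\<omega>. weight \<theta> x (?h \<omega> 0) * measure (\<mu> (Y 1 \<omega>)) B \<partial>P)"
    proof (rule markov_chain_on_integral[OF mc _ _ that, where H="\<lambda>h. weight \<theta> x (h 0)" and c=1])
      show "{..Suc 1} \<subseteq> {0, 1, 2::nat}" by auto
      show "cond_kernel P (Y 1) (Y (Suc 1)) \<mu>" using m by (simp add: numeral_2_eq_2)
      show "(\<lambda>h. weight \<theta> x (h 0)) \<in> borel_measurable (PiM {..1::nat} (\<lambda>_. borel))"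
      proof -
        have "(\<lambda>h. h 0) \<in> borel_measurable (PiM {..1::nat} (\<lambda>_. borel :: real measure))"
          by (rule measurable_component_singleton) simp
        from measurable_compose[OF this measurable_weight] show ?thesis .
      qed
    qed (use weight_bounds[OF \<theta>] in auto)
    then show ?thesis by (simp add: numeral_2_eq_2)
  qed
  have i1: "integrable P (\<lambda>\<omega>. weight \<theta> x (Y 0 \<omega>) * indicator A (Y 2 \<omega>))"
    and i2: "integrable P (\<lambda>\<omega>. weight \<theta> x (Y 0 \<omega>) * measure (\<mu> (Y 1 \<omega>)) A)" if [measurable]: "A \<in> sets borel" for A
    using weight_bounds[OF \<theta>] kernel_measure_le_1[OF \<kappa>(2)]
    by (auto intro!: integrable_bounded[where c=1] mult_le_one simp: abs_mult split: split_indicator)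
  have "E u v = (\<integral>\<omega>. weight \<theta> x (Y 0 \<omega>) * weight \<eta> z (Y 2 \<omega>) \<partial>P)"
    unfolding ux vz by (rule copula_of_eq_integral_weight[OF prob_space_axioms Y(1,3) E \<theta> \<eta>])
  also have "\<dots> = (\<integral>\<omega>. (1-\<eta>) * (weight \<theta> x (Y 0 \<omega>) * indicator {..<z} (Y 2 \<omega>))
       + \<eta> * (weight \<theta> x (Y 0 \<omega>) * indicator {..z} (Y 2 \<omega>)) \<partial>P)"
    by (intro Bochner_Integration.integral_cong) (auto simp: weight_def algebra_simps)
  also have "\<dots> = (1-\<eta>) * (\<integral>\<omega>. weight \<theta> x (Y 0 \<omega>) * measure (\<mu> (Y 1 \<omega>)) {..<z} \<partial>P)
      + \<eta> * (\<integral>\<omega>. weight \<theta> x (Y 0 \<omega>) * measure (\<mu> (Y 1 \<omega>)) {..z} \<partial>P)"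
    by (simp add: i1 m1)
  also have "\<dots> = (\<integral>\<omega>. (1-\<eta>) * (weight \<theta> x (Y 0 \<omega>) * measure (\<mu> (Y 1 \<omega>)) {..<z})
      + \<eta> * (weight \<theta> x (Y 0 \<omega>) * measure (\<mu> (Y 1 \<omega>)) {..z}) \<partial>P)"
    by (simp add: i2[unfolded One_nat_def])
  also have "\<dots> = (\<integral>\<omega>. ?b (Y 1 \<omega>) * weight \<theta> x (Y 0 \<omega>) \<partial>P)"
    by (intro Bochner_Integration.integral_cong) (auto simp: integral_weight_kernel[OF \<kappa>(2)] algebra_simps)
  also have "\<dots> = (\<integral>\<omega>. ?b (Y 1 \<omega>) * ?a (Y 1 \<omega>) \<partial>P)"
    by (rule cond_kernel_weight[OF Y(1,2) k _ b1]) measurable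
  also have "\<dots> = (\<integral>y. ?b y * ?a y \<partial>distr P borel (Y 1))"
    by (subst integral_distr) auto
  also have "\<dots> = (\<integral>y. ?b y * ?a y \<partial>distr unit_interval borel R1.I)"
    unfolding R1.distr_I_eq_M by (rule refl)
  also have "\<dots> = (\<integral>t. ?b (R1.I t) * ?a (R1.I t) \<partial>unit_interval)"
    by (rule integral_distr) measurable
  also have "\<dots> = (\<integral>t. ?a (R1.I t) * ?b (R1.I t) \<partial>unit_interval)"
    by (simp only: mult.commute)
  finally show ?thesis using c d by blast
qed

text \<open>The two triples may have different sample spaces and different marginals. By uniqueness
  their densities agree almost everywhere on the unit interval, and the integral formula involves
  nothing else.\<close>

lemma markov_product_unique:
  assumes P: "markov_chain_on {0, 1, 2} P Y"
      "copula_of P (Y 0) (Y 1) C" "copula_of P (Y 1) (Y 2) D" "copula_of P (Y 0) (Y 2) E"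
    and P': "markov_chain_on {0, 1, 2} P' Y'"
      "copula_of P' (Y' 0) (Y' 1) C" "copula_of P' (Y' 1) (Y' 2) D" "copula_of P' (Y' 0) (Y' 2) E'"
  shows "E = E'"
proof (rule copula_eqI)
  show "copula E" "copula E'" using P(4) P'(4) by (simp_all add: copula_of_def Let_def)
next
  fix u v :: real assume uv: "0 < u" "u < 1" "0 < v" "v < 1"
  obtain c d where cd: "copula_density C u c" "copula_density (\<lambda>v s. D s v) v d"
     "E u v = (\<integral>t. c t * d t \<partial>unit_interval)"
    using copula_of_markov_triple[OF P uv] by blast
  obtain c' d' where cd': "copula_density C u c'" "copula_density (\<lambda>v s. D s v) v d'"
     "E' u v = (\<integral>t. c' t * d' t \<partial>unit_interval)"
    using copula_of_markov_triple[OF P' uv] by blast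
  have "AE t in unit_interval. c t * d t = c' t * d' t"
    using copula_density_unique[OF cd(1) cd'(1)] copula_density_unique[OF cd(2) cd'(2)]
    by eventually_elim simp
  then show "E u v = E' u v"
    unfolding cd cd' using cd(1,2) cd'(1,2)
    by (intro integral_cong_AE) (auto simp: copula_density_def intro!: borel_measurable_times)
qed

corollary markov_product_eqI:
  fixes P :: "(nat \<Rightarrow> real) measure"
  assumes "markov_chain_on {0, 1, 2} P Y"
    "copula_of P (Y 0) (Y 1) C" "copula_of P (Y 1) (Y 2) D" "copula_of P (Y 0) (Y 2) E"
  shows "markov_product C D = E"
  unfolding markov_product_def
proof (rule the_equality)
  show "\<exists>(P :: (nat \<Rightarrow> real) measure) Y. markov_chain_on {0, 1, 2} P Y \<and>
     copula_of P (Y 0) (Y 1) C \<and> copula_of P (Y 1) (Y 2) D \<and> copula_of P (Y 0) (Y 2) E"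
    using assms by blast
  show "E' = E" if "\<exists>(P :: (nat \<Rightarrow> real) measure) Y. markov_chain_on {0, 1, 2} P Y \<and>
     copula_of P (Y 0) (Y 1) C \<and> copula_of P (Y 1) (Y 2) D \<and> copula_of P (Y 0) (Y 2) E'" for E'
    using that markov_product_unique[OF _ _ _ _ assms] by blast
qed

section \<open>Existence of the copula of a pair\<close>

text \<open>With an independent uniform \<open>w\<close>, this spreads the atoms of \<open>D\<close> uniformly over the gaps of its
  distribution function.\<close>

definition distr_transform :: "real measure \<Rightarrow> real \<Rightarrow> real \<Rightarrow> real" where
  "distr_transform D x w = measure D {..<x} + w * (measure D {..x} - measure D {..<x})"

lemma measurable_distr_transform [measurable (raw)]:
  assumes D: "real_distribution D" and [measurable]: "f \<in> borel_measurable N" "g \<in> borel_measurable N"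
  shows "(\<lambda>\<omega>. distr_transform D (f \<omega>) (g \<omega>)) \<in> borel_measurable N"
proof -
  interpret real_distribution D by fact
  have [measurable]: "(\<lambda>x. measure D {..<x}) \<in> borel_measurable borel" "(\<lambda>x. measure D {..x}) \<in> borel_measurable borel"
    by (auto intro!: borel_measurable_mono monoI finite_measure_mono)
  show ?thesis unfolding distr_transform_def by measurable
qed

lemma unit_interval_atMost:
  assumes "\<theta> \<in> {0..1}"
  shows "measure unit_interval ({..\<theta>} \<inter> {0<..<1}) = \<theta>" "measure unit_interval ({..<\<theta>} \<inter> {0<..<1}) = \<theta>"
proof -
  have "measure unit_interval ({..\<theta>} \<inter> {0<..<1}) = measure lborel ({..\<theta>} \<inter> {0<..<1})"
    by (subst measure_restrict_space) auto
  also have "\<dots> = measure lborel (if \<theta> = 1 then {0<..<1} else {0<..\<theta>})"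
    using assms by (intro arg_cong[where f="measure lborel"]) auto
  finally show "measure unit_interval ({..\<theta>} \<inter> {0<..<1}) = \<theta>" using assms by (auto split: if_splits)
  have "measure unit_interval ({..<\<theta>} \<inter> {0<..<1}) = measure lborel ({..<\<theta>} \<inter> {0<..<1})"
    by (subst measure_restrict_space) auto
  also have "\<dots> = measure lborel {0<..<\<theta>}"
    using assms by (intro arg_cong[where f="measure lborel"]) auto
  finally show "measure unit_interval ({..<\<theta>} \<inter> {0<..<1}) = \<theta>" using assms by simp
qed

lemma (in prob_space) prob_pair_Times:
  assumes "prob_space U" "A \<in> sets M" "B \<in> sets U"
  shows "measure (M \<Otimes>\<^sub>M U) (A \<times> B) = measure M A * measure U B"
proof -
  interpret U: prob_space U by fact
  show ?thesis
    unfolding measure_def using assms by (simp add: U.emeasure_pair_measure_Times enn2real_mult)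
qed

text \<open>The transform is weakly increasing in the pair \<open>(X, w)\<close> ordered
  lexicographically. The event that it is at most the level at position \<open>\<theta>\<close> in
  the gap at \<open>x\<close> is therefore, up to a null set, the initial section
  \<open>X < x\<close>, or \<open>X = x\<close> and \<open>w \<le> \<theta>\<close>, whose mass is
  computed by independence. Every level in the open unit interval has this form, whence the uniform
  law.\<close>

lemma distr_transform:
  fixes X Z :: "'a \<Rightarrow> real"
  assumes M: "prob_space M" and X: "X \<in> borel_measurable M"
  defines "N \<equiv> M \<Otimes>\<^sub>M unit_interval" and "D \<equiv> distr M borel X"
  defines "T \<equiv> \<lambda>p. distr_transform D (X (fst p)) (snd p)"
  shows prob_space_distr_transform: "prob_space N"
    and measurable_distr_transform_pair: "T \<in> borel_measurable N"
    and distr_distr_transform: "distr N borel T = uniform_measure lborel {0..1}"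
    and prob_distr_transform: "\<And>x \<theta> Z B. \<theta> \<in> {0..1} \<Longrightarrow> Z \<in> borel_measurable M \<Longrightarrow> B \<in> sets borel \<Longrightarrow>
      measure N {p\<in>space N. T p \<le> (1 - \<theta>) * measure D {..<x} + \<theta> * measure D {..x} \<and> Z (fst p) \<in> B}
      = (1 - \<theta>) * measure M {\<omega>\<in>space M. X \<omega> < x \<and> Z \<omega> \<in> (B :: real set)}
        + \<theta> * measure M {\<omega>\<in>space M. X \<omega> \<le> x \<and> Z \<omega> \<in> B}"
proof -
  interpret prob_space M by fact
  interpret U: prob_space unit_interval by (rule prob_space_unit_interval)
  interpret P: pair_prob_space M unit_interval ..
  interpret D: cdf_distribution D
    unfolding cdf_distribution_def D_def using X by simp
  note [measurable] = X D.real_distribution_axioms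
  show N: "prob_space N" unfolding N_def by (rule P.P.prob_space_axioms)
  interpret N: prob_space N by fact
  have id: "(\<lambda>t. t) \<in> borel_measurable unit_interval"
    by (rule measurable_restrict_space1) simp
  have [measurable]: "fst \<in> measurable N M" unfolding N_def by measurable
  have [measurable]: "snd \<in> borel_measurable N"
    unfolding N_def by (rule measurable_compose[OF measurable_snd id])
  show T[measurable]: "T \<in> borel_measurable N"
    unfolding T_def by (rule measurable_distr_transform[OF D.real_distribution_axioms]) measurable
  let ?l = "\<lambda>x. measure D {..<x}" and ?r = "\<lambda>x. measure D {..x}"
  let ?u = "\<lambda>x \<theta>. (1 - \<theta>) * ?l x + \<theta> * ?r x"
  have lr: "?l x \<le> ?r x" for x by (rule D.finite_measure_mono) auto
  have rl: "?r x \<le> ?l y" if "x < y" for x y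
    using that by (intro D.finite_measure_mono) auto
  have snd01: "0 < snd p \<and> snd p < 1" if "p \<in> space N" for p
    using that by (auto simp: N_def space_pair_measure space_restrict_space)
  have T_bounds: "?l (X (fst p)) \<le> T p" "T p \<le> ?r (X (fst p))" if "p \<in> space N" for p
  proof -
    have w: "0 \<le> snd p" "snd p \<le> 1" using snd01[OF that] by auto
    show "?l (X (fst p)) \<le> T p"
      using w lr by (simp add: T_def distr_transform_def)
    have "snd p * (?r (X (fst p)) - ?l (X (fst p))) \<le> 1 * (?r (X (fst p)) - ?l (X (fst p)))"
      using w lr by (intro mult_right_mono) auto
    then show "T p \<le> ?r (X (fst p))" by (simp add: T_def distr_transform_def)
  qed
  have D_measure: "measure D B = measure M {\<omega>\<in>space M. X \<omega> \<in> B}" if "B \<in> sets borel" for B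
    unfolding D_def using that by (subst measure_distr) (auto intro!: arg_cong[where f="measure M"])
  have slice: "measure N {p\<in>space N. (X (fst p) < x \<or> X (fst p) = x \<and> snd p \<in> W) \<and> Z (fst p) \<in> B}
     = (1 - \<theta>) * measure M {\<omega>\<in>space M. X \<omega> < x \<and> Z \<omega> \<in> B} + \<theta> * measure M {\<omega>\<in>space M. X \<omega> \<le> x \<and> Z \<omega> \<in> B}"
    if W: "measure unit_interval (W \<inter> {0<..<1}) = \<theta>" "W \<in> sets borel"
      and [measurable]: "Z \<in> borel_measurable M" "B \<in> sets borel"
    for x \<theta> and W B :: "real set" and Z
  proof -
    have Wm: "W \<inter> {0<..<1} \<in> sets unit_interval"
      using W(2) by (auto simp: sets_restrict_space)
    let ?A = "{\<omega>\<in>space M. X \<omega> < x \<and> Z \<omega> \<in> B}" and ?A' = "{\<omega>\<in>space M. X \<omega> = x \<and> Z \<omega> \<in> B}"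
    have A: "?A \<in> sets M" "?A' \<in> sets M" by measurable
    have split: "{p\<in>space N. (X (fst p) < x \<or> X (fst p) = x \<and> snd p \<in> W) \<and> Z (fst p) \<in> B}
       = ?A \<times> space unit_interval \<union> ?A' \<times> (W \<inter> {0<..<1})"
      by (auto simp: N_def space_pair_measure space_restrict_space)
    have "measure N {p\<in>space N. (X (fst p) < x \<or> X (fst p) = x \<and> snd p \<in> W) \<and> Z (fst p) \<in> B}
       = measure N (?A \<times> space unit_interval) + measure N (?A' \<times> (W \<inter> {0<..<1}))"
      unfolding split
    proof (rule N.finite_measure_Union)
      show "?A \<times> space unit_interval \<in> sets N" "?A' \<times> (W \<inter> {0<..<1}) \<in> sets N"
        unfolding N_def by (intro pair_measureI A Wm sets.top)+
    qed auto
    also have "\<dots> = measure M ?A + measure M ?A' * \<theta>"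
    proof -
      have r: "measure N (A \<times> B) = measure M A * measure unit_interval B"
        if "A \<in> sets M" "B \<in> sets unit_interval" for A B
        unfolding N_def by (rule prob_pair_Times[OF prob_space_unit_interval that])
      show ?thesis using A r[of ?A "space unit_interval"] r[of ?A' "W \<inter> {0<..<1}"] Wm W(1)
        by (simp only: U.prob_space sets.top mult_1_right)
    qed
    finally have eq: "measure N {p\<in>space N. (X (fst p) < x \<or> X (fst p) = x \<and> snd p \<in> W) \<and> Z (fst p) \<in> B}
       = measure M ?A + measure M ?A' * \<theta>" .
    have diff: "?A' = {\<omega>\<in>space M. X \<omega> \<le> x \<and> Z \<omega> \<in> B} - ?A" by auto
    have mA': "measure M ?A' = measure M {\<omega>\<in>space M. X \<omega> \<le> x \<and> Z \<omega> \<in> B} - measure M ?A"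
      unfolding diff by (rule finite_measure_Diff) auto
    show ?thesis unfolding eq mA' by (simp add: algebra_simps)
  qed
  have slice_total: "measure N {p\<in>space N. X (fst p) < x \<or> X (fst p) = x \<and> snd p \<in> W} = ?u x \<theta>"
    if "measure unit_interval (W \<inter> {0<..<1}) = \<theta>" "W \<in> sets borel" for x \<theta> W
    using slice[OF that X, of UNIV] by (simp add: D_measure)
  \<comment> \<open>The distribution function may be flat to the right of \<open>x\<close>, so that
    different pairs share a value of \<open>T\<close>. Hence there are inclusions only, the opposite
    one with strict inequalities.\<close>
  have lower: "{p\<in>space N. X (fst p) < x \<or> X (fst p) = x \<and> snd p \<in> {..\<theta>}} \<subseteq> {p\<in>space N. T p \<le> ?u x \<theta>}"
    if \<theta>: "\<theta> \<in> {0..1}" for x \<theta>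
  proof safe
    fix \<omega> w assume p: "(\<omega>, w) \<in> space N"
    have lu: "?l x \<le> ?u x \<theta>"
      using mult_left_mono[OF lr[of x], of \<theta>] \<theta> by (simp add: algebra_simps)
    show "T (\<omega>, w) \<le> ?u x \<theta>" if "X (fst (\<omega>, w)) < x"
      using T_bounds(2)[OF p] rl[OF that] lu by simp
    show "T (\<omega>, w) \<le> ?u (X (fst (\<omega>, w))) \<theta>" if "snd (\<omega>, w) \<le> \<theta>"
      using mult_right_mono[OF that, of "?r (X \<omega>) - ?l (X \<omega>)"] lr[of "X \<omega>"]
      by (simp add: T_def distr_transform_def algebra_simps)
  qed
  have upper: "{p\<in>space N. T p < ?u x \<theta>} \<subseteq> {p\<in>space N. X (fst p) < x \<or> X (fst p) = x \<and> snd p \<in> {..<\<theta>}}"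
    if \<theta>: "\<theta> \<in> {0..1}" for x \<theta>
  proof safe
    fix \<omega> w assume p: "(\<omega>, w) \<in> space N" and less: "T (\<omega>, w) < ?u x \<theta>" and n: "\<not> X (fst (\<omega>, w)) < x"
    have ur: "?u x \<theta> \<le> ?r x"
      using mult_left_mono[OF lr[of x], of "1 - \<theta>"] \<theta> by (simp add: algebra_simps)
    show eq: "X (fst (\<omega>, w)) = x"
      using n T_bounds(1)[OF p] rl[of x "X \<omega>"] ur less by (cases "X \<omega> = x") auto
    have "w * (?r x - ?l x) < \<theta> * (?r x - ?l x)"
      using less eq by (simp add: T_def distr_transform_def algebra_simps)
    then show "snd (\<omega>, w) < \<theta>"
      using lr[of x] by (auto simp: mult_less_cancel_right)
  qed
  \<comment> \<open>The lower bound is direct. The upper inclusion controls only strict events, so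
    the event at \<open>u\<close> is enlarged to the strict events at levels \<open>v > u\<close>,
    and \<open>v\<close> decreases to \<open>u\<close>.\<close>
  have T_le: "measure N {p\<in>space N. T p \<le> u} = u" if u: "0 < u" "u < 1" for u
  proof (rule antisym)
    have less: "measure N {p\<in>space N. T p < v} \<le> v" if v: "0 < v" "v < 1" for v
    proof -
      obtain \<theta> where \<theta>: "\<theta> \<in> {0..1}" and ve: "v = ?u (D.I v) \<theta>"
        by (rule D.quantile_gap[OF v]) blast
      have "measure N {p\<in>space N. T p < v}
        \<le> measure N {p\<in>space N. X (fst p) < D.I v \<or> X (fst p) = D.I v \<and> snd p \<in> {..<\<theta>}}"
        using upper[OF \<theta>, of "D.I v"] unfolding ve[symmetric] by (intro N.finite_measure_mono) measurable
      also have "\<dots> = v"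
        using slice_total[OF unit_interval_atMost(2)[OF \<theta>], of "D.I v"] ve by simp
      finally show ?thesis .
    qed
    show "measure N {p\<in>space N. T p \<le> u} \<le> u"
    proof (rule dense_ge_bounded[OF u(2)])
      fix v assume v: "u < v" "v < 1"
      have "measure N {p\<in>space N. T p \<le> u} \<le> measure N {p\<in>space N. T p < v}"
        using v by (intro N.finite_measure_mono) auto
      also have "\<dots> \<le> v" using u v by (intro less) auto
      finally show "measure N {p\<in>space N. T p \<le> u} \<le> v" .
    qed
    obtain \<theta> where \<theta>: "\<theta> \<in> {0..1}" and ue: "u = ?u (D.I u) \<theta>"
      by (rule D.quantile_gap[OF u]) blast
    have "u = measure N {p\<in>space N. X (fst p) < D.I u \<or> X (fst p) = D.I u \<and> snd p \<in> {..\<theta>}}"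
      using slice_total[OF unit_interval_atMost(1)[OF \<theta>], of "D.I u"] ue by simp
    also have "\<dots> \<le> measure N {p\<in>space N. T p \<le> u}"
      using lower[OF \<theta>, of "D.I u"] unfolding ue[symmetric] by (intro N.finite_measure_mono) measurable
    finally show "u \<le> measure N {p\<in>space N. T p \<le> u}" .
  qed
  have T_cdf: "measure N {p\<in>space N. T p \<le> u} = max 0 (min 1 u)" for u
  proof -
    consider "u \<le> 0" | "1 \<le> u" | "0 < u" "u < 1" by linarith
    then show ?thesis
    proof cases
      case 1
      have "measure N {p\<in>space N. T p \<le> u} \<le> 0"
      proof (rule dense_ge_bounded[of 0 1])
        fix v :: real assume v: "0 < v" "v < 1"
        have "measure N {p\<in>space N. T p \<le> u} \<le> measure N {p\<in>space N. T p \<le> v}"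
          using 1 v by (intro N.finite_measure_mono) auto
        with T_le[OF v] show "measure N {p\<in>space N. T p \<le> u} \<le> v" by simp
      qed simp
      with 1 show ?thesis by (simp add: antisym)
    next
      case 2
      have "T p \<le> u" if "p \<in> space N" for p
        using T_bounds(2)[OF that] D.prob_le_1[of "{..X (fst p)}"] 2 by linarith
      then have "{p\<in>space N. T p \<le> u} = space N" by auto
      with 2 show ?thesis by (simp add: N.prob_space)
    next
      case 3 then show ?thesis by (simp add: T_le)
    qed
  qed
  show "distr N borel T = uniform_measure lborel {0..1}"
  proof (rule cdf_unique)
    show "real_distribution (distr N borel T)" by simp
    have "prob_space (uniform_measure lborel {0..1::real})"
      by (rule prob_space_uniform_measure) auto
    then show "real_distribution (uniform_measure lborel {0..1})"
      by (simp add: real_distribution_def real_distribution_axioms_def)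
    show "cdf (distr N borel T) = cdf (uniform_measure lborel {0..1})"
    proof
      fix u
      have "cdf (distr N borel T) u = measure N {p\<in>space N. T p \<le> u}"
        unfolding cdf_def by (subst measure_distr) (auto intro!: arg_cong[where f="measure N"])
      then show "cdf (distr N borel T) u = cdf (uniform_measure lborel {0..1}) u"
        by (simp add: T_cdf cdf_def uniform_01_atMost)
    qed
  qed
  show "measure N {p\<in>space N. T p \<le> ?u x \<theta> \<and> Z (fst p) \<in> B}
      = (1 - \<theta>) * measure M {\<omega>\<in>space M. X \<omega> < x \<and> Z \<omega> \<in> (B :: real set)}
        + \<theta> * measure M {\<omega>\<in>space M. X \<omega> \<le> x \<and> Z \<omega> \<in> B}"
    if \<theta>: "\<theta> \<in> {0..1}" and Z[measurable]: "Z \<in> borel_measurable M" and B[measurable]: "B \<in> sets borel"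
    for x \<theta> Z B
  proof -
    let ?A = "{p\<in>space N. X (fst p) < x \<or> X (fst p) = x \<and> snd p \<in> {..\<theta>}}"
    let ?S = "{p\<in>space N. T p \<le> ?u x \<theta>}"
    have "?u x \<theta> \<in> {0..1}"
      using \<theta> by (auto intro!: convex_bound_le add_nonneg_nonneg mult_nonneg_nonneg)
    \<comment> \<open>The section \<open>?A\<close> is contained in \<open>?S\<close> and both have
      mass \<open>?u x \<theta>\<close>; intersecting with an event about \<open>Z\<close> therefore
      changes nothing.\<close>
    then have "measure N (?S - ?A) = 0"
      using lower[OF \<theta>, of x] slice_total[OF unit_interval_atMost(1)[OF \<theta>], of x] T_cdf[of "?u x \<theta>"]
      by (subst N.finite_measure_Diff) auto
    moreover have "measure N {p\<in>space N. T p \<le> ?u x \<theta> \<and> Z (fst p) \<in> B} \<le>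
       measure N {p\<in>space N. (X (fst p) < x \<or> X (fst p) = x \<and> snd p \<in> {..\<theta>}) \<and> Z (fst p) \<in> B} + measure N (?S - ?A)"
      by (rule order_trans[OF N.finite_measure_mono measure_Un_le]) auto
    moreover have "measure N {p\<in>space N. (X (fst p) < x \<or> X (fst p) = x \<and> snd p \<in> {..\<theta>}) \<and> Z (fst p) \<in> B}
      \<le> measure N {p\<in>space N. T p \<le> ?u x \<theta> \<and> Z (fst p) \<in> B}"
      using lower[OF \<theta>, of x] by (intro N.finite_measure_mono) auto
    ultimately show ?thesis
      using slice[OF unit_interval_atMost(1)[OF \<theta>] _ Z B, of x] by simp
  qed
qed

text \<open>Two independent uniform variables are adjoined in succession, one for the atoms of
  \<open>X\<close> and one for those of \<open>Y\<close>; \<open>E\<close> is the joint distribution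
  function of the two transforms.\<close>

theorem copula_of_exists:
  assumes M: "prob_space M" and X: "X \<in> borel_measurable M" and Y: "Y \<in> borel_measurable M"
  shows "\<exists>E. copula_of M X Y E"
proof -
  interpret prob_space M by fact
  interpret U: prob_space unit_interval by (rule prob_space_unit_interval)
  let ?N = "M \<Otimes>\<^sub>M unit_interval"
  let ?T = "\<lambda>p. distr_transform (distr M borel X) (X (fst p)) (snd p)"
  let ?Y = "\<lambda>p. Y (fst p)"
  note N = prob_space_distr_transform[OF M X]
  interpret N: prob_space ?N by (rule N)
  note T = measurable_distr_transform_pair[OF M X]
  have Y': "?Y \<in> borel_measurable ?N"
    by (rule measurable_compose[OF measurable_fst Y])
  let ?N2 = "?N \<Otimes>\<^sub>M unit_interval"
  let ?S = "\<lambda>q. distr_transform (distr ?N borel ?Y) (?Y (fst q)) (snd q)"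
  note N2 = prob_space_distr_transform[OF N Y']
  interpret N2: prob_space ?N2 by (rule N2)
  note S = measurable_distr_transform_pair[OF N Y']
  have T2: "(\<lambda>q. ?T (fst q)) \<in> borel_measurable ?N2"
    by (rule measurable_compose[OF measurable_fst T])
  have DY: "distr ?N borel ?Y = distr M borel Y"
  proof -
    have "distr ?N borel ?Y = distr (distr ?N M fst) borel Y"
      using Y by (subst distr_distr) (auto simp: comp_def)
    then show ?thesis by (simp add: U.distr_pair_fst)
  qed
  let ?Fl = "\<lambda>x. measure (distr M borel X) {..<x}" and ?Fr = "\<lambda>x. measure (distr M borel X) {..x}"
  let ?Gl = "\<lambda>y. measure (distr M borel Y) {..<y}" and ?Gr = "\<lambda>y. measure (distr M borel Y) {..y}"
  define E where "E u v = measure ?N2 {q\<in>space ?N2. ?S q \<le> v \<and> ?T (fst q) \<in> {..u}}" for u v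
  \<comment> \<open>The intermediate stage, with \<open>X\<close> already transformed and
    \<open>Y\<close> not yet. It separates interpolation in the second coordinate, from
    \<open>E\<close> to \<open>K\<close>, from interpolation in the first, from \<open>K\<close> to
    probabilities of the pair.\<close>
  define K where "K u B = measure ?N {p\<in>space ?N. ?Y p \<in> B \<and> ?T p \<in> {..u}}" for u B
  have E_gap: "E u ((1 - t) * ?Gl y + t * ?Gr y) = (1 - t) * K u {..<y} + t * K u {..y}"
    if "t \<in> {0..1}" for t u y
    using prob_distr_transform[OF N Y' that T, of "{..u}" y] by (simp add: E_def K_def DY)
  have E_l: "E u (?Gl y) = K u {..<y}" and E_r: "E u (?Gr y) = K u {..y}" for u y
    using E_gap[of 0 u y] E_gap[of 1 u y] by auto
  have K_gap: "K ((1 - t) * ?Fl x + t * ?Fr x) B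
      = (1 - t) * measure M {\<omega>\<in>space M. X \<omega> < x \<and> Y \<omega> \<in> B} + t * measure M {\<omega>\<in>space M. X \<omega> \<le> x \<and> Y \<omega> \<in> B}"
    if "t \<in> {0..1}" "B \<in> sets borel" for t x B
    using prob_distr_transform[OF M X that(1) Y that(2), of x] by (simp add: K_def conj_commute)
  have K_lin: "K ((1 - t) * ?Fl x + t * ?Fr x) B = (1 - t) * K (?Fl x) B + t * K (?Fr x) B"
    if "t \<in> {0..1}" "B \<in> sets borel" for t x B
    using K_gap[OF that, of x] K_gap[of 0 B x] K_gap[of 1 B x] that by simp
  have copE: "copula E"
    unfolding copula_def
  proof (intro exI[of _ "distr ?N2 borel (\<lambda>q. (?T (fst q), ?S q))"] conjI allI)
    have TS: "(\<lambda>q. (?T (fst q), ?S q)) \<in> measurable ?N2 borel"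
      unfolding borel_prod[symmetric] by (rule measurable_Pair[OF T2 S])
    show "prob_space (distr ?N2 borel (\<lambda>q. (?T (fst q), ?S q)))"
      by (rule N2.prob_space_distr[OF TS])
    show "distr (distr ?N2 borel (\<lambda>q. (?T (fst q), ?S q))) borel fst = uniform_measure lborel {0..1}"
    proof -
      have "distr (distr ?N2 borel (\<lambda>q. (?T (fst q), ?S q))) borel fst = distr ?N2 borel (\<lambda>q. ?T (fst q))"
        using TS by (subst distr_distr) (auto simp: comp_def borel_measurable_continuous_onI continuous_intros)
      also have "\<dots> = distr (distr ?N2 ?N fst) borel ?T"
        using T by (subst distr_distr) (auto simp: comp_def)
      also have "\<dots> = uniform_measure lborel {0..1}"
        by (simp add: U.distr_pair_fst distr_distr_transform[OF M X])
      finally show ?thesis .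
    qed
    show "distr (distr ?N2 borel (\<lambda>q. (?T (fst q), ?S q))) borel snd = uniform_measure lborel {0..1}"
    proof -
      have "distr (distr ?N2 borel (\<lambda>q. (?T (fst q), ?S q))) borel snd = distr ?N2 borel ?S"
        using TS by (subst distr_distr) (auto simp: comp_def borel_measurable_continuous_onI continuous_intros)
      then show ?thesis by (simp add: distr_distr_transform[OF N Y'])
    qed
    show "E u v = measure (distr ?N2 borel (\<lambda>q. (?T (fst q), ?S q))) ({..u} \<times> {..v})" for u v
    proof -
      have "{..u} \<times> {..v} \<in> sets (borel :: (real \<times> real) measure)"
        unfolding borel_prod[symmetric] by (rule pair_measureI) auto
      then show ?thesis
        unfolding E_def using TS by (subst measure_distr) (auto intro!: arg_cong[where f="measure ?N2"])
    qed
  qed simp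
  \<comment> \<open>Interpolation in the first coordinate is required for every \<open>v\<close>. A
    \<open>v\<close> in the open unit interval lies in a gap of the distribution function of
    \<open>Y\<close>, which reduces the claim to \<open>K\<close>; elsewhere the copula values are
    explicit.\<close>
  have E_lin: "E ((1 - t) * ?Fl x + t * ?Fr x) v = (1 - t) * E (?Fl x) v + t * E (?Fr x) v"
    if t: "t \<in> {0..1}" for t x v
  proof -
    interpret RX: cdf_distribution "distr M borel X"
      unfolding cdf_distribution_def using X by simp
    interpret RY: cdf_distribution "distr M borel Y"
      unfolding cdf_distribution_def using Y by simp
    note sw = copula_swap[OF copE]
    consider "v \<le> 0" | "1 \<le> v" | "0 < v" "v < 1" by linarith
    then show ?thesis
    proof cases
      case 1 then show ?thesis using copula_le_0[OF sw] by simp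
    next
      case 2
      have "w \<in> {0..1} \<Longrightarrow> E w v = w" for w
        using copula_ge_1[OF sw 2, of w] by simp
      moreover have "(1 - t) * ?Fl x + t * ?Fr x \<in> {0..1}"
        using t by (auto intro!: convex_bound_le)
      ultimately show ?thesis by simp
    next
      case 3
      obtain \<theta> y where \<theta>: "\<theta> \<in> {0..1}" "v = (1 - \<theta>) * ?Gl y + \<theta> * ?Gr y"
        by (rule RY.quantile_gap[OF 3]) blast
      show ?thesis
        unfolding \<theta>(2) E_gap[OF \<theta>(1)] K_lin[OF t lessThan_borel] K_lin[OF t atMost_borel]
        by (simp add: algebra_simps)
    qed
  qed
  have "measure M {\<omega>\<in>space M. X \<omega> \<le> x \<and> Y \<omega> \<le> y} = E (?Fr x) (?Gr y)" for x y
    unfolding E_r using K_gap[of 1 "{..y}" x] by simp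
  moreover have "E u ((1 - t) * ?Gl y + t * ?Gr y) = (1 - t) * E u (?Gl y) + t * E u (?Gr y)"
    if "t \<in> {0..1}" for t u y
    unfolding E_gap[OF that] E_l E_r by (rule refl)
  ultimately have "copula_of M X Y E"
    using copE E_lin by (simp add: copula_of_def Let_def cdf_def)
  then show ?thesis by blast
qed

section \<open>Idempotent Markov copulas\<close>

lemma copula_of_distr:
  assumes S: "S \<in> measurable M N" and X: "X \<in> borel_measurable N" and Y: "Y \<in> borel_measurable N"
  shows "copula_of (distr M N S) X Y C \<longleftrightarrow> copula_of M (\<lambda>\<omega>. X (S \<omega>)) (\<lambda>\<omega>. Y (S \<omega>)) C"
proof -
  note [measurable] = X Y
  have "distr (distr M N S) borel X = distr M borel (\<lambda>\<omega>. X (S \<omega>))"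
    "distr (distr M N S) borel Y = distr M borel (\<lambda>\<omega>. Y (S \<omega>))"
    using S X Y by (simp_all add: distr_distr comp_def)
  moreover have "measure (distr M N S) {\<omega>\<in>space (distr M N S). X \<omega> \<le> x \<and> Y \<omega> \<le> y}
     = measure M {\<omega>\<in>space M. X (S \<omega>) \<le> x \<and> Y (S \<omega>) \<le> y}" for x y
    using S measurable_space[OF S] by (subst measure_distr) (auto intro!: arg_cong[where f="measure M"])
  ultimately show ?thesis by (simp add: copula_of_def Let_def)
qed

text \<open>\<open>markov_product\<close> ranges over measures on the sequence space only, so the
  given chain has to be replaced by the coordinate process under its law.\<close>

lemma markov_chain_on_coordinates:
  assumes mc: "markov_chain M X"
  shows "markov_chain_on {0, 1, 2} (distr M (PiM UNIV (\<lambda>_. borel)) (\<lambda>\<omega> n. X n \<omega>)) (\<lambda>n h. h n)"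
proof -
  interpret prob_space M by (rule markov_chain_onD[OF mc])
  have X[measurable]: "X n \<in> borel_measurable M" for n using markov_chain_onD[OF mc] by blast
  have S: "(\<lambda>\<omega> n. X n \<omega>) \<in> measurable M (PiM UNIV (\<lambda>_. borel))"
    by (rule measurable_PiM_single') auto
  have "\<forall>n. \<exists>\<kappa>. cond_kernel M (X n) (X (Suc n)) \<kappa>" by (auto intro!: cond_kernel_exists)
  then obtain \<kappa> where k: "\<And>n. cond_kernel M (X n) (X (Suc n)) (\<kappa> n)" by metis
  have \<kappa>[measurable]: "\<kappa> n \<in> measurable borel (prob_algebra borel)" for n
    using k[of n] by (simp add: cond_kernel_def)
  have coord[measurable]: "(\<lambda>h. h n) \<in> borel_measurable (PiM UNIV (\<lambda>_. borel :: real measure))" for n :: nat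
    by (rule measurable_component_singleton) simp
  show ?thesis
  proof (rule markov_chain_onI[OF _ _ _ \<kappa>])
    show "prob_space (distr M (PiM UNIV (\<lambda>_. borel)) (\<lambda>\<omega> n. X n \<omega>))"
      by (rule prob_space_distr[OF S])
    show "(\<lambda>h. h i) \<in> borel_measurable (distr M (PiM UNIV (\<lambda>_. borel)) (\<lambda>\<omega> n. X n \<omega>))" for i
      by simp
    show "{..n} \<subseteq> {0, 1, 2}" if "Suc n \<in> {0, 1, 2}" for n :: nat
      using that by auto
    fix n :: nat and A :: "(nat \<Rightarrow> real) set" and B :: "real set" assume A[measurable]: "A \<in> sets (PiM {..n} (\<lambda>_. borel))" and B[measurable]: "B \<in> sets borel"
    have [measurable]: "(\<lambda>h. \<lambda>i\<in>{..n}. h i) \<in> measurable (PiM UNIV (\<lambda>_. borel :: real measure)) (PiM {..n} (\<lambda>_. borel))"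
      by (rule measurable_restrict) auto
    show "(\<integral>h. indicator A (\<lambda>i\<in>{..n}. h i) * indicator B (h (Suc n)) \<partial>distr M (PiM UNIV (\<lambda>_. borel)) (\<lambda>\<omega> n. X n \<omega>))
       = (\<integral>h. indicator A (\<lambda>i\<in>{..n}. h i) * measure (\<kappa> n (h n)) B \<partial>distr M (PiM UNIV (\<lambda>_. borel)) (\<lambda>\<omega> n. X n \<omega>))"
      using markov_chain_on_integral[OF mc _ k B, of n "indicator A" 1]
      by (simp add: integral_distr[OF S] indicator_abs_le_1)
  qed
qed

text \<open>The pair \<open>(X 0, X 2)\<close> has some copula \<open>E\<close>. With this witness
  the definite description is known to denote \<open>E\<close>, and idempotence identifies
  \<open>E\<close> with \<open>C\<close>.\<close>

lemma copula_of_idempotent: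
  assumes mc: "markov_chain M X"
    and C: "\<And>n. copula_of M (X n) (X (Suc n)) C" and idem: "markov_product C C = C"
  shows "copula_of M (X 0) (X 2) C"
proof -
  interpret prob_space M by (rule markov_chain_onD[OF mc])
  have X[measurable]: "X n \<in> borel_measurable M" for n using markov_chain_onD[OF mc] by blast
  have S: "(\<lambda>\<omega> n. X n \<omega>) \<in> measurable M (PiM UNIV (\<lambda>_. borel))"
    by (rule measurable_PiM_single') auto
  have coord: "(\<lambda>h. h n) \<in> borel_measurable (PiM UNIV (\<lambda>_. borel :: real measure))" for n :: nat
    by (rule measurable_component_singleton) simp
  obtain E where E: "copula_of M (X 0) (X 2) E"
    using copula_of_exists[OF prob_space_axioms X X] by blast
  have "markov_product C C = E"
    using C[of 0] C[of 1] E
    by (intro markov_product_eqI[OF markov_chain_on_coordinates[OF mc]])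
       (simp_all add: copula_of_distr[OF S coord coord] numeral_2_eq_2)
  with E idem show ?thesis by simp
qed

lemma distr_pair_eqI:
  fixes X Y X' Y' :: "'a \<Rightarrow> real"
  assumes M: "prob_space M" and [measurable]: "X \<in> borel_measurable M" "Y \<in> borel_measurable M"
    "X' \<in> borel_measurable M" "Y' \<in> borel_measurable M"
    and eq: "\<And>x y. measure M {\<omega>\<in>space M. X \<omega> \<le> x \<and> Y \<omega> \<le> y} = measure M {\<omega>\<in>space M. X' \<omega> \<le> x \<and> Y' \<omega> \<le> y}"
  shows "distr M (borel \<Otimes>\<^sub>M borel) (\<lambda>\<omega>. (X \<omega>, Y \<omega>)) = distr M (borel \<Otimes>\<^sub>M borel) (\<lambda>\<omega>. (X' \<omega>, Y' \<omega>))"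
    (is "?L = ?R")
proof -
  interpret prob_space M by fact
  let ?E = "range (\<lambda>(a, b). {..a::real} \<times> {..b::real})"
  have sets: "sets (borel \<Otimes>\<^sub>M borel :: (real \<times> real) measure) = sigma_sets UNIV ?E"
  proof -
    have "range (\<lambda>(a::real, b::real). {..a} \<times> {..b}) = range (atMost :: real \<times> real \<Rightarrow> _)"
      by (intro image_cong) auto
    then show ?thesis
      unfolding borel_prod by (subst borel_eq_atMost) auto
  qed
  have rect: "{..a} \<times> {..b} \<in> sets (borel \<Otimes>\<^sub>M borel)" for a b :: real
    by (rule pair_measureI) auto
  show ?thesis
  proof (rule measure_eqI_generator_eq)
    show "Int_stable ?E"
    proof (rule Int_stableI)
      fix A B assume "A \<in> ?E" "B \<in> ?E"
      then obtain a b c d where "A = {..a} \<times> {..b}" "B = {..c} \<times> {..d}" by auto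
      then have "A \<inter> B = (\<lambda>(a, b). {..a} \<times> {..b}) (min a c, min b d)" by auto
      then show "A \<inter> B \<in> ?E" by blast
    qed
    show "?E \<subseteq> Pow UNIV" by simp
    show "emeasure ?L Z = emeasure ?R Z" if "Z \<in> ?E" for Z
    proof -
      from that obtain a b where Z: "Z = {..a} \<times> {..b}" by auto
      have "(\<lambda>\<omega>. (X \<omega>, Y \<omega>)) -` ({..a} \<times> {..b}) \<inter> space M = {\<omega>\<in>space M. X \<omega> \<le> a \<and> Y \<omega> \<le> b}"
        "(\<lambda>\<omega>. (X' \<omega>, Y' \<omega>)) -` ({..a} \<times> {..b}) \<inter> space M = {\<omega>\<in>space M. X' \<omega> \<le> a \<and> Y' \<omega> \<le> b}"
        by auto
      then show ?thesis
        unfolding Z by (simp add: emeasure_distr rect emeasure_eq_measure eq)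
    qed
    show "sets ?L = sigma_sets UNIV ?E" "sets ?R = sigma_sets UNIV ?E" by (simp_all add: sets)
    show "range (\<lambda>i::nat. {..real i} \<times> {..real i}) \<subseteq> ?E" by auto
    show "(\<Union>i::nat. {..real i} \<times> {..real i}) = UNIV"
    proof (intro equalityI subsetI; clarify?)
      fix a b :: real
      obtain i :: nat where "max a b \<le> real i" using real_arch_simple by blast
      then show "(a, b) \<in> (\<Union>i::nat. {..real i} \<times> {..real i})" by auto
    qed simp
    have "prob_space ?L" by (rule prob_space_distr) measurable
    then show "emeasure ?L ({..real i} \<times> {..real i}) \<noteq> \<infinity>" for i :: nat
      using prob_space.finite_measure finite_measure.emeasure_finite by (metis infinity_ennreal_def)
  qed
qed

section \<open>A strong law of large numbers\<close>

text \<open>Let \<open>m\<close> be the integer part of the square root of \<open>n\<close>. Then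
  \<open>n\<close> exceeds the square of \<open>m\<close> by at most \<open>2 * m\<close>, so
  \<open>S\<close> moves by at most \<open>2 * m\<close> in between; after division by
  \<open>n\<close>, which is at least that square, the error is at most
  \<open>2 / m\<close>.\<close>

lemma average_tendsto_0_squares:
  fixes S :: "nat \<Rightarrow> real"
  assumes step: "\<And>n. \<bar>S (Suc n) - S n\<bar> \<le> 1"
    and lim: "(\<lambda>m. S (m\<^sup>2) / real (m\<^sup>2)) \<longlonglongrightarrow> 0"
  shows "(\<lambda>n. S n / real n) \<longlonglongrightarrow> 0"
proof -
  define m where "m n = nat \<lfloor>sqrt (real n)\<rfloor>" for n :: nat
  have m_le: "(m n)\<^sup>2 \<le> n" for n
  proof -
    have "real (m n) \<le> sqrt (real n)" by (simp add: m_def)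
    then have "(real (m n))\<^sup>2 \<le> (sqrt (real n))\<^sup>2" by (intro power_mono) auto
    then have "real ((m n)\<^sup>2) \<le> real n" by simp
    then show ?thesis by (simp only: of_nat_le_iff)
  qed
  have m_gt: "n \<le> (m n)\<^sup>2 + 2 * m n" for n
  proof -
    have "sqrt (real n) < real (m n) + 1" by (simp add: m_def)
    then have "(sqrt (real n))\<^sup>2 < (real (m n) + 1)\<^sup>2" by (intro power_strict_mono) auto
    then have "real n < real ((m n + 1)\<^sup>2)" by (simp add: add.commute)
    then have "n < (m n + 1)\<^sup>2" by (simp only: of_nat_less_iff)
    then show ?thesis by (simp add: power2_eq_square)
  qed
  have m_top: "filterlim m at_top at_top"
    unfolding filterlim_at_top
  proof
    fix Z
    show "eventually (\<lambda>n. Z \<le> m n) at_top"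
      using eventually_ge_at_top[of "Z\<^sup>2"]
    proof eventually_elim
      fix n assume "Z\<^sup>2 \<le> n"
      then have "real Z \<le> sqrt (real n)" by (intro real_le_rsqrt) (metis of_nat_le_iff of_nat_power)
      then show "Z \<le> m n" by (simp add: m_def le_nat_floor)
    qed
  qed
  have var: "\<bar>S (n + d) - S n\<bar> \<le> real d" for n d
  proof (induction d)
    case (Suc d)
    then show ?case using step[of "n + d"] by simp
  qed simp
  have bound: "\<bar>S n / real n\<bar> \<le> \<bar>S ((m n)\<^sup>2) / real ((m n)\<^sup>2)\<bar> + 2 * inverse (real (m n))" if "1 \<le> n" for n
  proof -
    have m1: "1 \<le> m n" using m_gt[of n] that by (cases "m n") auto
    have d: "real (n - (m n)\<^sup>2) \<le> 2 * real (m n)"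
      using m_gt[of n] m_le[of n] by linarith
    have "\<bar>S n\<bar> \<le> \<bar>S ((m n)\<^sup>2)\<bar> + 2 * real (m n)"
      using var[of "(m n)\<^sup>2" "n - (m n)\<^sup>2"] m_le[of n] d by simp
    then have "\<bar>S n / real n\<bar> \<le> (\<bar>S ((m n)\<^sup>2)\<bar> + 2 * real (m n)) / real n"
      using that by (simp add: divide_right_mono abs_divide)
    also have "\<dots> \<le> (\<bar>S ((m n)\<^sup>2)\<bar> + 2 * real (m n)) / real ((m n)\<^sup>2)"
    proof (rule divide_left_mono)
      show "real ((m n)\<^sup>2) \<le> real n" using m_le[of n] by (simp only: of_nat_le_iff)
      show "0 < real n * real ((m n)\<^sup>2)" using that m1 by simp
    qed simp
    also have "\<dots> = \<bar>S ((m n)\<^sup>2) / real ((m n)\<^sup>2)\<bar> + 2 * inverse (real (m n))"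
      using m1 by (simp add: field_simps power2_eq_square)
    finally show ?thesis .
  qed
  have "(\<lambda>n. \<bar>S ((m n)\<^sup>2) / real ((m n)\<^sup>2)\<bar> + 2 * inverse (real (m n))) \<longlonglongrightarrow> \<bar>0\<bar> + 2 * 0"
    by (intro tendsto_intros filterlim_compose[OF lim m_top]
        filterlim_compose[OF lim_inverse_n m_top])
  then have lim0: "(\<lambda>n. \<bar>S ((m n)\<^sup>2) / real ((m n)\<^sup>2)\<bar> + 2 * inverse (real (m n))) \<longlonglongrightarrow> 0"
    by (simp only: abs_zero mult_zero_right add_0)
  have "eventually (\<lambda>n. norm (S n / real n) \<le> \<bar>S ((m n)\<^sup>2) / real ((m n)\<^sup>2)\<bar> + 2 * inverse (real (m n))) sequentially"
    unfolding real_norm_def by (rule eventually_mono[OF eventually_ge_at_top[of 1] bound])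
  then show ?thesis
    by (rule Lim_null_comparison[OF _ lim0])
qed

text \<open>Second moments give convergence along the squares only, which suffices for bounded variables.\<close>

lemma (in prob_space) strong_law_orthogonal:
  fixes Z :: "nat \<Rightarrow> 'a \<Rightarrow> real"
  assumes Z[measurable]: "\<And>k. Z k \<in> borel_measurable M" and bd: "\<And>k \<omega>. \<bar>Z k \<omega>\<bar> \<le> 1"
    and orth: "\<And>j k. j \<noteq> k \<Longrightarrow> (\<integral>\<omega>. Z j \<omega> * Z k \<omega> \<partial>M) = 0"
  shows "AE \<omega> in M. (\<lambda>n. (\<Sum>k<n. Z k \<omega>) / real n) \<longlonglongrightarrow> 0"
proof -
  let ?S = "\<lambda>n \<omega>. \<Sum>k<n. Z k \<omega>"
  have prod_bd: "\<bar>Z j \<omega> * Z k \<omega>\<bar> \<le> 1" for j k \<omega>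
    using bd by (simp add: abs_mult mult_le_one)
  have int: "integrable M (\<lambda>\<omega>. Z j \<omega> * Z k \<omega>)" for j k
    by (rule integrable_bounded[where c=1]) (use prod_bd in auto)
  have sq: "(?S n \<omega>)\<^sup>2 = (\<Sum>j<n. \<Sum>k<n. Z j \<omega> * Z k \<omega>)" for n \<omega>
    by (simp add: power2_eq_square sum_product)
  have int_S: "integrable M (\<lambda>\<omega>. (?S n \<omega>)\<^sup>2)" for n
    unfolding sq by (intro Bochner_Integration.integrable_sum int)
  \<comment> \<open>Orthogonality removes the off-diagonal terms of the expanded square, and each of
    the \<open>n\<close> diagonal terms is at most 1.\<close>
  have var: "(\<integral>\<omega>. (?S n \<omega>)\<^sup>2 \<partial>M) \<le> real n" for n
  proof -
    have "(\<integral>\<omega>. (?S n \<omega>)\<^sup>2 \<partial>M) = (\<Sum>j<n. \<Sum>k<n. \<integral>\<omega>. Z j \<omega> * Z k \<omega> \<partial>M)"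
      unfolding sq by (simp add: int Bochner_Integration.integral_sum)
    also have "\<dots> = (\<Sum>j<n. \<Sum>k<n. if k = j then \<integral>\<omega>. Z j \<omega> * Z j \<omega> \<partial>M else 0)"
      using orth by (intro sum.cong refl) auto
    also have "\<dots> = (\<Sum>j<n. \<integral>\<omega>. Z j \<omega> * Z j \<omega> \<partial>M)"
      by (simp add: sum.delta)
    also have "\<dots> \<le> (\<Sum>j<n. \<integral>\<omega>. 1 \<partial>M)"
      using prod_bd by (intro sum_mono integral_mono int) (auto dest: abs_le_D1)
    finally show ?thesis by (simp add: prob_space)
  qed
  \<comment> \<open>The expectation of \<open>f m\<close> is at most the inverse square of
    \<open>Suc m\<close>. These bounds are summable, so almost surely the series of the
    \<open>f m\<close> converges and its terms tend to 0. The shift to \<open>Suc m\<close> avoids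
    division by 0.\<close>
  define f where "f m \<omega> = (?S ((Suc m)\<^sup>2) \<omega> / real ((Suc m)\<^sup>2))\<^sup>2" for m \<omega>
  have [measurable]: "f m \<in> borel_measurable M" for m unfolding f_def by measurable
  have f_eq: "f m \<omega> = (?S ((Suc m)\<^sup>2) \<omega>)\<^sup>2 / (real ((Suc m)\<^sup>2))\<^sup>2" for m \<omega>
    by (simp add: f_def power_divide)
  have nn: "(\<integral>\<^sup>+\<omega>. ennreal (f m \<omega>) \<partial>M) \<le> ennreal (inverse (real (Suc m) ^ 2))" for m
  proof -
    have "(\<integral>\<^sup>+\<omega>. ennreal (f m \<omega>) \<partial>M) = ennreal (\<integral>\<omega>. f m \<omega> \<partial>M)"
      unfolding f_eq by (intro nn_integral_eq_integral integrable_divide int_S) auto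
    also have "(\<integral>\<omega>. f m \<omega> \<partial>M) \<le> real ((Suc m)\<^sup>2) / (real ((Suc m)\<^sup>2))\<^sup>2"
      unfolding f_eq by (simp only: integral_divide_zero) (intro divide_right_mono var, simp)
    also have "\<dots> = inverse (real (Suc m) ^ 2)"
      unfolding of_nat_power by (simp add: power2_eq_square field_simps del: of_nat_Suc)
    finally show ?thesis by (simp add: ennreal_leI)
  qed
  have "(\<integral>\<^sup>+\<omega>. (\<Sum>m. ennreal (f m \<omega>)) \<partial>M) = (\<Sum>m. \<integral>\<^sup>+\<omega>. ennreal (f m \<omega>) \<partial>M)"
    by (rule nn_integral_suminf) measurable
  also have "\<dots> \<le> (\<Sum>m. ennreal (inverse (real (Suc m) ^ 2)))"
    using nn by (intro suminf_le summableI) auto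
  also have "\<dots> = ennreal (\<Sum>m. inverse (real (Suc m) ^ 2))"
    using inverse_power_summable[of 2, where 'a=real] by (intro suminf_ennreal2) (auto simp: summable_Suc_iff[of "\<lambda>m. inverse (real m ^ 2)"] simp del: of_nat_Suc)
  also have "\<dots> < \<infinity>" by simp
  finally have "AE \<omega> in M. (\<Sum>m. ennreal (f m \<omega>)) \<noteq> \<infinity>"
    by (intro nn_integral_noteq_infinite) auto
  then show ?thesis
  proof eventually_elim
    fix \<omega> assume fin: "(\<Sum>m. ennreal (f m \<omega>)) \<noteq> \<infinity>"
    have "0 \<le> f m \<omega>" for m unfolding f_def by (rule zero_le_power2)
    then have "summable (\<lambda>m. f m \<omega>)"
      using fin[unfolded infinity_ennreal_def] by (rule summable_suminf_not_top)
    then have "(\<lambda>m. f m \<omega>) \<longlonglongrightarrow> 0" by (rule summable_LIMSEQ_zero)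
    then have "(\<lambda>m. sqrt (f m \<omega>)) \<longlonglongrightarrow> sqrt 0" by (rule tendsto_real_sqrt)
    then have "(\<lambda>m. \<bar>?S ((Suc m)\<^sup>2) \<omega> / real ((Suc m)\<^sup>2)\<bar>) \<longlonglongrightarrow> 0"
      unfolding f_def by (simp only: real_sqrt_abs real_sqrt_zero)
    then have "(\<lambda>m. ?S ((Suc m)\<^sup>2) \<omega> / real ((Suc m)\<^sup>2)) \<longlonglongrightarrow> 0"
      by (simp only: tendsto_rabs_zero_iff)
    then have "(\<lambda>m. ?S (m\<^sup>2) \<omega> / real (m\<^sup>2)) \<longlonglongrightarrow> 0"
      by (rule LIMSEQ_imp_Suc)
    then show "(\<lambda>n. ?S n \<omega> / real n) \<longlonglongrightarrow> 0"
      by (intro average_tendsto_0_squares) (use bd in auto)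
  qed
qed

section \<open>Conditionally i.i.d. sequences\<close>

lemma prod_indicator_eq:
  "(\<Prod>i\<in>J. indicator (B i) (X i \<omega>) :: real) = (if \<forall>i\<in>J. X i \<omega> \<in> B i then 1 else 0)" if "finite J"
  using that by (induction J) (auto split: split_indicator)

lemma (in prob_space) cond_iid_givenI:
  assumes X[measurable]: "\<And>n. X n \<in> borel_measurable M" and G: "subalgebra M G"
    and \<eta>: "\<eta> \<in> measurable G (prob_algebra borel)"
    and eq: "\<And>A n B. A \<in> sets G \<Longrightarrow> (\<And>i. B i \<in> sets borel) \<Longrightarrow>
      (\<integral>\<omega>. indicator A \<omega> * (\<Prod>i<n. indicator (B i) (X i \<omega>)) \<partial>M) =
      (\<integral>\<omega>. indicator A \<omega> * (\<Prod>i<n. measure (\<eta> \<omega>) (B i)) \<partial>M)"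
  shows "cond_iid_given M G X \<eta>"
  unfolding cond_iid_given_def
proof (intro conjI allI impI G \<eta>)
  fix n :: nat and B' :: "nat \<Rightarrow> real set"
  assume B': "\<forall>i<n. B' i \<in> sets borel"
  \<comment> \<open>The definition constrains the sets only below \<open>n\<close>; the extension by
    \<open>UNIV\<close> makes the whole family Borel.\<close>
  define B where "B i = (if i < n then B' i else UNIV)" for i
  have B[measurable]: "B i \<in> sets borel" for i using B' by (simp add: B_def)
  have BB: "(\<Prod>i<n. measure (\<eta> \<omega>) (B' i)) = (\<Prod>i<n. measure (\<eta> \<omega>) (B i))"
    "{\<omega>\<in>space M. \<forall>i<n. X i \<omega> \<in> B' i} = {\<omega>\<in>space M. \<forall>i<n. X i \<omega> \<in> B i}" for \<omega>
    by (auto simp: B_def)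
  interpret sigma_finite_subalgebra M G by (rule sigma_finite_subalgebra_of[OF G])
  have \<eta>M: "\<eta> \<in> measurable M (prob_algebra borel)" by (rule measurable_from_subalg[OF G \<eta>])
  have \<eta>B: "(\<lambda>\<omega>. measure (\<eta> \<omega>) (B i)) \<in> borel_measurable G" for i
    by (rule measurable_kernel_measure[OF \<eta> B])
  have 01: "measure (\<eta> \<omega>) (B i) \<le> 1" if "\<omega> \<in> space M" for i \<omega>
    using measurable_space[OF \<eta>M that] by (auto simp: space_prob_algebra prob_space.prob_le_1)
  show "AE \<omega> in M. real_cond_exp M G (indicator {\<omega> \<in> space M. \<forall>i<n. X i \<omega> \<in> B' i}) \<omega>
        = (\<Prod>i<n. measure (\<eta> \<omega>) (B' i))"
    unfolding BB
  proof (rule real_cond_exp_charact)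
    let ?i = "indicator {\<omega> \<in> space M. \<forall>i<n. X i \<omega> \<in> B i} :: 'a \<Rightarrow> real"
    show "integrable M ?i"
      by (rule integrable_bounded[where c=1]) (auto split: split_indicator)
    show pG: "(\<lambda>\<omega>. \<Prod>i<n. measure (\<eta> \<omega>) (B i)) \<in> borel_measurable G"
      by (intro borel_measurable_prod \<eta>B)
    show "integrable M (\<lambda>\<omega>. \<Prod>i<n. measure (\<eta> \<omega>) (B i))"
    proof (rule integrable_const_bound[where B=1])
      show "AE \<omega> in M. norm (\<Prod>i<n. measure (\<eta> \<omega>) (B i)) \<le> 1"
        by (rule AE_I2) (auto simp: abs_prod intro!: prod_le_1 01)
      show "(\<lambda>\<omega>. \<Prod>i<n. measure (\<eta> \<omega>) (B i)) \<in> borel_measurable M"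
        by (rule measurable_from_subalg[OF G pG])
    qed
    fix A assume A: "A \<in> sets G"
    have "(\<integral>\<omega>\<in>A. ?i \<omega> \<partial>M) = (\<integral>\<omega>. indicator A \<omega> * (\<Prod>i<n. indicator (B i) (X i \<omega>)) \<partial>M)"
      unfolding set_lebesgue_integral_def
      by (intro Bochner_Integration.integral_cong) (auto simp: prod_indicator_eq split: split_indicator)
    also have "\<dots> = (\<integral>\<omega>\<in>A. (\<Prod>i<n. measure (\<eta> \<omega>) (B i)) \<partial>M)"
      unfolding set_lebesgue_integral_def using eq[OF A B] by simp
    finally show "(\<integral>\<omega>\<in>A. ?i \<omega> \<partial>M) = (\<integral>\<omega>\<in>A. (\<Prod>i<n. measure (\<eta> \<omega>) (B i)) \<partial>M)" .
  qed
qed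

text \<open>The probability of finitely many constraints is an integrated product in which the
  indices occur only as labels, and an injective relabelling leaves a finite product unchanged.
  Injectivity covers strictly increasing sequences and permutations alike.\<close>

lemma (in prob_space) same_law_inj:
  assumes X[measurable]: "\<And>n. X n \<in> borel_measurable M" and k: "inj k"
    and eq: "\<And>J A. finite J \<Longrightarrow> (\<And>j. A j \<in> sets borel) \<Longrightarrow>
      measure M {\<omega>\<in>space M. \<forall>j\<in>J. X j \<omega> \<in> A j} = (\<integral>\<omega>. (\<Prod>j\<in>J. measure (\<eta> \<omega>) (A j)) \<partial>M)"
  shows "same_law M X (\<lambda>n. X (k n))"
  unfolding same_law_def
proof (rule measure_eqI_PiM_infinite)
  let ?P = "PiM UNIV (\<lambda>_. borel) :: (nat \<Rightarrow> real) measure"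
  have S: "(\<lambda>\<omega> n. X n \<omega>) \<in> measurable M ?P" "(\<lambda>\<omega> n. X (k n) \<omega>) \<in> measurable M ?P"
    by (rule measurable_PiM_single'; auto)+
  show "finite_measure (distr M ?P (\<lambda>\<omega> n. X n \<omega>))"
    by (rule finite_measure_distr[OF S(1)])
  fix A' :: "nat \<Rightarrow> real set" and J :: "nat set"
  assume J: "finite J" and A': "\<And>j. j \<in> J \<Longrightarrow> A' j \<in> sets borel"
  define A where "A j = (if j \<in> J then A' j else UNIV)" for j
  have A: "A j \<in> sets borel" for j using A' by (simp add: A_def)
  let ?E = "prod_emb UNIV (\<lambda>_. borel) J (Pi\<^sub>E J A')"
  have E: "?E \<in> sets ?P" using J A' by (intro sets_PiM_I) auto
  have 1: "(\<lambda>\<omega> n. X n \<omega>) -` ?E \<inter> space M = {\<omega>\<in>space M. \<forall>j\<in>J. X j \<omega> \<in> A j}"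
    by (auto simp: prod_emb_def A_def PiE_iff)
  have 2: "(\<lambda>\<omega> n. X (k n) \<omega>) -` ?E \<inter> space M = {\<omega>\<in>space M. \<forall>i\<in>k ` J. X i \<omega> \<in> A (inv k i)}"
    by (auto simp: prod_emb_def A_def PiE_iff inv_f_f[OF k])
  have "measure M {\<omega>\<in>space M. \<forall>i\<in>k ` J. X i \<omega> \<in> A (inv k i)}
      = (\<integral>\<omega>. (\<Prod>i\<in>k ` J. measure (\<eta> \<omega>) (A (inv k i))) \<partial>M)"
    using J A by (intro eq) auto
  also have "\<dots> = (\<integral>\<omega>. (\<Prod>j\<in>J. measure (\<eta> \<omega>) (A j)) \<partial>M)"
    using inj_on_subset[OF k subset_UNIV] by (subst prod.reindex) (auto simp: inv_f_f[OF k])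
  also have "\<dots> = measure M {\<omega>\<in>space M. \<forall>j\<in>J. X j \<omega> \<in> A j}"
    using J A by (intro eq[symmetric])
  finally show "emeasure (distr M ?P (\<lambda>\<omega> n. X n \<omega>)) ?E = emeasure (distr M ?P (\<lambda>\<omega> n. X (k n) \<omega>)) ?E"
    unfolding emeasure_distr[OF S(1) E] emeasure_distr[OF S(2) E] 1 2 by (simp add: emeasure_eq_measure)
qed simp_all

text \<open>Right-continuity lets countably many levels decide, so that almost sure equality of
  random distributions can be tested outside a single null set.\<close>

lemma measure_eqI_cdf_rat:
  assumes M: "real_distribution M" and N: "real_distribution N"
    and eq: "\<And>q. q \<in> \<rat> \<Longrightarrow> measure M {..q} = measure N {..q}"
  shows "M = N"
proof (rule cdf_unique[OF M N], rule ext)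
  fix x
  have le: "cdf P x \<le> cdf R x" if P: "real_distribution P" and R: "real_distribution R"
    and eq: "\<And>q. q \<in> \<rat> \<Longrightarrow> measure P {..q} = measure R {..q}" for P R
  proof (rule ccontr)
    interpret P: real_distribution P by fact
    interpret R: real_distribution R by fact
    assume "\<not> cdf P x \<le> cdf R x"
    then have "eventually (\<lambda>z. cdf R z < cdf P x) (at_right x)"
      using R.cdf_is_right_cont[of x] by (auto simp: continuous_within order_tendsto_iff)
    then obtain b where b: "x < b" "\<And>z. x < z \<Longrightarrow> z < b \<Longrightarrow> cdf R z < cdf P x"
      by (auto simp: eventually_at_right_field)
    then obtain q where q: "q \<in> \<rat>" "x < q" "q < b" using Rats_dense_in_real by blast
    have "cdf P x \<le> cdf P q" using q by (intro P.cdf_nondecreasing) auto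
    with b(2)[of q] q eq[of q] show False by (simp add: cdf_def)
  qed
  show "cdf M x = cdf N x"
    using le[OF M N eq] le[OF N M eq[symmetric]] by (rule antisym)
qed

section \<open>Chains with an idempotent Markov copula\<close>

text \<open>Copulas no longer occur here: what they provide is expressed by laws and a single
  transition kernel for all times. \<open>two_step_law\<close> is what remains of
  idempotence.\<close>

locale idempotent_chain = prob_space M for M :: "'a measure" +
  fixes X :: "nat \<Rightarrow> 'a \<Rightarrow> real" and \<kappa> :: "real \<Rightarrow> real measure"
  assumes X[measurable]: "\<And>n. X n \<in> borel_measurable M"
    and kernel: "\<And>n. cond_kernel M (X n) (X (Suc n)) \<kappa>"
    and markov: "\<And>n B H c. B \<in> sets borel \<Longrightarrow> H \<in> borel_measurable (PiM {..n} (\<lambda>_. borel)) \<Longrightarrow>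
      (\<And>h. \<bar>H h\<bar> \<le> (c::real)) \<Longrightarrow>
      (\<integral>\<omega>. H (\<lambda>i\<in>{..n}. X i \<omega>) * indicator B (X (Suc n) \<omega>) \<partial>M) =
      (\<integral>\<omega>. H (\<lambda>i\<in>{..n}. X i \<omega>) * measure (\<kappa> (X n \<omega>)) B \<partial>M)"
    and law: "\<And>n. distr M borel (X n) = distr M borel (X 0)"
    and pair_law: "\<And>n. distr M (borel \<Otimes>\<^sub>M borel) (\<lambda>\<omega>. (X n \<omega>, X (Suc n) \<omega>))
      = distr M (borel \<Otimes>\<^sub>M borel) (\<lambda>\<omega>. (X 0 \<omega>, X 1 \<omega>))"
    and two_step_law: "distr M (borel \<Otimes>\<^sub>M borel) (\<lambda>\<omega>. (X 0 \<omega>, X 2 \<omega>))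
      = distr M (borel \<Otimes>\<^sub>M borel) (\<lambda>\<omega>. (X 0 \<omega>, X 1 \<omega>))"
begin

lemma \<kappa>[measurable]: "\<kappa> \<in> measurable borel (prob_algebra borel)"
  using kernel[of 0] by (simp add: cond_kernel_def)

lemma \<kappa>_le_1: "measure (\<kappa> x) B \<le> 1"
  by (rule kernel_measure_le_1[OF \<kappa>])

lemma integral_law:
  fixes f :: "real \<Rightarrow> real"
  assumes "f \<in> borel_measurable borel"
  shows "(\<integral>\<omega>. f (X n \<omega>) \<partial>M) = (\<integral>\<omega>. f (X 0 \<omega>) \<partial>M)"
  using integral_distr[OF X assms, of n] integral_distr[OF X assms, of 0] law[of n] by simp

section \<open>Constancy of the kernel along the chain\<close>

lemma kernel_step:
  assumes B[measurable]: "B \<in> sets borel"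
  shows "AE \<omega> in M. measure (\<kappa> (X (Suc n) \<omega>)) B = measure (\<kappa> (X n \<omega>)) B"
proof -
  define h where "h x = measure (\<kappa> x) B" for x
  have h[measurable]: "h \<in> borel_measurable borel" unfolding h_def by measurable
  have h01: "0 \<le> h x" "h x \<le> 1" for x by (auto simp: h_def \<kappa>_le_1)
  have habs: "\<bar>h x\<bar> \<le> 1" for x using h01 by simp
  have P: "(\<lambda>\<omega>. (X i \<omega>, X j \<omega>)) \<in> measurable M (borel \<Otimes>\<^sub>M borel)" for i j by measurable
  have int: "integrable M (\<lambda>\<omega>. h (X i \<omega>) * h (X j \<omega>))" for i j
    by (rule integrable_bounded[where c=1]) (auto simp: abs_mult h01 mult_le_one)
  \<comment> \<open>Three facts give the mixed moment: the Markov property at time 1, the two-step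
    law replacing \<open>X 2\<close> by \<open>X 1\<close>, and the kernel from time 0 to time
    1.\<close>
  have "(\<integral>\<omega>. h (X 0 \<omega>) * indicator B (X 2 \<omega>) \<partial>M) = (\<integral>\<omega>. h (X 0 \<omega>) * h (X 1 \<omega>) \<partial>M)"
  proof -
    have m: "(\<lambda>z. h (z 0)) \<in> borel_measurable (PiM {..1::nat} (\<lambda>_. borel))"
    proof -
      have "(\<lambda>z. z 0) \<in> borel_measurable (PiM {..1::nat} (\<lambda>_. borel :: real measure))"
        by (rule measurable_component_singleton) simp
      from measurable_compose[OF this h] show ?thesis .
    qed
    have "(\<integral>\<omega>. h ((\<lambda>i\<in>{..1}. X i \<omega>) 0) * indicator B (X (Suc 1) \<omega>) \<partial>M)
       = (\<integral>\<omega>. h ((\<lambda>i\<in>{..1}. X i \<omega>) 0) * h (X 1 \<omega>) \<partial>M)"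
      unfolding h_def[of "X 1 _"] by (rule markov[OF B m, of 1]) (simp add: h01)
    then show ?thesis by (simp add: numeral_2_eq_2)
  qed
  moreover have "(\<integral>\<omega>. h (X 0 \<omega>) * indicator B (X 2 \<omega>) \<partial>M) = (\<integral>\<omega>. h (X 0 \<omega>) * indicator B (X 1 \<omega>) \<partial>M)"
    using integral_distr[OF P[of 0 2], of "\<lambda>p. h (fst p) * indicator B (snd p)"]
      integral_distr[OF P[of 0 1], of "\<lambda>p. h (fst p) * indicator B (snd p)"] two_step_law
    by simp
  moreover have "(\<integral>\<omega>. h (X 0 \<omega>) * indicator B (X 1 \<omega>) \<partial>M) = (\<integral>\<omega>. h (X 0 \<omega>) * h (X 0 \<omega>) \<partial>M)"
    using cond_kernel_integral[OF X X kernel B h habs, of 0] by (simp add: h_def)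
  ultimately have cross: "(\<integral>\<omega>. h (X 0 \<omega>) * h (X 1 \<omega>) \<partial>M) = (\<integral>\<omega>. h (X 0 \<omega>) * h (X 0 \<omega>) \<partial>M)"
    by simp
  have "(\<integral>\<omega>. (h (X 1 \<omega>) - h (X 0 \<omega>))\<^sup>2 \<partial>M)
     = (\<integral>\<omega>. h (X 1 \<omega>) * h (X 1 \<omega>) - 2 * (h (X 0 \<omega>) * h (X 1 \<omega>)) + h (X 0 \<omega>) * h (X 0 \<omega>) \<partial>M)"
    by (intro Bochner_Integration.integral_cong refl) (simp add: power2_eq_square algebra_simps)
  also have "\<dots> = (\<integral>\<omega>. h (X 1 \<omega>) * h (X 1 \<omega>) \<partial>M) - (\<integral>\<omega>. h (X 0 \<omega>) * h (X 0 \<omega>) \<partial>M)"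
    by (simp add: int cross del: One_nat_def)
  also have "\<dots> = 0"
    using integral_law[of "\<lambda>x. h x * h x" 1] by simp
  finally have "(\<integral>\<omega>. (h (X 1 \<omega>) - h (X 0 \<omega>))\<^sup>2 \<partial>M) = 0" .
  moreover have "integrable M (\<lambda>\<omega>. (h (X 1 \<omega>) - h (X 0 \<omega>))\<^sup>2)"
  proof (rule integrable_bounded[where c=1])
    show "\<bar>(h (X 1 \<omega>) - h (X 0 \<omega>))\<^sup>2\<bar> \<le> 1" for \<omega>
      using h01[of "X 1 \<omega>"] h01[of "X 0 \<omega>"] by (auto simp: abs_square_le_1 abs_le_iff)
  qed measurable
  ultimately have "AE \<omega> in M. (h (X 1 \<omega>) - h (X 0 \<omega>))\<^sup>2 = 0"
    by (subst (asm) integral_nonneg_eq_0_iff_AE) auto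
  then have "AE \<omega> in M. h (X 1 \<omega>) = h (X 0 \<omega>)" by simp
  \<comment> \<open>The equality is read as a property of the joint law, which is the same for all
    consecutive pairs.\<close>
  then have "AE p in distr M (borel \<Otimes>\<^sub>M borel) (\<lambda>\<omega>. (X 0 \<omega>, X 1 \<omega>)). h (snd p) = h (fst p)"
    by (subst AE_distr_iff[OF P]) auto
  then have "AE \<omega> in M. h (X (Suc n) \<omega>) = h (X n \<omega>)"
    unfolding pair_law[of n, symmetric] by (subst (asm) AE_distr_iff[OF P]) auto
  then show ?thesis by (simp add: h_def)
qed

lemma kernel_const:
  assumes B: "B \<in> sets borel"
  shows "AE \<omega> in M. measure (\<kappa> (X n \<omega>)) B = measure (\<kappa> (X 0 \<omega>)) B"
proof (induction n)
  case (Suc n)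
  with kernel_step[OF B, of n] show ?case by eventually_elim simp
qed simp

text \<open>So far the null set depended on the Borel set; the countably many half-lines with
  rational endpoint leave one null set for the whole measure.\<close>

lemma kernel_const_AE: "AE \<omega> in M. \<kappa> (X n \<omega>) = \<kappa> (X 0 \<omega>)"
proof -
  have "AE \<omega> in M. \<forall>q\<in>\<rat>. measure (\<kappa> (X n \<omega>)) {..q} = measure (\<kappa> (X 0 \<omega>)) {..q}"
    using kernel_const by (subst AE_ball_countable[OF countable_rat]) auto
  then show ?thesis
    by eventually_elim (auto intro: measure_eqI_cdf_rat real_distribution_kernel[OF \<kappa>])
qed

section \<open>Conditional independence and its consequences\<close>

text \<open>The last variable is removed first: its indicator becomes
  \<open>measure (\<kappa> (X n \<omega>)) (B n)\<close>, which almost surely is a function of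
  \<open>X 0\<close> and is absorbed into \<open>g\<close>. For this reason the induction keeps
  \<open>g\<close> general.\<close>

lemma integral_prod_successors:
  assumes g: "g \<in> borel_measurable borel" and bd: "\<And>x. \<bar>g x\<bar> \<le> (c::real)"
    and B: "\<And>i. B i \<in> sets borel"
  shows "(\<integral>\<omega>. g (X 0 \<omega>) * (\<Prod>i<n. indicator (B i) (X (Suc i) \<omega>)) \<partial>M)
       = (\<integral>\<omega>. g (X 0 \<omega>) * (\<Prod>i<n. measure (\<kappa> (X 0 \<omega>)) (B i)) \<partial>M)"
  using g bd
proof (induction n arbitrary: g)
  case (Suc n)
  note [measurable] = Suc.prems(1) B
  have coord: "(\<lambda>h. h i) \<in> borel_measurable (PiM {..n} (\<lambda>_. borel :: real measure))" if "i \<le> n" for i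
    using that by (intro measurable_component_singleton) auto
  let ?H = "\<lambda>h. g (h 0) * (\<Prod>i<n. indicator (B i) (h (Suc i)))"
  have Hm: "?H \<in> borel_measurable (PiM {..n} (\<lambda>_. borel))"
    by (intro borel_measurable_times borel_measurable_prod measurable_compose[OF coord Suc.prems(1)]
        measurable_compose[OF coord borel_measurable_indicator[OF B]]) auto
  have prod_bd: "\<bar>g x * (\<Prod>i<n. indicator (B i) (y i))\<bar> \<le> c" for x y
    using mult_mono[OF Suc.prems(2)[of x], of "\<Prod>i<n. indicator (B i) (y i)" 1]
      order_trans[OF abs_ge_zero Suc.prems(2)]
    by (simp add: abs_mult prod_nonneg prod_le_1)
  have "(\<integral>\<omega>. g (X 0 \<omega>) * (\<Prod>i<Suc n. indicator (B i) (X (Suc i) \<omega>)) \<partial>M)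
      = (\<integral>\<omega>. ?H (\<lambda>i\<in>{..n}. X i \<omega>) * indicator (B n) (X (Suc n) \<omega>) \<partial>M)"
    by (intro Bochner_Integration.integral_cong refl) (simp add: mult.assoc)
  also have "\<dots> = (\<integral>\<omega>. ?H (\<lambda>i\<in>{..n}. X i \<omega>) * measure (\<kappa> (X n \<omega>)) (B n) \<partial>M)"
    by (rule markov[OF B Hm, where c=c]) (rule prod_bd)
  also have "\<dots> = (\<integral>\<omega>. (g (X 0 \<omega>) * measure (\<kappa> (X 0 \<omega>)) (B n)) * (\<Prod>i<n. indicator (B i) (X (Suc i) \<omega>)) \<partial>M)"
  proof (rule integral_cong_AE)
    show "AE \<omega> in M. ?H (\<lambda>i\<in>{..n}. X i \<omega>) * measure (\<kappa> (X n \<omega>)) (B n)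
      = (g (X 0 \<omega>) * measure (\<kappa> (X 0 \<omega>)) (B n)) * (\<Prod>i<n. indicator (B i) (X (Suc i) \<omega>))"
      using kernel_const[OF B, of n n] by eventually_elim simp
  qed simp_all
  also have "\<dots> = (\<integral>\<omega>. (g (X 0 \<omega>) * measure (\<kappa> (X 0 \<omega>)) (B n)) * (\<Prod>i<n. measure (\<kappa> (X 0 \<omega>)) (B i)) \<partial>M)"
  proof (rule Suc.IH)
    show "\<bar>g x * measure (\<kappa> x) (B n)\<bar> \<le> c" for x
      using mult_mono[OF Suc.prems(2)[of x] \<kappa>_le_1[of x "B n"]] order_trans[OF abs_ge_zero Suc.prems(2)[of x]]
      by (simp add: abs_mult)
  qed measurable
  finally show ?case by (simp add: mult_ac)
qed simp

lemma integral_prod: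
  assumes S: "S \<in> sets (prob_algebra borel)" and B: "\<And>i. B i \<in> sets borel"
  shows "(\<integral>\<omega>. indicator S (\<kappa> (X 0 \<omega>)) * (\<Prod>i<n. indicator (B i) (X i \<omega>)) \<partial>M)
       = (\<integral>\<omega>. indicator S (\<kappa> (X 0 \<omega>)) * (\<Prod>i<n. measure (\<kappa> (X 0 \<omega>)) (B i)) \<partial>M :: real)"
proof (cases n)
  case (Suc m)
  note [measurable] = S B
  define \<Psi> where "\<Psi> P = indicator S P * (\<Prod>i<m. measure P (B (Suc i)))" for P :: "real measure"
  have \<Psi>m[measurable]: "(\<lambda>x. \<Psi> (\<kappa> x)) \<in> borel_measurable borel"
    unfolding \<Psi>_def by measurable
  have \<Psi>bd: "\<bar>\<Psi> (\<kappa> x)\<bar> \<le> 1" for x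
    by (auto simp: \<Psi>_def abs_prod intro!: prod_le_1 \<kappa>_le_1 split: split_indicator)
  have "(\<integral>\<omega>. indicator S (\<kappa> (X 0 \<omega>)) * (\<Prod>i<n. indicator (B i) (X i \<omega>)) \<partial>M)
    = (\<integral>\<omega>. (indicator S (\<kappa> (X 0 \<omega>)) * indicator (B 0) (X 0 \<omega>)) * (\<Prod>i<m. indicator (B (Suc i)) (X (Suc i) \<omega>)) \<partial>M :: real)"
    unfolding Suc prod.lessThan_Suc_shift by (simp add: mult.assoc)
  also have "\<dots> = (\<integral>\<omega>. (indicator S (\<kappa> (X 0 \<omega>)) * indicator (B 0) (X 0 \<omega>)) * (\<Prod>i<m. measure (\<kappa> (X 0 \<omega>)) (B (Suc i))) \<partial>M)"
    by (rule integral_prod_successors[where g="\<lambda>x. indicator S (\<kappa> x) * indicator (B 0) x" and c=1])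
       (auto split: split_indicator)
  also have "\<dots> = (\<integral>\<omega>. \<Psi> (\<kappa> (X 0 \<omega>)) * indicator (B 0) (X 0 \<omega>) \<partial>M)"
    by (intro Bochner_Integration.integral_cong refl) (simp add: \<Psi>_def mult_ac)
  \<comment> \<open>The integrand involves \<open>X 0\<close> alone, so equal marginals allow the
    shift to time 1. There \<open>\<kappa> (X 1 \<omega>)\<close> is exchanged for
    \<open>\<kappa> (X 0 \<omega>)\<close>, after which \<open>X 1\<close> can be conditioned on
    \<open>X 0\<close>.\<close>
  also have "\<dots> = (\<integral>\<omega>. \<Psi> (\<kappa> (X 1 \<omega>)) * indicator (B 0) (X 1 \<omega>) \<partial>M)"
    by (rule integral_law[of "\<lambda>x. \<Psi> (\<kappa> x) * indicator (B 0) x", symmetric]) measurable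
  also have "\<dots> = (\<integral>\<omega>. \<Psi> (\<kappa> (X 0 \<omega>)) * indicator (B 0) (X 1 \<omega>) \<partial>M)"
    using kernel_const_AE[of 1] by (intro integral_cong_AE) auto
  also have "\<dots> = (\<integral>\<omega>. \<Psi> (\<kappa> (X 0 \<omega>)) * measure (\<kappa> (X 0 \<omega>)) (B 0) \<partial>M)"
    using cond_kernel_integral[OF X X kernel B \<Psi>m \<Psi>bd, of 0 0] by simp
  also have "\<dots> = (\<integral>\<omega>. indicator S (\<kappa> (X 0 \<omega>)) * (\<Prod>i<n. measure (\<kappa> (X 0 \<omega>)) (B i)) \<partial>M)"
    unfolding Suc prod.lessThan_Suc_shift \<Psi>_def by (simp add: mult_ac)
  finally show ?thesis .
qed simp

lemma prob_finite:
  assumes J: "finite J" and A: "\<And>j. A j \<in> sets borel"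
  shows "measure M {\<omega>\<in>space M. \<forall>j\<in>J. X j \<omega> \<in> A j} = (\<integral>\<omega>. (\<Prod>j\<in>J. measure (\<kappa> (X 0 \<omega>)) (A j)) \<partial>M)"
proof -
  obtain n where n: "J \<subseteq> {..<n}" using finite_nat_bounded[OF J] by blast
  define B where "B j = (if j \<in> J then A j else UNIV)" for j
  have B[measurable]: "B j \<in> sets borel" for j using A by (simp add: B_def)
  have \<kappa>U: "measure (\<kappa> x) UNIV = 1" for x
    using prob_space.prob_space[OF prob_space_kernel[OF \<kappa>, of x]] sets_eq_imp_space_eq[OF sets_kernel[OF \<kappa>, of x]] by simp
  have "measure M {\<omega>\<in>space M. \<forall>j\<in>J. X j \<omega> \<in> A j} = measure M {\<omega>\<in>space M. \<forall>j\<in>{..<n}. X j \<omega> \<in> B j}"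
    using n by (intro arg_cong[where f="measure M"]) (auto simp: B_def)
  also have "\<dots> = (\<integral>\<omega>. indicator {\<omega>\<in>space M. \<forall>j\<in>{..<n}. X j \<omega> \<in> B j} \<omega> \<partial>M)"
    by simp
  \<comment> \<open>The new factor is identically 1; it only brings the integral into the shape of
    \<open>integral_prod\<close>.\<close>
  also have "\<dots> = (\<integral>\<omega>. indicator (space (prob_algebra borel)) (\<kappa> (X 0 \<omega>)) * (\<Prod>i<n. indicator (B i) (X i \<omega>)) \<partial>M)"
    using measurable_space[OF \<kappa>]
    by (intro Bochner_Integration.integral_cong refl) (auto simp: prod_indicator_eq split: split_indicator)
  also have "\<dots> = (\<integral>\<omega>. indicator (space (prob_algebra borel)) (\<kappa> (X 0 \<omega>)) * (\<Prod>i<n. measure (\<kappa> (X 0 \<omega>)) (B i)) \<partial>M)"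
    by (rule integral_prod[OF sets.top B])
  also have "\<dots> = (\<integral>\<omega>. (\<Prod>j\<in>J. measure (\<kappa> (X 0 \<omega>)) (A j)) \<partial>M)"
  proof (intro Bochner_Integration.integral_cong refl)
    fix \<omega>
    have "(\<Prod>i<n. measure (\<kappa> (X 0 \<omega>)) (B i)) = (\<Prod>j\<in>J. measure (\<kappa> (X 0 \<omega>)) (A j))"
      using n by (intro prod.mono_neutral_cong_right) (auto simp: B_def \<kappa>U)
    then show "indicator (space (prob_algebra borel)) (\<kappa> (X 0 \<omega>)) * (\<Prod>i<n. measure (\<kappa> (X 0 \<omega>)) (B i))
       = (\<Prod>j\<in>J. measure (\<kappa> (X 0 \<omega>)) (A j))"
      using measurable_space[OF \<kappa>] by simp
  qed
  finally show ?thesis .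
qed

lemma same_law_X: "inj k \<Longrightarrow> same_law M X (\<lambda>n. X (k n))"
  by (rule same_law_inj[OF X _ prob_finite])

lemma cond_iid_X: "cond_iid M X (\<lambda>\<omega>. \<kappa> (X 0 \<omega>))"
proof (rule cond_iid_givenI[OF X])
  have m: "(\<lambda>\<omega>. \<kappa> (X 0 \<omega>)) \<in> measurable M (prob_algebra borel)" by measurable
  show "subalgebra M (sigma_distribution M (\<lambda>\<omega>. \<kappa> (X 0 \<omega>)))"
    by (rule subalgebra_vimage[OF m])
  show "(\<lambda>\<omega>. \<kappa> (X 0 \<omega>)) \<in> measurable (sigma_distribution M (\<lambda>\<omega>. \<kappa> (X 0 \<omega>))) (prob_algebra borel)"
    using measurable_space[OF m] by (intro measurable_vimage_algebra1) auto
  fix A n and B :: "nat \<Rightarrow> real set"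
  assume A: "A \<in> sets (sigma_distribution M (\<lambda>\<omega>. \<kappa> (X 0 \<omega>)))" and B: "\<And>i. B i \<in> sets borel"
  obtain S where S: "S \<in> sets (prob_algebra borel)" "A = (\<lambda>\<omega>. \<kappa> (X 0 \<omega>)) -` S \<inter> space M"
    using A m by (rule vimage_algebra_setE)
  have *: "(\<integral>\<omega>. indicator A \<omega> * f \<omega> \<partial>M) = (\<integral>\<omega>. indicator S (\<kappa> (X 0 \<omega>)) * f \<omega> \<partial>M)" for f :: "'a \<Rightarrow> real"
    by (intro Bochner_Integration.integral_cong refl) (auto simp: S(2) split: split_indicator)
  show "(\<integral>\<omega>. indicator A \<omega> * (\<Prod>i<n. indicator (B i) (X i \<omega>)) \<partial>M) =
      (\<integral>\<omega>. indicator A \<omega> * (\<Prod>i<n. measure (\<kappa> (X 0 \<omega>)) (B i)) \<partial>M)"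
    unfolding * by (rule integral_prod[OF S(1) B])
qed

text \<open>Here the test events are arbitrary events of \<open>X 0\<close>, for which
  \<open>integral_prod_successors\<close> with an indicator as \<open>g\<close> suffices because the
  sequence starts at time 1.\<close>

lemma cond_iid_given_X0:
  "cond_iid_given M (sigma_rv M (X 0)) (\<lambda>n. X (Suc n)) (\<lambda>\<omega>. \<kappa> (X 0 \<omega>))"
proof (rule cond_iid_givenI)
  show "subalgebra M (sigma_rv M (X 0))" by (rule subalgebra_vimage[OF X])
  show "(\<lambda>\<omega>. \<kappa> (X 0 \<omega>)) \<in> measurable (sigma_rv M (X 0)) (prob_algebra borel)"
    by (rule measurable_compose[OF measurable_vimage_algebra1 \<kappa>]) auto
  fix A n and B :: "nat \<Rightarrow> real set"
  assume A: "A \<in> sets (sigma_rv M (X 0))" and B: "\<And>i. B i \<in> sets borel"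
  obtain S where S: "S \<in> sets borel" "A = X 0 -` S \<inter> space M"
    using A X by (rule vimage_algebra_setE)
  have *: "(\<integral>\<omega>. indicator A \<omega> * f \<omega> \<partial>M) = (\<integral>\<omega>. indicator S (X 0 \<omega>) * f \<omega> \<partial>M)" for f :: "'a \<Rightarrow> real"
    by (intro Bochner_Integration.integral_cong refl) (auto simp: S(2) split: split_indicator)
  show "(\<integral>\<omega>. indicator A \<omega> * (\<Prod>i<n. indicator (B i) (X (Suc i) \<omega>)) \<partial>M) =
      (\<integral>\<omega>. indicator A \<omega> * (\<Prod>i<n. measure (\<kappa> (X 0 \<omega>)) (B i)) \<partial>M)"
    unfolding * using S(1) by (intro integral_prod_successors[where c=1] B) auto
qed measurable

text \<open>The inclusion is exact, without completion by null sets, because the random distribution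
  is chosen pointwise as a measurable function of \<open>X 0\<close>.\<close>

lemma sigma_distribution_le: "sets (sigma_distribution M (\<lambda>\<omega>. \<kappa> (X 0 \<omega>))) \<subseteq> sets (sigma_rv M (X 0))"
proof
  fix A assume A: "A \<in> sets (sigma_distribution M (\<lambda>\<omega>. \<kappa> (X 0 \<omega>)))"
  have m: "(\<lambda>\<omega>. \<kappa> (X 0 \<omega>)) \<in> measurable M (prob_algebra borel)" by measurable
  obtain S where S: "S \<in> sets (prob_algebra borel)" "A = (\<lambda>\<omega>. \<kappa> (X 0 \<omega>)) -` S \<inter> space M"
    using A m by (rule vimage_algebra_setE)
  have "A = X 0 -` (\<kappa> -` S) \<inter> space M" using S(2) by auto
  moreover have "\<kappa> -` S \<in> sets borel" using measurable_sets[OF \<kappa> S(1)] by simp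
  ultimately show "A \<in> sets (sigma_rv M (X 0))" by (auto intro: in_vimage_algebra)
qed

text \<open>Given the random distribution, the indicators of \<open>X k \<in> B\<close> are
  independent with common mean \<open>h (X 0 \<omega>)\<close>. Centred by this mean they are
  orthogonal, and the strong law applies.\<close>

lemma empirical_limit_X: "empirical_limit M X (\<lambda>\<omega>. \<kappa> (X 0 \<omega>))"
  unfolding empirical_limit_def
proof
  fix B :: "real set" assume B[measurable]: "B \<in> sets borel"
  define h where "h x = measure (\<kappa> x) B" for x
  have h[measurable]: "h \<in> borel_measurable borel" unfolding h_def by measurable
  have h01: "0 \<le> h x" "h x \<le> 1" "\<bar>h x\<bar> \<le> 1" for x by (auto simp: h_def \<kappa>_le_1)
  let ?I = "\<lambda>k \<omega>. indicator B (X k \<omega>) :: real"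
  let ?Z = "\<lambda>k \<omega>. ?I k \<omega> - h (X 0 \<omega>)"
  \<comment> \<open>The detour through time \<open>k\<close> and then time 1 treats all
    \<open>k\<close> alike, including \<open>k = 0\<close>, where the kernel cannot be applied
    directly.\<close>
  have one: "(\<integral>\<omega>. ?I k \<omega> * h (X 0 \<omega>) \<partial>M) = (\<integral>\<omega>. h (X 0 \<omega>) * h (X 0 \<omega>) \<partial>M)" for k
  proof -
    have "(\<integral>\<omega>. ?I k \<omega> * h (X 0 \<omega>) \<partial>M) = (\<integral>\<omega>. ?I k \<omega> * h (X k \<omega>) \<partial>M)"
      using kernel_const[OF B, of k] by (intro integral_cong_AE) (auto simp: h_def)
    also have "\<dots> = (\<integral>\<omega>. ?I 1 \<omega> * h (X 1 \<omega>) \<partial>M)"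
      using integral_law[of "\<lambda>x. indicator B x * h x" k] integral_law[of "\<lambda>x. indicator B x * h x" 1] by simp
    also have "\<dots> = (\<integral>\<omega>. h (X 0 \<omega>) * ?I 1 \<omega> \<partial>M)"
      using kernel_const[OF B, of 1] by (intro integral_cong_AE) (auto simp: h_def)
    also have "\<dots> = (\<integral>\<omega>. h (X 0 \<omega>) * h (X 0 \<omega>) \<partial>M)"
      using cond_kernel_integral[OF X X kernel B h h01(3), of 0] by (simp add: h_def)
    finally show ?thesis .
  qed
  have "AE \<omega> in M. (\<lambda>n. (\<Sum>k<n. ?Z k \<omega>) / real n) \<longlonglongrightarrow> 0"
  proof (rule strong_law_orthogonal)
    show "\<bar>?Z k \<omega>\<bar> \<le> 1" for k \<omega> using h01[of "X 0 \<omega>"] by (auto split: split_indicator)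
    fix j k :: nat assume jk: "j \<noteq> k"
    have ii: "integrable M (\<lambda>\<omega>. ?I j \<omega> * ?I k \<omega>)" and ih: "integrable M (\<lambda>\<omega>. ?I i \<omega> * h (X 0 \<omega>))"
      and hh: "integrable M (\<lambda>\<omega>. h (X 0 \<omega>) * h (X 0 \<omega>))" for i
      by (rule integrable_bounded[where c=1]; auto simp: h01 abs_mult mult_le_one split: split_indicator)+
    have two: "(\<integral>\<omega>. ?I j \<omega> * ?I k \<omega> \<partial>M) = (\<integral>\<omega>. h (X 0 \<omega>) * h (X 0 \<omega>) \<partial>M)"
    proof -
      have "(\<integral>\<omega>. ?I j \<omega> * ?I k \<omega> \<partial>M) = (\<integral>\<omega>. indicator {\<omega>\<in>space M. \<forall>i\<in>{j, k}. X i \<omega> \<in> B} \<omega> \<partial>M)"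
        by (intro Bochner_Integration.integral_cong refl) (auto split: split_indicator)
      also have "\<dots> = measure M {\<omega>\<in>space M. \<forall>i\<in>{j, k}. X i \<omega> \<in> B}"
        by simp
      also have "\<dots> = (\<integral>\<omega>. (\<Prod>i\<in>{j, k}. measure (\<kappa> (X 0 \<omega>)) B) \<partial>M)"
        by (rule prob_finite) auto
      finally show ?thesis using jk by (simp add: h_def)
    qed
    have "(\<integral>\<omega>. ?Z j \<omega> * ?Z k \<omega> \<partial>M)
      = (\<integral>\<omega>. ?I j \<omega> * ?I k \<omega> - ?I j \<omega> * h (X 0 \<omega>) - ?I k \<omega> * h (X 0 \<omega>) + h (X 0 \<omega>) * h (X 0 \<omega>) \<partial>M)"
      by (intro Bochner_Integration.integral_cong refl) (simp add: algebra_simps)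
    also have "\<dots> = 0"
      by (simp add: ii ih hh one two)
    finally show "(\<integral>\<omega>. ?Z j \<omega> * ?Z k \<omega> \<partial>M) = 0" .
  qed measurable
  then show "AE \<omega> in M. (\<lambda>n. (\<Sum>k<n. indicator B (X k \<omega>)) / real n) \<longlonglongrightarrow> measure (\<kappa> (X 0 \<omega>)) B"
  proof eventually_elim
    fix \<omega> assume "(\<lambda>n. (\<Sum>k<n. ?Z k \<omega>) / real n) \<longlonglongrightarrow> 0"
    then have "(\<lambda>n. (\<Sum>k<n. ?Z k \<omega>) / real n + h (X 0 \<omega>)) \<longlonglongrightarrow> 0 + h (X 0 \<omega>)"
      by (intro tendsto_intros)
    \<comment> \<open>Only for \<open>n > 0\<close>: at \<open>n = 0\<close> both quotients are 0 by
      convention, and the added mean would remain.\<close>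
    moreover have "eventually (\<lambda>n. (\<Sum>k<n. ?Z k \<omega>) / real n + h (X 0 \<omega>) = (\<Sum>k<n. ?I k \<omega>) / real n) sequentially"
      using eventually_gt_at_top[of 0]
      by eventually_elim (simp add: sum_subtractf diff_divide_distrib)
    ultimately show "(\<lambda>n. (\<Sum>k<n. ?I k \<omega>) / real n) \<longlonglongrightarrow> measure (\<kappa> (X 0 \<omega>)) B"
      by (simp add: h_def Lim_transform_eventually)
  qed
qed

end

section \<open>From the copula hypotheses to the laws of the chain\<close>

lemma idempotent_chain_of_copula:
  assumes mc: "markov_chain M X"
    and law: "\<And>n. distr M borel (X n) = distr M borel (X 0)"
    and C: "\<And>n. copula_of M (X n) (X (Suc n)) C"
    and idem: "markov_product C C = C"
  shows "\<exists>\<kappa>. idempotent_chain M X \<kappa>"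
proof -
  interpret prob_space M by (rule markov_chain_onD[OF mc])
  have X[measurable]: "X n \<in> borel_measurable M" for n using markov_chain_onD[OF mc] by blast
  have C_cdf: "measure M {\<omega>\<in>space M. X m \<omega> \<le> x \<and> X n \<omega> \<le> y}
      = C (cdf (distr M borel (X 0)) x) (cdf (distr M borel (X 0)) y)"
    if "copula_of M (X m) (X n) C" for m n x y
    using that law[of m] law[of n] by (simp add: copula_of_def Let_def)
  \<comment> \<open>With equal marginals the copula determines the joint distribution function. This
    serves both for consecutive pairs and for times 0 and 2.\<close>
  have pair: "distr M (borel \<Otimes>\<^sub>M borel) (\<lambda>\<omega>. (X m \<omega>, X n \<omega>))
      = distr M (borel \<Otimes>\<^sub>M borel) (\<lambda>\<omega>. (X 0 \<omega>, X 1 \<omega>))" if "copula_of M (X m) (X n) C" for m n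
    using C_cdf[OF that] C_cdf[OF C[of 0]] by (intro distr_pair_eqI prob_space_axioms X) simp
  obtain \<kappa> where k0: "cond_kernel M (X 0) (X 1) \<kappa>" using cond_kernel_exists[OF X X] by blast
  then have \<kappa>[measurable]: "\<kappa> \<in> measurable borel (prob_algebra borel)"
    by (simp add: cond_kernel_def)
  have P: "(\<lambda>\<omega>. (X i \<omega>, X j \<omega>)) \<in> measurable M (borel \<Otimes>\<^sub>M borel)" for i j by measurable
  have kernel: "cond_kernel M (X n) (X (Suc n)) \<kappa>" for n
    unfolding cond_kernel_def
  proof (intro conjI ballI \<kappa>)
    fix A B :: "real set" assume [measurable]: "A \<in> sets borel" "B \<in> sets borel"
    let ?f = "\<lambda>p. indicator A (fst p) * indicator B (snd p) :: real"
    let ?g = "\<lambda>p. indicator A (fst p) * measure (\<kappa> (fst p)) B"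
    have "(\<integral>\<omega>. ?f (X n \<omega>, X (Suc n) \<omega>) \<partial>M) = (\<integral>\<omega>. ?f (X 0 \<omega>, X 1 \<omega>) \<partial>M)"
      using integral_distr[OF P, of ?f n "Suc n"] integral_distr[OF P, of ?f 0 1] pair[OF C[of n]] by simp
    also have "\<dots> = (\<integral>\<omega>. ?g (X 0 \<omega>, X 1 \<omega>) \<partial>M)"
      using k0 by (simp add: cond_kernel_def)
    also have "\<dots> = (\<integral>\<omega>. ?g (X n \<omega>, X (Suc n) \<omega>) \<partial>M)"
      using integral_distr[OF P, of ?g n "Suc n"] integral_distr[OF P, of ?g 0 1] pair[OF C[of n]] by simp
    finally show "(\<integral>\<omega>. indicator A (X n \<omega>) * indicator B (X (Suc n) \<omega>) \<partial>M) =
        (\<integral>\<omega>. indicator A (X n \<omega>) * measure (\<kappa> (X n \<omega>)) B \<partial>M)" by simp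
  qed
  have "idempotent_chain M X \<kappa>"
  proof unfold_locales
    show "(\<integral>\<omega>. H (\<lambda>i\<in>{..n}. X i \<omega>) * indicator B (X (Suc n) \<omega>) \<partial>M) =
      (\<integral>\<omega>. H (\<lambda>i\<in>{..n}. X i \<omega>) * measure (\<kappa> (X n \<omega>)) B \<partial>M)"
      if "B \<in> sets borel" "H \<in> borel_measurable (PiM {..n} (\<lambda>_. borel))" "\<And>h. \<bar>H h\<bar> \<le> c" for n B H and c :: real
      by (rule markov_chain_on_integral[OF mc _ kernel that]) simp
  qed (rule X kernel law pair C copula_of_idempotent[OF mc C idem])+
  then show ?thesis by blast
qed

text \<open>A copula carries no information about the marginals, whereas spreadability forces them
  to coincide; their equality is therefore a separate hypothesis. One witness,
  \<open>\<kappa> (X 0 \<omega>)\<close>, serves all four properties of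
  \<open>\<eta>\<close>.\<close>

theorem mainTheorem4:
  fixes M :: "'a measure" and X :: "nat \<Rightarrow> 'a \<Rightarrow> real" and C :: "real \<Rightarrow> real \<Rightarrow> real"
  assumes "markov_chain M X"
    and "\<And>n. distr M borel (X n) = distr M borel (X 0)"
    and "\<And>n. copula_of M (X n) (X (Suc n)) C"
    and "C \<star> C = C"
  shows "spreadable M X \<and> exchangeable M X \<and>
    (\<exists>\<eta>. cond_iid M X \<eta> \<and> empirical_limit M X \<eta> \<and>
         sets (sigma_distribution M \<eta>) \<subseteq> sets (sigma_rv M (X 0)) \<and>
         cond_iid_given M (sigma_rv M (X 0)) (\<lambda>n. X (Suc n)) \<eta>)"
proof -
  obtain \<kappa> where "idempotent_chain M X \<kappa>"
    using idempotent_chain_of_copula[OF assms] by blast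
  then interpret idempotent_chain M X \<kappa> .
  have "spreadable M X"
    unfolding spreadable_def using same_law_X by (blast intro: strict_mono_imp_inj_on)
  moreover have "exchangeable M X"
    unfolding exchangeable_def using same_law_X by (blast intro: bij_is_inj)
  ultimately show ?thesis
    using cond_iid_X empirical_limit_X sigma_distribution_le cond_iid_given_X0 by blast
qed

end
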